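(* For each $c\in(0,1)$ let $R_{CT}(c)$ denote the Bayes risk $R$ of the Chernoff test with parameter $c$ (defined in the context). Then, as $c\to0$, $$R_{CT}(c)\;\sim\;\frac{-c\log c}{I^*(M,K)}\;\sim\;\inf_\Gamma R(\Gamma),$$ the infimum being over all admissible policies, and $a(c)\sim b(c)$ meaning $\lim_{c\to0}a(c)/b(c)=1$.
   Context: Model. Fix integers $M\ge 2$ and $1\le K\le M$. There are $M$ cells, exactly one of which contains a target. Hypothesis $H_m$: the target is in cell $m$, with prior $\pi_m\in(0,1)$, $\sum_m\pi_m=1$. Let $f,g$ be probability densities w.r.t. a common measure with $0<D(g\|f)<\infty$, $0<D(f\|g)<\infty$ ($D(p\|q)=\int p\log(p/q)$), and assume $\log(g(Y)/f(Y))$ has a finite moment generating function near $0$ when $Y\sim f$ and when $Y\sim g$. At each time $n=1,2,\dots$ a set $\phi(n)$ of $K$ distinct cells is selected and an observation $y_k(n)$ is obtained from each $k\in\phi(n)$; under $H_m$ all observations are independent, $y_m(n)\sim g$, $y_k(n)\sim f$ for $k\neq m$. An admissible policy $\Gamma=(\tau,\delta,\boldsymbol\phi)$: a (deterministic or randomized) selection rule depending on past selections and observations, a stopping time $\tau$, and a decision $\delta\in\{1,\dots,M\}$. $\mathbf P_m,\mathbf E_m$: probability/expectation under $H_m$. $\alpha_m(\Gamma)=\mathbf P_m(\delta\ne m)$, $P_e=\sum_m\pi_m\alpha_m$, and for cost $c>0$ per time step, $R(\Gamma)=P_e(\Gamma)+c\sum_m\pi_m\mathbf E_m(\tau)$.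 Notation. $\ell_k(n)=\log\frac{g(y_k(n))}{f(y_k(n))}$; $\mathbf 1_k(n)$ indicates that cell $k$ is observed at time $n$; $S_k(n)=\sum_{t=1}^n\ell_k(t)\mathbf 1_k(t)$; $m^{(i)}(n)$ is the cell with the $i$-th largest $S_k(n)$ (ties arbitrary); $\Delta S(n)=S_{m^{(1)}(n)}(n)-S_{m^{(2)}(n)}(n)$. $I^*(M,K)=D(g\|f)+D(f\|g)$ if $K=M$; $I^*(M,K)=\max\big[\frac{KD(f\|g)}{M-1},D(g\|f)+\frac{(K-1)D(f\|g)}{M-1}\big]$ if $K<M$. Chernoff test (as specialized to this problem) with parameter $c$: if $K=M$, all cells are observed at each time. If $K<M$ and $D(g\|f)\ge D(f\|g)/(M-1)$, at each time it selects the current leader $m^{(1)}$ together with $K-1$ further cells drawn uniformly at random from the remaining $M-1$ cells; if $K<M$ and $D(g\|f)<D(f\|g)/(M-1)$, it selects $K$ cells drawn uniformly at random from $\{m^{(2)},\dots,m^{(M)}\}$ (rankings use the sums from the previous time step). It stops at $\tau=\inf\{n:\Delta S(n)\ge-\log c\}$ and declares $\delta=m^{(1)}(\tau)$. *)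

theory Defs
  imports "HOL-Probability.Probability"
begin

definition KL :: "'a measure \<Rightarrow> ('a \<Rightarrow> real) \<Rightarrow> ('a \<Rightarrow> real) \<Rightarrow> real" where
  "KL \<mu> p q = (\<integral>x. p x * ln (p x / q x) \<partial>\<mu>)"

definition Istar :: "nat \<Rightarrow> nat \<Rightarrow> real \<Rightarrow> real \<Rightarrow> real" where
  "Istar M K Dgf Dfg =
     (if K = M then Dgf + Dfg
      else max (real K * Dfg / (real M - 1)) (Dgf + (real K - 1) * Dfg / (real M - 1)))"

text \<open>Cells are 0..M-1, times are 0,1,2,... (time index t here = paper time t+1).
  A sample consists of an array of observations obs(t,k) (time t, cell k) and an array of
  independent uniform [0,1] seeds used for randomization.\<close>

type_synonym 'a hist = "(nat set \<times> (nat \<Rightarrow> 'a)) list"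
type_synonym seeds = "nat \<times> nat \<Rightarrow> real"
type_synonym 'a sample = "(nat \<times> nat \<Rightarrow> 'a) \<times> seeds"

record 'a policy =
  sel :: "seeds \<Rightarrow> 'a hist \<Rightarrow> nat set"
  stp :: "seeds \<Rightarrow> 'a hist \<Rightarrow> bool"
  dec :: "seeds \<Rightarrow> 'a hist \<Rightarrow> nat"

fun hist :: "('a, 'b) policy_scheme \<Rightarrow> 'a sample \<Rightarrow> nat \<Rightarrow> 'a hist" where
  "hist p \<omega> 0 = []"
| "hist p \<omega> (Suc n) =
     (let S = sel p (snd \<omega>) (hist p \<omega> n)
      in hist p \<omega> n @ [(S, restrict (\<lambda>k. fst \<omega> (n, k)) S)])"

definition stopped :: "('a, 'b) policy_scheme \<Rightarrow> 'a sample \<Rightarrow> nat \<Rightarrow> bool" where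
  "stopped p \<omega> n = stp p (snd \<omega>) (hist p \<omega> n)"

definition stop_time :: "('a, 'b) policy_scheme \<Rightarrow> 'a sample \<Rightarrow> ennreal" where
  "stop_time p \<omega> = (if \<exists>n. stopped p \<omega> n then of_nat (LEAST n. stopped p \<omega> n) else \<infinity>)"

definition decision_error :: "('a, 'b) policy_scheme \<Rightarrow> nat \<Rightarrow> 'a sample \<Rightarrow> bool" where
  "decision_error p m \<omega> =
     ((\<nexists>n. stopped p \<omega> n) \<or> dec p (snd \<omega>) (hist p \<omega> (LEAST n. stopped p \<omega> n)) \<noteq> m)"

definition obs_space :: "'a measure \<Rightarrow> ('a \<Rightarrow> real) \<Rightarrow> ('a \<Rightarrow> real) \<Rightarrow> nat \<Rightarrow> (nat \<times> nat \<Rightarrow> 'a) measure" where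
  "obs_space \<mu> f g m =
     (\<Pi>\<^sub>M tk\<in>UNIV. if snd tk = m then density \<mu> (\<lambda>x. ennreal (g x)) else density \<mu> (\<lambda>x. ennreal (f x)))"

definition seed_space :: "seeds measure" where
  "seed_space = (\<Pi>\<^sub>M tk\<in>UNIV. uniform_measure lborel {0..1::real})"

definition sample_space :: "'a measure \<Rightarrow> ('a \<Rightarrow> real) \<Rightarrow> ('a \<Rightarrow> real) \<Rightarrow> nat \<Rightarrow> 'a sample measure" where
  "sample_space \<mu> f g m = obs_space \<mu> f g m \<Otimes>\<^sub>M seed_space"

definition admissible :: "nat \<Rightarrow> nat \<Rightarrow> 'a measure \<Rightarrow> ('a \<Rightarrow> real) \<Rightarrow> ('a \<Rightarrow> real) \<Rightarrow> 'a policy \<Rightarrow> bool" where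
  "admissible M K \<mu> f g p =
     ((\<forall>\<xi> h. sel p \<xi> h \<subseteq> {..<M} \<and> card (sel p \<xi> h) = K \<and> dec p \<xi> h < M) \<and>
      (\<forall>m<M. \<forall>n.
         (\<lambda>\<omega>. sel p (snd \<omega>) (hist p \<omega> n)) \<in> measurable (sample_space \<mu> f g m) (count_space UNIV) \<and>
         (\<lambda>\<omega>. stopped p \<omega> n) \<in> measurable (sample_space \<mu> f g m) (count_space UNIV) \<and>
         (\<lambda>\<omega>. dec p (snd \<omega>) (hist p \<omega> n)) \<in> measurable (sample_space \<mu> f g m) (count_space UNIV)))"

definition bayes_risk :: "nat \<Rightarrow> 'a measure \<Rightarrow> ('a \<Rightarrow> real) \<Rightarrow> ('a \<Rightarrow> real) \<Rightarrow> (nat \<Rightarrow> real) \<Rightarrow> real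
    \<Rightarrow> 'a policy \<Rightarrow> ennreal" where
  "bayes_risk M \<mu> f g \<pi> c p =
     (\<Sum>m<M. ennreal (\<pi> m) *
        emeasure (sample_space \<mu> f g m) {\<omega> \<in> space (sample_space \<mu> f g m). decision_error p m \<omega>})
     + ennreal c * (\<Sum>m<M. ennreal (\<pi> m) * (\<integral>\<^sup>+\<omega>. stop_time p \<omega> \<partial>sample_space \<mu> f g m))"

definition Ssum :: "('a \<Rightarrow> real) \<Rightarrow> ('a \<Rightarrow> real) \<Rightarrow> 'a hist \<Rightarrow> nat \<Rightarrow> real" where
  "Ssum f g h k = sum_list (map (\<lambda>(S, y). if k \<in> S then ln (g (y k) / f (y k)) else 0) h)"

text \<open>Leader m^(1) and runner-up m^(2); ties broken by an arbitrary (fixed) choice.\<close>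
definition leader :: "nat \<Rightarrow> ('a \<Rightarrow> real) \<Rightarrow> ('a \<Rightarrow> real) \<Rightarrow> 'a hist \<Rightarrow> nat" where
  "leader M f g h = (ARG_MAX (Ssum f g h) k. k < M)"

definition runner_up :: "nat \<Rightarrow> ('a \<Rightarrow> real) \<Rightarrow> ('a \<Rightarrow> real) \<Rightarrow> 'a hist \<Rightarrow> nat" where
  "runner_up M f g h = (ARG_MAX (Ssum f g h) k. k < M \<and> k \<noteq> leader M f g h)"

definition gap :: "nat \<Rightarrow> ('a \<Rightarrow> real) \<Rightarrow> ('a \<Rightarrow> real) \<Rightarrow> 'a hist \<Rightarrow> real" where
  "gap M f g h = Ssum f g h (leader M f g h) - Ssum f g h (runner_up M f g h)"

text \<open>A uniformly random r-subset of A at time n: the r elements of A with the smallest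
  i.i.d. uniform seeds seeds(n,k) (ties, a null event, broken by index).\<close>
definition rand_subset :: "seeds \<Rightarrow> nat \<Rightarrow> nat set \<Rightarrow> nat \<Rightarrow> nat set" where
  "rand_subset \<xi> n A r =
     {k \<in> A. card {j \<in> A. \<xi> (n, j) < \<xi> (n, k) \<or> (\<xi> (n, j) = \<xi> (n, k) \<and> j < k)} < r}"

definition chernoff_test :: "nat \<Rightarrow> nat \<Rightarrow> 'a measure \<Rightarrow> ('a \<Rightarrow> real) \<Rightarrow> ('a \<Rightarrow> real) \<Rightarrow> real \<Rightarrow> 'a policy" where
  "chernoff_test M K \<mu> f g c =
     \<lparr> sel = (\<lambda>\<xi> h. let L = leader M f g h in
                if K = M then {..<M}
                else if KL \<mu> g f \<ge> KL \<mu> f g / (real M - 1)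
                  then insert L (rand_subset \<xi> (length h) ({..<M} - {L}) (K - 1))
                else rand_subset \<xi> (length h) ({..<M} - {L}) K),
       stp = (\<lambda>\<xi> h. gap M f g h \<ge> - ln c),
       dec = (\<lambda>\<xi> h. leader M f g h) \<rparr>"

end

theory Submission
  imports Defs "HOL-Real_Asymp.Real_Asymp"
begin

text \<open>
  Lower bound: under \<open>H m\<close> the log-likelihood ratio against \<open>H j\<close>, stopped at \<open>min \<tau> n\<close>, has expectation at
  least \<open>a (1 - \<alpha>\<^sub>m) - exp a \<alpha>\<^sub>j\<close> in the limit, for every \<open>a\<close>. By Wald's identity, averaging over \<open>j \<noteq> m\<close> bounds
  this expectation by \<open>I* E\<^sub>m \<tau>\<close>: the average increment at a time step is linear in whether cell \<open>m\<close> is observed,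
  and \<open>I*\<close> is its maximum. With \<open>a = - ln c - b\<close> and \<open>b\<close> a large constant, the error terms are absorbed
  by the Bayes risk itself, which yields \<open>R \<ge> c (- ln c - b) / I*\<close> for all policies at once.

  Upper bound: at the stopping time of the Chernoff test the likelihood ratio of a wrong decision is at most \<open>c\<close>,
  so its error probability is \<open>O(c)\<close>. For the time, an exponential supermartingale shows that a wrong cell leads
  for more than \<open>\<kappa> n\<close> of the first \<open>n\<close> steps only with exponentially small probability, and a second one
  that \<open>S\<^sub>m - S\<^sub>j\<close> grows at rate \<open>I*\<close> while \<open>m\<close> leads. Hence \<open>P(\<tau> > n)\<close> is summable over
  \<open>n \<ge> - ln c / (I* - \<delta>)\<close>, uniformly in \<open>c\<close>.
\<close>

section \<open>Mixing coordinates of product measures\<close>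

text \<open>Adaptivity is the obstacle: which coordinates are read depends on the values read
  before, so the stopped likelihood ratio is not a product over a fixed index set. It is handled
  without filtrations or conditional expectations. All observations, read or not, form one infinite
  product measure, and the only operation is to redraw a single coordinate. Two facts carry the
  argument: overwriting a coordinate does not affect whether it is read, and overwriting one that is
  not read changes nothing up to the stopping time. Dependence on a set \<open>J\<close> of
  coordinates is likewise an equation, invariance under \<open>mix J\<close>.

  The lower bound averages over the alternatives because \<open>I*\<close> bounds the average drift,
  while the drift against one particular alternative can exceed it. The exponential moments near
  exponent 0 come from the one at exponent 1: \<open>exp (- llr)\<close> is the reciprocal density
  ratio and has mean 1 under \<open>g\<close>, and likewise \<open>exp llr\<close> under
  \<open>f\<close>. The random subsets of the test read only the seeds of the current time, which
  makes them independent of the history.\<close>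

definition mix :: "'i set \<Rightarrow> ('i \<Rightarrow> 'b) \<Rightarrow> ('i \<Rightarrow> 'b) \<Rightarrow> 'i \<Rightarrow> 'b" where
  "mix J x y = (\<lambda>i. if i \<in> J then x i else y i)"

lemma measurable_mix:
  assumes "\<And>i. sets (N' i) = sets (N i)" "\<And>i. sets (N'' i) = sets (N i)"
  shows "(\<lambda>z. mix J (fst z) (snd z)) \<in> measurable (PiM UNIV N \<Otimes>\<^sub>M PiM UNIV N') (PiM UNIV N'')"
proof (rule measurable_PiM_single')
  fix i
  have "(\<lambda>z. fst z i) \<in> measurable (PiM UNIV N \<Otimes>\<^sub>M PiM UNIV N') (N i)"
       "(\<lambda>z. snd z i) \<in> measurable (PiM UNIV N \<Otimes>\<^sub>M PiM UNIV N') (N' i)" by measurable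
  moreover have "measurable L (N i) = measurable L (N'' i)" "measurable L (N' i) = measurable L (N'' i)" for L :: "'z measure"
    using assms by (auto intro!: measurable_cong_sets)
  ultimately show "(\<lambda>z. mix J (fst z) (snd z) i) \<in> measurable (PiM UNIV N \<Otimes>\<^sub>M PiM UNIV N') (N'' i)"
    unfolding mix_def by (cases "i \<in> J") (auto cong: measurable_cong_sets simp: assms)
qed (use sets_eq_imp_space_eq[OF assms(1)] sets_eq_imp_space_eq[OF assms(2)]
     in \<open>auto simp: mix_def space_pair_measure space_PiM PiE_iff\<close>)

text \<open>A product measure is determined by its finite-dimensional boxes, and the preimage of a
  box under \<open>mix J\<close> is a product of two boxes, one for the coordinates in
  \<open>J\<close> and one for the rest.\<close>

lemma distr_PiM_mix:
  fixes J :: "'i set"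
  assumes P: "\<And>i. prob_space (N i)" "\<And>i. prob_space (N' i)"
    and sets: "\<And>i. sets (N' i) = sets (N i)"
  defines "N'' \<equiv> (\<lambda>i. if i \<in> J then N i else N' i)"
  shows "distr (PiM UNIV N \<Otimes>\<^sub>M PiM UNIV N') (PiM UNIV N'') (\<lambda>z. mix J (fst z) (snd z)) = PiM UNIV N''"
proof -
  have P'': "prob_space (N'' i)" for i using P by (simp add: N''_def)
  have sets'': "sets (N'' i) = sets (N i)" for i using sets by (simp add: N''_def)
  interpret A: product_prob_space N UNIV
    using P by (simp add: product_prob_space_def product_sigma_finite_def product_prob_space_axioms_def prob_space_imp_sigma_finite)
  interpret B: product_prob_space N' UNIV
    using P by (simp add: product_prob_space_def product_sigma_finite_def product_prob_space_axioms_def prob_space_imp_sigma_finite)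
  interpret C: product_prob_space N'' UNIV
    using P'' by (simp add: product_prob_space_def product_sigma_finite_def product_prob_space_axioms_def prob_space_imp_sigma_finite)
  interpret Q: pair_prob_space "PiM UNIV N" "PiM UNIV N'" ..
  have meas: "(\<lambda>z. mix J (fst z) (snd z)) \<in> measurable (PiM UNIV N \<Otimes>\<^sub>M PiM UNIV N') (PiM UNIV N'')"
    by (rule measurable_mix) (use sets sets'' in auto)
  show ?thesis
  proof (rule C.PiM_eq)
    fix I F assume I: "finite I" "I \<subseteq> UNIV" and F: "\<And>j. j \<in> I \<Longrightarrow> F j \<in> sets (N'' j)"
    let ?E = "prod_emb UNIV N'' I (Pi\<^sub>E I F)"
    let ?E1 = "prod_emb UNIV N (I \<inter> J) (Pi\<^sub>E (I \<inter> J) F)"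
    let ?E2 = "prod_emb UNIV N' (I - J) (Pi\<^sub>E (I - J) F)"
    have sp: "space (N' i) = space (N i)" "space (N'' i) = space (N i)" for i
      using sets_eq_imp_space_eq[OF sets] sets_eq_imp_space_eq[OF sets''] by auto
    have F1: "\<And>j. j \<in> I \<inter> J \<Longrightarrow> F j \<in> sets (N j)" and F2: "\<And>j. j \<in> I - J \<Longrightarrow> F j \<in> sets (N' j)"
      using F unfolding N''_def by fastforce+
    have "?E \<in> sets (PiM UNIV N'')" using I F by (intro sets_PiM_I) auto
    then have "emeasure (distr (PiM UNIV N \<Otimes>\<^sub>M PiM UNIV N') (PiM UNIV N'') (\<lambda>z. mix J (fst z) (snd z))) ?E
       = emeasure (PiM UNIV N \<Otimes>\<^sub>M PiM UNIV N') ((\<lambda>z. mix J (fst z) (snd z)) -` ?E \<inter> space (PiM UNIV N \<Otimes>\<^sub>M PiM UNIV N'))"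
      by (simp add: emeasure_distr[OF meas])
    also have "(\<lambda>z. mix J (fst z) (snd z)) -` ?E \<inter> space (PiM UNIV N \<Otimes>\<^sub>M PiM UNIV N') = ?E1 \<times> ?E2"
    proof -
      have Fs: "x \<in> space (N i)" if "x \<in> F i" "i \<in> I" for x i
        using sets.sets_into_space[OF F[OF that(2)]] that(1) sp by auto
      show ?thesis
        by (auto simp: prod_emb_def space_pair_measure space_PiM mix_def PiE_iff sp Fs
            extensional_def split: if_splits)
    qed
    also have "emeasure (PiM UNIV N \<Otimes>\<^sub>M PiM UNIV N') (?E1 \<times> ?E2) = emeasure (PiM UNIV N) ?E1 * emeasure (PiM UNIV N') ?E2"
      using I F1 F2 by (intro B.emeasure_pair_measure_Times sets_PiM_I) auto
    also have "\<dots> = (\<Prod>i\<in>I \<inter> J. emeasure (N i) (F i)) * (\<Prod>i\<in>I - J. emeasure (N' i) (F i))"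
      using I F1 F2 by (subst A.emeasure_PiM_emb B.emeasure_PiM_emb, simp, simp, blast)+ simp
    also have "\<dots> = (\<Prod>i\<in>I \<inter> J. emeasure (N'' i) (F i)) * (\<Prod>i\<in>I - J. emeasure (N'' i) (F i))"
      by (intro arg_cong2[where f="(*)"] prod.cong) (auto simp: N''_def)
    also have "\<dots> = (\<Prod>i\<in>I. emeasure (N'' i) (F i))"
      using I by (subst prod.union_disjoint[symmetric]) (auto intro!: prod.cong)
    finally show "emeasure (distr (PiM UNIV N \<Otimes>\<^sub>M PiM UNIV N') (PiM UNIV N'') (\<lambda>z. mix J (fst z) (snd z))) ?E = \<dots>" .
  qed simp
qed

lemma nn_integral_PiM_mix:
  assumes P: "\<And>i. prob_space (N i)" "\<And>i. prob_space (N' i)"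
    and sets: "\<And>i. sets (N' i) = sets (N i)"
    and phi: "\<phi> \<in> borel_measurable (PiM UNIV N)"
  shows "(\<integral>\<^sup>+x. \<phi> x \<partial>PiM UNIV (\<lambda>i. if i \<in> J then N i else N' i))
       = (\<integral>\<^sup>+x. \<integral>\<^sup>+y. \<phi> (mix J x y) \<partial>PiM UNIV N' \<partial>PiM UNIV N)"
proof -
  let ?N = "\<lambda>i. if i \<in> J then N i else N' i"
  interpret B: prob_space "PiM UNIV N'" using P by (intro prob_space_PiM)
  have phi': "\<phi> \<in> borel_measurable (PiM UNIV ?N)"
    using phi by (subst measurable_cong_sets[OF sets_PiM_cong refl]) (auto simp: sets)
  have meas: "(\<lambda>z. mix J (fst z) (snd z)) \<in> measurable (PiM UNIV N \<Otimes>\<^sub>M PiM UNIV N') (PiM UNIV ?N)"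
    by (rule measurable_mix) (use sets in auto)
  have "(\<integral>\<^sup>+x. \<phi> x \<partial>PiM UNIV ?N) = (\<integral>\<^sup>+x. \<phi> x \<partial>distr (PiM UNIV N \<Otimes>\<^sub>M PiM UNIV N') (PiM UNIV ?N) (\<lambda>z. mix J (fst z) (snd z)))"
    by (simp add: distr_PiM_mix[OF P sets])
  also have "\<dots> = (\<integral>\<^sup>+z. \<phi> (mix J (fst z) (snd z)) \<partial>(PiM UNIV N \<Otimes>\<^sub>M PiM UNIV N'))"
    by (rule nn_integral_distr[OF meas]) (use phi' in simp)
  also have "\<dots> = (\<integral>\<^sup>+x. \<integral>\<^sup>+y. \<phi> (mix J x y) \<partial>PiM UNIV N' \<partial>PiM UNIV N)"
    by (subst B.nn_integral_fst[symmetric]) (auto intro!: measurable_compose[OF meas phi'])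
  finally show ?thesis .
qed

text \<open>The laws may differ only outside \<open>J\<close>, where \<open>\<phi>\<close> does not
  look: after mixing, the inner integral is that of a constant.\<close>

lemma nn_integral_PiM_relevant:
  assumes P: "\<And>i. prob_space (N i)" "\<And>i. prob_space (N' i)"
    and sets: "\<And>i. sets (N' i) = sets (N i)" and eq: "\<And>i. i \<in> J \<Longrightarrow> N' i = N i"
    and phi: "\<phi> \<in> borel_measurable (PiM UNIV N)"
    and J: "\<And>x y. \<phi> (mix J x y) = \<phi> x"
  shows "(\<integral>\<^sup>+x. \<phi> x \<partial>PiM UNIV N') = (\<integral>\<^sup>+x. \<phi> x \<partial>PiM UNIV N)"
proof -
  interpret B: prob_space "PiM UNIV N'" using P by (intro prob_space_PiM)
  have "(\<lambda>i. if i \<in> J then N i else N' i) = N'" using eq by auto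
  then show ?thesis
    using nn_integral_PiM_mix[OF P sets phi, of J] by (simp add: J B.emeasure_space_1)
qed

text \<open>Mixing two independent copies of the same law gives that law again; \<open>F\<close>
  then reads only the first copy and \<open>H\<close> only the second, so the double integral
  factors.\<close>

lemma nn_integral_PiM_indep:
  assumes P: "\<And>i. prob_space (N i)"
    and F: "F \<in> borel_measurable (PiM UNIV N)" and H: "H \<in> borel_measurable (PiM UNIV N)"
    and FJ: "\<And>x y. F (mix J x y) = F x" and HJ: "\<And>x y. H (mix J x y) = H y"
  shows "(\<integral>\<^sup>+x. F x * H x \<partial>PiM UNIV N) = (\<integral>\<^sup>+x. F x \<partial>PiM UNIV N) * (\<integral>\<^sup>+x. H x \<partial>PiM UNIV N)"
proof -
  have "(\<integral>\<^sup>+x. F x * H x \<partial>PiM UNIV N) = (\<integral>\<^sup>+x. \<integral>\<^sup>+y. F x * H y \<partial>PiM UNIV N \<partial>PiM UNIV N)"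
    using nn_integral_PiM_mix[OF P P refl, where \<phi>="\<lambda>x. F x * H x" and J=J] F H by (simp add: FJ HJ)
  also have "\<dots> = (\<integral>\<^sup>+x. F x * (\<integral>\<^sup>+y. H y \<partial>PiM UNIV N) \<partial>PiM UNIV N)"
    using H by (intro nn_integral_cong) (simp add: nn_integral_cmult)
  finally show ?thesis using F by (simp add: nn_integral_multc)
qed

lemma nn_integral_PiM_component:
  assumes P: "\<And>i. prob_space (N i)" and h: "h \<in> borel_measurable (N i)"
  shows "(\<integral>\<^sup>+x. h (x i) \<partial>PiM UNIV N) = (\<integral>\<^sup>+y. h y \<partial>N i)"
proof -
  have "(\<integral>\<^sup>+y. h y \<partial>N i) = (\<integral>\<^sup>+y. h y \<partial>distr (PiM UNIV N) (N i) (\<lambda>x. x i))"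
    by (subst distr_PiM_component) (auto simp: P)
  also have "\<dots> = (\<integral>\<^sup>+x. h (x i) \<partial>PiM UNIV N)" by (rule nn_integral_distr) (auto simp: h)
  finally show ?thesis by simp
qed

text \<open>The basic tool for changing laws and for averaging over one observation: mixing with
  \<open>J = - {i}\<close> takes everything but coordinate \<open>i\<close> from
  \<open>N\<close>.\<close>

lemma nn_integral_PiM_resample:
  assumes P: "\<And>i. prob_space (N i)" "prob_space D" "sets D = sets (N i)"
    and phi: "\<phi> \<in> borel_measurable (PiM UNIV N)"
  shows "(\<integral>\<^sup>+x. \<phi> x \<partial>PiM UNIV (N(i := D))) = (\<integral>\<^sup>+x. \<integral>\<^sup>+y. \<phi> (x(i := y)) \<partial>D \<partial>PiM UNIV N)"
proof -
  let ?N' = "N(i := D)"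
  have P': "prob_space (?N' j)" for j using P by auto
  have "(\<integral>\<^sup>+x. \<phi> x \<partial>PiM UNIV ?N') = (\<integral>\<^sup>+x. \<integral>\<^sup>+y. \<phi> (mix (- {i}) x y) \<partial>PiM UNIV ?N' \<partial>PiM UNIV N)"
  proof -
    have "(\<lambda>j. if j \<in> - {i} then N j else ?N' j) = ?N'" by auto
    then show ?thesis
      using nn_integral_PiM_mix[of N ?N' \<phi> "- {i}"] P P' phi by simp
  qed
  also have "\<dots> = (\<integral>\<^sup>+x. \<integral>\<^sup>+y. \<phi> (x(i := y i)) \<partial>PiM UNIV ?N' \<partial>PiM UNIV N)"
    by (intro nn_integral_cong arg_cong[where f=\<phi>]) (auto simp: mix_def)
  also have "\<dots> = (\<integral>\<^sup>+x. \<integral>\<^sup>+y. \<phi> (x(i := y)) \<partial>D \<partial>PiM UNIV N)"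
  proof (rule nn_integral_cong)
    fix x assume x: "x \<in> space (PiM UNIV N)"
    have "(\<lambda>y. x(i := y)) \<in> measurable (N i) (PiM UNIV N)"
    proof (rule measurable_PiM_single')
      fix j show "(\<lambda>y. (x(i := y)) j) \<in> measurable (N i) (N j)"
        using x by (cases "j = i") (auto simp: space_PiM PiE_iff)
    qed (use x in \<open>auto simp: space_PiM PiE_iff\<close>)
    then have "(\<lambda>y. x(i := y)) \<in> measurable D (PiM UNIV N)"
      using P(3) by (simp cong: measurable_cong_sets)
    then have "(\<lambda>y. \<phi> (x(i := y))) \<in> borel_measurable (?N' i)"
      using phi by simp
    from nn_integral_PiM_component[of ?N', OF P' this]
    show "(\<integral>\<^sup>+y. \<phi> (x(i := y i)) \<partial>PiM UNIV ?N') = (\<integral>\<^sup>+y. \<phi> (x(i := y)) \<partial>D)" by simp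
  qed
  finally show ?thesis .
qed

section \<open>Observations and change of law\<close>

definition upd :: "'a sample \<Rightarrow> nat \<times> nat \<Rightarrow> 'a \<Rightarrow> 'a sample" where
  "upd \<omega> i y = ((fst \<omega>)(i := y), snd \<omega>)"

lemma upd_simps [simp]: "snd (upd \<omega> i y) = snd \<omega>" "fst (upd \<omega> i y) j = (if j = i then y else fst \<omega> j)"
  by (auto simp: upd_def)

abbreviation unif :: "real measure" where "unif \<equiv> uniform_measure lborel {0..1}"

lemma prob_space_unif: "prob_space unif"
  by (intro prob_space_uniform_measure) auto

lemma prob_space_seed_space: "prob_space seed_space"
  unfolding seed_space_def by (intro prob_space_PiM prob_space_unif)

section \<open>Sample laws and redrawing of single observations\<close>

locale two_densities =
  fixes \<mu> :: "'a measure" and f g :: "'a \<Rightarrow> real"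
  assumes f_meas [measurable]: "f \<in> borel_measurable \<mu>" and g_meas [measurable]: "g \<in> borel_measurable \<mu>"
    and f_nonneg: "\<forall>x\<in>space \<mu>. 0 \<le> f x" and g_nonneg: "\<forall>x\<in>space \<mu>. 0 \<le> g x"
    and f_prob: "(\<integral>\<^sup>+x. ennreal (f x) \<partial>\<mu>) = 1" and g_prob: "(\<integral>\<^sup>+x. ennreal (g x) \<partial>\<mu>) = 1"
    and mutual_ac: "AE x in \<mu>. (f x = 0 \<longleftrightarrow> g x = 0)"
begin

definition Df :: "'a measure" where "Df = density \<mu> (\<lambda>x. ennreal (f x))"
definition Dg :: "'a measure" where "Dg = density \<mu> (\<lambda>x. ennreal (g x))"

definition llr :: "'a \<Rightarrow> real" where "llr y = ln (g y / f y)"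

text \<open>Indexed by an arbitrary set of (time, cell) pairs rather than by a cell, so that one
  hypothesis is reached from another by inserting single coordinates; \<open>{}\<close> is the
  reference law with \<open>f\<close> everywhere.\<close>

definition law :: "(nat \<times> nat) set \<Rightarrow> nat \<times> nat \<Rightarrow> 'a measure" where
  "law G i = (if i \<in> G then Dg else Df)"

definition Pr :: "(nat \<times> nat) set \<Rightarrow> 'a sample measure" where
  "Pr G = PiM UNIV (law G) \<Otimes>\<^sub>M seed_space"

text \<open>Carries the sigma-algebra common to all \<open>Pr G\<close>, so that measurability is
  established once for all hypotheses and all intermediate laws.\<close>

definition Om :: "'a sample measure" where
  "Om = PiM UNIV (\<lambda>_. \<mu>) \<Otimes>\<^sub>M PiM UNIV (\<lambda>_. borel)"

lemma sample_space_eq_Pr: "sample_space \<mu> f g m = Pr {i. snd i = m}"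
  unfolding sample_space_def obs_space_def Pr_def law_def Df_def Dg_def by simp

lemma llr_meas [measurable]: "llr \<in> borel_measurable \<mu>"
  unfolding llr_def by measurable

lemma sets_D [simp, measurable_cong]: "sets Df = sets \<mu>" "sets Dg = sets \<mu>"
  by (auto simp: Df_def Dg_def)

lemma sets_law [simp, measurable_cong]: "sets (law G i) = sets \<mu>"
  by (auto simp: law_def)

lemma sets_PiM_law: "sets (PiM UNIV (law G)) = sets (PiM UNIV (\<lambda>_. \<mu>))"
  by (intro sets_PiM_cong) auto

lemma sets_seed: "sets seed_space = sets (PiM UNIV (\<lambda>_. borel))"
  unfolding seed_space_def by (intro sets_PiM_cong) auto

lemma sets_Pr [simp, measurable_cong]: "sets (Pr G) = sets Om"
  unfolding Pr_def Om_def by (intro sets_pair_measure_cong sets_PiM_law sets_seed)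

lemma space_Pr [simp]: "space (Pr G) = space Om"
  by (rule sets_eq_imp_space_eq) simp

lemma prob_D: "prob_space Df" "prob_space Dg"
  unfolding Df_def Dg_def using f_prob g_prob
  by (auto intro!: prob_spaceI simp: emeasure_density cong: nn_integral_cong)

lemma prob_law: "prob_space (law G i)"
  using prob_D by (auto simp: law_def)

lemma prob_Pr: "prob_space (Pr G)"
  unfolding Pr_def
  by (intro prob_space_pair prob_space_PiM prob_law prob_space_seed_space)

lemma emeasure_Pr_UNIV [simp]: "emeasure (Pr G) (space Om) = 1"
  using prob_space.emeasure_space_1[OF prob_Pr[of G]] by simp

lemma measurable_upd: "(\<lambda>z. upd (fst z) i (snd z)) \<in> measurable (Om \<Otimes>\<^sub>M \<mu>) Om"
proof -
  have "(\<lambda>z. (fst (fst z))(i := snd z)) \<in> measurable (Om \<Otimes>\<^sub>M \<mu>) (PiM UNIV (\<lambda>_. \<mu>))"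
  proof (rule measurable_PiM_single')
    fix j show "(\<lambda>z. ((fst (fst z))(i := snd z)) j) \<in> measurable (Om \<Otimes>\<^sub>M \<mu>) \<mu>"
      unfolding Om_def by (cases "j = i") auto
  qed (auto simp: space_pair_measure Om_def space_PiM PiE_iff)
  then show ?thesis unfolding upd_def Om_def by measurable
qed

lemma measurable_upd_section:
  assumes "\<phi> \<in> borel_measurable Om" "\<omega> \<in> space Om"
  shows "(\<lambda>y. \<phi> (upd \<omega> i y)) \<in> borel_measurable \<mu>"
  using measurable_compose[OF measurable_Pair1'[OF assms(2)] measurable_compose[OF measurable_upd assms(1)], of i]
  by simp

lemma measurable_fst_Om [measurable]: "(\<lambda>\<omega>. fst \<omega> i) \<in> measurable Om \<mu>"
  unfolding Om_def by measurable

lemma measurable_snd_Om [measurable]: "(\<lambda>\<omega>. snd \<omega> i) \<in> borel_measurable Om"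
  unfolding Om_def by measurable

lemma measurable_Pr_pair:
  "\<phi> \<in> measurable Om N \<Longrightarrow> \<phi> \<in> measurable (PiM UNIV (law G) \<Otimes>\<^sub>M seed_space) N"
  using measurable_cong_sets[OF sets_Pr[of G, unfolded Pr_def] refl, of N] by simp

lemma nn_integral_Pr_obs:
  assumes "\<phi> \<in> borel_measurable Om"
  shows "(\<integral>\<^sup>+\<omega>. \<phi> \<omega> \<partial>Pr G) = (\<integral>\<^sup>+\<xi>. \<integral>\<^sup>+x. \<phi> (x, \<xi>) \<partial>PiM UNIV (law G) \<partial>seed_space)"
proof -
  interpret A: prob_space "PiM UNIV (law G)" by (intro prob_space_PiM prob_law)
  interpret B: prob_space seed_space by (rule prob_space_seed_space)
  interpret Q: pair_prob_space "PiM UNIV (law G)" seed_space ..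
  show ?thesis unfolding Pr_def
    by (rule Q.nn_integral_snd[symmetric])
       (rule measurable_Pr_pair[OF assms])
qed

lemma nn_integral_Pr_seeds:
  assumes "\<phi> \<in> borel_measurable Om"
  shows "(\<integral>\<^sup>+\<omega>. \<phi> \<omega> \<partial>Pr G) = (\<integral>\<^sup>+x. \<integral>\<^sup>+\<xi>. \<phi> (x, \<xi>) \<partial>seed_space \<partial>PiM UNIV (law G))"
proof -
  interpret B: prob_space seed_space by (rule prob_space_seed_space)
  show ?thesis unfolding Pr_def
    by (rule B.nn_integral_fst[symmetric])
       (rule measurable_Pr_pair[OF assms])
qed

lemma section_obs_meas:
  assumes "\<phi> \<in> borel_measurable Om" "\<xi> \<in> space seed_space"
  shows "(\<lambda>x. \<phi> (x, \<xi>)) \<in> borel_measurable (PiM UNIV (law G))"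
proof -
  have "\<phi> \<in> borel_measurable (PiM UNIV (law G) \<Otimes>\<^sub>M seed_space)"
    by (rule measurable_Pr_pair[OF assms(1)])
  then show ?thesis using assms(2) by measurable
qed

lemma section_seed_meas:
  assumes "\<phi> \<in> borel_measurable Om" "x \<in> space (PiM UNIV (law G))"
  shows "(\<lambda>\<xi>. \<phi> (x, \<xi>)) \<in> borel_measurable seed_space"
proof -
  have "\<phi> \<in> borel_measurable (PiM UNIV (law G) \<Otimes>\<^sub>M seed_space)"
    by (rule measurable_Pr_pair[OF assms(1)])
  then show ?thesis using assms(2) by measurable
qed

lemma resample_meas:
  assumes "\<phi> \<in> borel_measurable Om"
  shows "(\<lambda>\<omega>. \<integral>\<^sup>+y. \<phi> (upd \<omega> i y) \<partial>law G i) \<in> borel_measurable Om"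
proof -
  interpret L: prob_space "law G i" by (rule prob_law)
  have "(\<lambda>z. \<phi> (upd (fst z) i (snd z))) \<in> borel_measurable (Om \<Otimes>\<^sub>M law G i)"
    using measurable_compose[OF measurable_upd assms(1), of i]
    by (simp cong: measurable_cong_sets sets_pair_measure_cong)
  then show ?thesis
    by (intro L.borel_measurable_nn_integral) (simp add: case_prod_beta')
qed

text \<open>With \<open>G' = G\<close> this averages out the observation at \<open>i\<close> with
  all others held fixed, in place of a conditional expectation; with \<open>G'\<close> differing
  from \<open>G\<close> at \<open>i\<close> it is the first half of a change of law.\<close>

lemma resample:
  assumes phi: "\<phi> \<in> borel_measurable Om" and G: "G - {i} = G' - {i}"
  shows "(\<integral>\<^sup>+\<omega>. \<phi> \<omega> \<partial>Pr G) = (\<integral>\<^sup>+\<omega>. \<integral>\<^sup>+y. \<phi> (upd \<omega> i y) \<partial>law G i \<partial>Pr G')"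
proof -
  have law: "law G = (law G')(i := law G i)" using G by (auto simp: law_def fun_eq_iff)
  have "(\<integral>\<^sup>+\<omega>. \<phi> \<omega> \<partial>Pr G) = (\<integral>\<^sup>+\<xi>. \<integral>\<^sup>+x. \<phi> (x, \<xi>) \<partial>PiM UNIV (law G) \<partial>seed_space)"
    by (rule nn_integral_Pr_obs[OF phi])
  also have "\<dots> = (\<integral>\<^sup>+\<xi>. \<integral>\<^sup>+x. \<integral>\<^sup>+y. \<phi> (upd (x, \<xi>) i y) \<partial>law G i \<partial>PiM UNIV (law G') \<partial>seed_space)"
  proof (rule nn_integral_cong)
    fix \<xi> :: seeds assume xi: "\<xi> \<in> space seed_space"
    show "(\<integral>\<^sup>+x. \<phi> (x, \<xi>) \<partial>PiM UNIV (law G)) = (\<integral>\<^sup>+x. \<integral>\<^sup>+y. \<phi> (upd (x, \<xi>) i y) \<partial>law G i \<partial>PiM UNIV (law G'))"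
      using nn_integral_PiM_resample[where N="law G'" and D="law G i" and i=i and \<phi>="\<lambda>x. \<phi> (x, \<xi>)"] section_obs_meas[OF phi xi]
      by (simp add: law[symmetric] prob_law upd_def)
  qed
  also have "\<dots> = (\<integral>\<^sup>+\<omega>. \<integral>\<^sup>+y. \<phi> (upd \<omega> i y) \<partial>law G i \<partial>Pr G')"
    using resample_meas[OF phi, of G i] by (subst nn_integral_Pr_obs) auto
  finally show ?thesis .
qed

lemma nn_integral_Dg:
  assumes h: "h \<in> borel_measurable \<mu>"
  shows "(\<integral>\<^sup>+y. h y \<partial>Dg) = (\<integral>\<^sup>+y. h y * ennreal (exp (llr y)) \<partial>Df)"
proof -
  have "(\<integral>\<^sup>+y. h y \<partial>Dg) = (\<integral>\<^sup>+y. ennreal (g y) * h y \<partial>\<mu>)"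
    unfolding Dg_def using h by (subst nn_integral_density) auto
  also have "\<dots> = (\<integral>\<^sup>+y. ennreal (f y) * (h y * ennreal (exp (llr y))) \<partial>\<mu>)"
  proof (rule nn_integral_cong_AE)
    \<comment> \<open>The defaults \<open>x / 0 = 0\<close> and \<open>ln 0 = 0\<close> inside
      \<open>llr\<close> do no harm: by \<open>mutual_ac\<close> the densities vanish together
      almost everywhere, and there both sides are 0.\<close>
    show "AE y in \<mu>. ennreal (g y) * h y = ennreal (f y) * (h y * ennreal (exp (llr y)))"
      using mutual_ac AE_space
    proof eventually_elim
      case (elim y)
      show ?case
      proof (cases "f y = 0")
        case False
        then have "f y > 0" "g y > 0" using elim f_nonneg g_nonneg by (auto simp: order_less_le)
        then have "g y = f y * exp (llr y)" "f y \<ge> 0" by (auto simp: llr_def)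
        then have "ennreal (g y) = ennreal (f y) * ennreal (exp (llr y))"
          by (metis ennreal_mult' )
        then show ?thesis by (simp add: ac_simps)
      qed (use elim in auto)
    qed
  qed
  also have "\<dots> = (\<integral>\<^sup>+y. h y * ennreal (exp (llr y)) \<partial>Df)"
    unfolding Df_def using h by (subst nn_integral_density) auto
  finally show ?thesis .
qed

text \<open>The coordinate \<open>i\<close> enters \<open>\<phi>\<close> only on the event \<open>A\<close>, so changing its law from \<open>f\<close> to \<open>g\<close> costs the
  density ratio only there; this is why unobserved cells do not contribute to the likelihood ratio.\<close>

lemma change_law_at:
  assumes phi [measurable]: "\<phi> \<in> borel_measurable Om" and i: "i \<notin> G"
    and A [measurable]: "Measurable.pred Om A"
    and A_upd: "\<And>\<omega> y. A (upd \<omega> i y) = A \<omega>"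
    and phi_upd: "\<And>\<omega> y. \<not> A \<omega> \<Longrightarrow> \<phi> (upd \<omega> i y) = \<phi> \<omega>"
  shows "(\<integral>\<^sup>+\<omega>. \<phi> \<omega> \<partial>Pr (insert i G))
       = (\<integral>\<^sup>+\<omega>. \<phi> \<omega> * ennreal (exp (if A \<omega> then llr (fst \<omega> i) else 0)) \<partial>Pr G)"
proof -
  let ?w = "\<lambda>\<omega>. ennreal (exp (if A \<omega> then llr (fst \<omega> i) else 0))"
  interpret Df: prob_space Df by (rule prob_D)
  interpret Dg: prob_space Dg by (rule prob_D)
  have "(\<integral>\<^sup>+\<omega>. \<phi> \<omega> \<partial>Pr (insert i G)) = (\<integral>\<^sup>+\<omega>. \<integral>\<^sup>+y. \<phi> (upd \<omega> i y) \<partial>Dg \<partial>Pr G)"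
    using resample[OF phi, of "insert i G" i G] by (simp add: law_def)
  also have "\<dots> = (\<integral>\<^sup>+\<omega>. \<integral>\<^sup>+y. \<phi> (upd \<omega> i y) * ?w (upd \<omega> i y) \<partial>Df \<partial>Pr G)"
  proof (rule nn_integral_cong)
    fix \<omega> assume \<omega>: "\<omega> \<in> space (Pr G)"
    show "(\<integral>\<^sup>+y. \<phi> (upd \<omega> i y) \<partial>Dg) = (\<integral>\<^sup>+y. \<phi> (upd \<omega> i y) * ?w (upd \<omega> i y) \<partial>Df)"
    proof (cases "A \<omega>")
      case True
      then show ?thesis
        using nn_integral_Dg[OF measurable_upd_section[OF phi, of \<omega> i]] \<omega> by (simp add: A_upd)
    next
      case False
      then show ?thesis
        by (simp add: A_upd phi_upd Df.emeasure_space_1 Dg.emeasure_space_1)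
    qed
  qed
  also have "\<dots> = (\<integral>\<^sup>+\<omega>. \<phi> \<omega> * ?w \<omega> \<partial>Pr G)"
    using resample[of "\<lambda>\<omega>. \<phi> \<omega> * ?w \<omega>" G i G] i by (simp add: law_def)
  finally show ?thesis .
qed

text \<open>Coordinates are changed one at a time, and the weight acquired at \<open>i\<close> joins
  the integrand for the remaining ones. \<open>A_upd'\<close> keeps this consistent: the weight at
  \<open>i\<close> is unaffected by overwriting another coordinate that is inactive, so the new
  integrand again satisfies \<open>phi_upd\<close>.\<close>

lemma change_law:
  assumes "finite I" "I \<inter> G = {}"
    and A [measurable]: "\<And>i. Measurable.pred Om (A i)"
    and A_upd: "\<And>i \<omega> y. A i (upd \<omega> i y) = A i \<omega>"
    and A_upd': "\<And>i j \<omega> y. \<not> A i \<omega> \<Longrightarrow> A j (upd \<omega> i y) = A j \<omega>"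
    and phi: "\<phi> \<in> borel_measurable Om"
    and phi_upd: "\<And>i \<omega> y. i \<in> I \<Longrightarrow> \<not> A i \<omega> \<Longrightarrow> \<phi> (upd \<omega> i y) = \<phi> \<omega>"
  shows "(\<integral>\<^sup>+\<omega>. \<phi> \<omega> \<partial>Pr (I \<union> G))
       = (\<integral>\<^sup>+\<omega>. \<phi> \<omega> * ennreal (exp (\<Sum>i\<in>I. if A i \<omega> then llr (fst \<omega> i) else 0)) \<partial>Pr G)"
  using assms(1,2) phi phi_upd
proof (induction I arbitrary: \<phi> rule: finite_induct)
  case (insert i I)
  note [measurable] = insert.prems(2)
  let ?w = "\<lambda>\<omega>. ennreal (exp (if A i \<omega> then llr (fst \<omega> i) else 0))"
  have "(\<integral>\<^sup>+\<omega>. \<phi> \<omega> \<partial>Pr (insert i (I \<union> G))) = (\<integral>\<^sup>+\<omega>. \<phi> \<omega> * ?w \<omega> \<partial>Pr (I \<union> G))"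
    by (rule change_law_at) (use insert A_upd in auto)
  also have "\<dots> = (\<integral>\<^sup>+\<omega>. \<phi> \<omega> * ?w \<omega> * ennreal (exp (\<Sum>i\<in>I. if A i \<omega> then llr (fst \<omega> i) else 0)) \<partial>Pr G)"
  proof (rule insert.IH)
    show "\<phi> (upd \<omega> j y) * ?w (upd \<omega> j y) = \<phi> \<omega> * ?w \<omega>" if "j \<in> I" "\<not> A j \<omega>" for j \<omega> y
      using that insert.hyps insert.prems(3)[of j \<omega> y] A_upd'[of j \<omega> i y] by auto
  qed (use insert.prems in auto)
  also have "\<dots> = (\<integral>\<^sup>+\<omega>. \<phi> \<omega> * ennreal (exp (\<Sum>i\<in>insert i I. if A i \<omega> then llr (fst \<omega> i) else 0)) \<partial>Pr G)"
    by (intro nn_integral_cong)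
       (simp only: sum.insert[OF insert.hyps] exp_add ennreal_mult'[OF exp_ge_zero] mult.assoc)
  finally show ?case by simp
qed simp

text \<open>Two hypotheses differ in infinitely many coordinates. For a function of the first
  \<open>n\<close> rows the later ones may carry either density, which leaves a finite change of
  law.\<close>

lemma relevant_rows:
  assumes phi: "\<phi> \<in> borel_measurable Om"
    and rows: "\<And>x x' \<xi>. (\<And>i. fst i < n \<Longrightarrow> x i = x' i) \<Longrightarrow> \<phi> (x, \<xi>) = \<phi> (x', \<xi>)"
    and G: "\<And>i. fst i < n \<Longrightarrow> i \<in> G \<longleftrightarrow> i \<in> G'"
  shows "(\<integral>\<^sup>+\<omega>. \<phi> \<omega> \<partial>Pr G) = (\<integral>\<^sup>+\<omega>. \<phi> \<omega> \<partial>Pr G')"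
  unfolding nn_integral_Pr_obs[OF phi]
proof (rule nn_integral_cong)
  fix \<xi> :: seeds assume xi: "\<xi> \<in> space seed_space"
  show "(\<integral>\<^sup>+x. \<phi> (x, \<xi>) \<partial>PiM UNIV (law G)) = (\<integral>\<^sup>+x. \<phi> (x, \<xi>) \<partial>PiM UNIV (law G'))"
    by (rule nn_integral_PiM_relevant[where J="{i. fst i < n}"])
       (auto simp: prob_law law_def[of G] law_def[of G'] G mix_def prob_D
          intro!: section_obs_meas[OF phi xi] rows)
qed

text \<open>In use \<open>J\<close> is the complement of one row of seeds: what was determined
  without that row is independent of the randomization drawn from it.\<close>

lemma seed_indep:
  assumes F: "F \<in> borel_measurable Om" and H: "H \<in> borel_measurable seed_space"
    and FJ: "\<And>x \<xi> \<xi>'. F (x, mix J \<xi> \<xi>') = F (x, \<xi>)" and HJ: "\<And>\<xi> \<xi>'. H (mix J \<xi> \<xi>') = H \<xi>'"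
  shows "(\<integral>\<^sup>+\<omega>. F \<omega> * H (snd \<omega>) \<partial>Pr G) = (\<integral>\<^sup>+\<omega>. F \<omega> \<partial>Pr G) * (\<integral>\<^sup>+\<xi>. H \<xi> \<partial>seed_space)"
proof -
  interpret B: prob_space seed_space by (rule prob_space_seed_space)
  have H': "H \<in> borel_measurable (PiM UNIV (\<lambda>_. borel))"
    using H by (simp cong: measurable_cong_sets add: sets_seed)
  have [measurable]: "(\<lambda>\<omega>. H (snd \<omega>)) \<in> borel_measurable Om"
    unfolding Om_def by (rule measurable_compose[OF measurable_snd H'])
  have F': "F \<in> borel_measurable (PiM UNIV (law G) \<Otimes>\<^sub>M seed_space)"
    by (rule measurable_Pr_pair[OF F])
  have "(\<integral>\<^sup>+\<omega>. F \<omega> * H (snd \<omega>) \<partial>Pr G)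
      = (\<integral>\<^sup>+x. \<integral>\<^sup>+\<xi>. F (x, \<xi>) * H \<xi> \<partial>seed_space \<partial>PiM UNIV (law G))"
    using F by (subst nn_integral_Pr_seeds) auto
  also have "\<dots> = (\<integral>\<^sup>+x. (\<integral>\<^sup>+\<xi>. F (x, \<xi>) \<partial>seed_space) * (\<integral>\<^sup>+\<xi>. H \<xi> \<partial>seed_space) \<partial>PiM UNIV (law G))"
  proof (rule nn_integral_cong)
    fix x assume "x \<in> space (PiM UNIV (law G))"
    from section_seed_meas[OF F this] H
    show "(\<integral>\<^sup>+\<xi>. F (x, \<xi>) * H \<xi> \<partial>seed_space) = (\<integral>\<^sup>+\<xi>. F (x, \<xi>) \<partial>seed_space) * (\<integral>\<^sup>+\<xi>. H \<xi> \<partial>seed_space)"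
      unfolding seed_space_def by (intro nn_integral_PiM_indep[where J=J] prob_space_unif) (auto simp: FJ HJ)
  qed
  also have "\<dots> = (\<integral>\<^sup>+x. (\<integral>\<^sup>+\<xi>. F (x, \<xi>) \<partial>seed_space) \<partial>PiM UNIV (law G)) * (\<integral>\<^sup>+\<xi>. H \<xi> \<partial>seed_space)"
    by (rule nn_integral_multc) (rule B.borel_measurable_nn_integral_fst[OF F'])
  finally show ?thesis using F by (simp add: nn_integral_Pr_seeds)
qed

lemma nn_integral_fresh:
  assumes h [measurable]: "h \<in> borel_measurable \<mu>" and F [measurable]: "F \<in> borel_measurable Om"
    and F_upd: "\<And>\<omega> y. F (upd \<omega> i y) = F \<omega>"
  shows "(\<integral>\<^sup>+\<omega>. F \<omega> * h (fst \<omega> i) \<partial>Pr G) = (\<integral>\<^sup>+\<omega>. F \<omega> \<partial>Pr G) * (\<integral>\<^sup>+y. h y \<partial>law G i)"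
proof -
  have "(\<integral>\<^sup>+\<omega>. F \<omega> * h (fst \<omega> i) \<partial>Pr G) = (\<integral>\<^sup>+\<omega>. \<integral>\<^sup>+y. F \<omega> * h y \<partial>law G i \<partial>Pr G)"
    using resample[of "\<lambda>\<omega>. F \<omega> * h (fst \<omega> i)" G i G] by (simp add: F_upd)
  then show ?thesis by (simp add: nn_integral_cmult nn_integral_multc)
qed

text \<open>One step of Wald's identity: the event is settled without the value at \<open>i\<close>,
  so event and observation are independent.\<close>

lemma integral_fresh:
  assumes h [measurable]: "h \<in> borel_measurable \<mu>" and int: "integrable (law G i) h"
    and A [measurable]: "Measurable.pred Om A" and A_upd: "\<And>\<omega> y. A (upd \<omega> i y) = A \<omega>"
  shows "integrable (Pr G) (\<lambda>\<omega>. if A \<omega> then h (fst \<omega> i) else 0)"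
    and "(\<integral>\<omega>. (if A \<omega> then h (fst \<omega> i) else 0) \<partial>Pr G) = measure (Pr G) {\<omega>\<in>space Om. A \<omega>} * (\<integral>y. h y \<partial>law G i)"
proof -
  interpret P: prob_space "Pr G" by (rule prob_Pr)
  let ?A = "{\<omega>\<in>space Om. A \<omega>}"
  \<comment> \<open>Used with \<open>k\<close> the identity, negation and modulus; since
    \<open>ennreal\<close> sends negative reals to 0, these give the positive part, the negative
    part and the absolute moment of \<open>h\<close>.\<close>
  have nn: "(\<integral>\<^sup>+\<omega>. ennreal (k (if A \<omega> then h (fst \<omega> i) else 0)) \<partial>Pr G)
      = ennreal (measure (Pr G) ?A) * (\<integral>\<^sup>+y. ennreal (k (h y)) \<partial>law G i)"
    if k [measurable]: "k \<in> borel_measurable borel" and k0: "k 0 = 0" for k :: "real \<Rightarrow> real"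
  proof -
    have "(\<integral>\<^sup>+\<omega>. ennreal (k (if A \<omega> then h (fst \<omega> i) else 0)) \<partial>Pr G)
        = (\<integral>\<^sup>+\<omega>. indicator ?A \<omega> * ennreal (k (h (fst \<omega> i))) \<partial>Pr G)"
      by (intro nn_integral_cong) (auto simp: k0)
    also have "\<dots> = (\<integral>\<^sup>+\<omega>. (if A \<omega> then 1 else 0) * ennreal (k (h (fst \<omega> i))) \<partial>Pr G)"
      by (intro nn_integral_cong) auto
    also have "\<dots> = (\<integral>\<^sup>+\<omega>. (if A \<omega> then 1 else 0) \<partial>Pr G) * (\<integral>\<^sup>+y. ennreal (k (h y)) \<partial>law G i)"
      by (rule nn_integral_fresh) (auto simp: A_upd)
    also have "(\<integral>\<^sup>+\<omega>. (if A \<omega> then 1 else 0) \<partial>Pr G) = (\<integral>\<^sup>+\<omega>. indicator ?A \<omega> \<partial>Pr G)"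
      by (intro nn_integral_cong) auto
    also have "\<dots> = ennreal (measure (Pr G) ?A)"
      by (simp add: P.emeasure_eq_measure)
    finally show ?thesis .
  qed
  have nabs: "(\<integral>\<^sup>+y. ennreal \<bar>h y\<bar> \<partial>law G i) < \<infinity>" using int by (auto simp: integrable_iff_bounded)
  show I: "integrable (Pr G) (\<lambda>\<omega>. if A \<omega> then h (fst \<omega> i) else 0)"
    unfolding integrable_iff_bounded using nn[of abs] nabs
    by (auto simp: ennreal_mult_less_top)
  have fin: "(\<integral>\<^sup>+y. ennreal (h y) \<partial>law G i) < \<infinity>" "(\<integral>\<^sup>+y. ennreal (- h y) \<partial>law G i) < \<infinity>"
    using int by (auto simp: real_integrable_def less_top)
  show "(\<integral>\<omega>. (if A \<omega> then h (fst \<omega> i) else 0) \<partial>Pr G) = measure (Pr G) ?A * (\<integral>y. h y \<partial>law G i)"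
    unfolding real_lebesgue_integral_def[OF I] real_lebesgue_integral_def[OF int]
    using nn[of "\<lambda>x. x"] nn[of uminus] by (simp add: enn2real_mult right_diff_distrib)
qed

end

section \<open>Policies and likelihood ratios\<close>

abbreviation Sel :: "('a, 'b) policy_scheme \<Rightarrow> 'a sample \<Rightarrow> nat \<Rightarrow> nat set" where
  "Sel p \<omega> n \<equiv> sel p (snd \<omega>) (hist p \<omega> n)"

definition live :: "('a, 'b) policy_scheme \<Rightarrow> 'a sample \<Rightarrow> nat \<Rightarrow> bool" where
  "live p \<omega> n = (\<forall>i<n. \<not> stopped p \<omega> i)"

text \<open>\<open>Suc\<close> because the observation at time \<open>t\<close> is taken only if no
  history of length at most \<open>t\<close> has led to stopping. The recursion for
  \<open>hist\<close> runs on after stopping; restricting to active coordinates freezes every sum at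
  the stopping time.\<close>

definition act :: "('a, 'b) policy_scheme \<Rightarrow> nat \<times> nat \<Rightarrow> 'a sample \<Rightarrow> bool" where
  "act p i \<omega> = (live p \<omega> (Suc (fst i)) \<and> snd i \<in> Sel p \<omega> (fst i))"

definition ends :: "('a, 'b) policy_scheme \<Rightarrow> nat \<Rightarrow> nat \<Rightarrow> 'a sample \<Rightarrow> bool" where
  "ends p m n \<omega> = (\<exists>k\<le>n. live p \<omega> k \<and> stopped p \<omega> k \<and> dec p (snd \<omega>) (hist p \<omega> k) = m)"

lemma live_Suc: "live p \<omega> (Suc n) \<longleftrightarrow> live p \<omega> n \<and> \<not> stopped p \<omega> n"
  by (auto simp: live_def less_Suc_eq)

lemma live_mono: "live p \<omega> n \<Longrightarrow> k \<le> n \<Longrightarrow> live p \<omega> k"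
  by (auto simp: live_def)

lemma live_stopped_unique: "live p \<omega> k \<Longrightarrow> stopped p \<omega> k \<Longrightarrow> live p \<omega> l \<Longrightarrow> stopped p \<omega> l \<Longrightarrow> k = l"
  unfolding live_def by (cases k l rule: linorder_cases) auto

lemma hist_rows:
  assumes "\<And>i. fst i < n \<Longrightarrow> fst \<omega> i = fst \<omega>' i" "snd \<omega> = snd \<omega>'"
  shows "hist p \<omega> n = hist p \<omega>' n"
proof -
  have "k \<le> n \<Longrightarrow> hist p \<omega> k = hist p \<omega>' k" for k
  proof (induction k)
    case (Suc k)
    then have "hist p \<omega> k = hist p \<omega>' k" "\<And>j. fst \<omega> (k, j) = fst \<omega>' (k, j)" using assms(1) by auto
    then show ?case by (simp add: assms(2))
  qed simp
  then show ?thesis by simp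
qed

lemma hist_upd_future: "n \<le> fst i \<Longrightarrow> hist p (upd \<omega> i y) n = hist p \<omega> n"
  by (intro hist_rows) auto

lemma stopped_upd_future: "n \<le> fst i \<Longrightarrow> stopped p (upd \<omega> i y) n = stopped p \<omega> n"
  by (simp add: stopped_def hist_upd_future)

lemma live_upd_future: "n \<le> Suc (fst i) \<Longrightarrow> live p (upd \<omega> i y) n = live p \<omega> n"
  by (auto simp: live_def stopped_upd_future)

lemma act_upd_self: "act p i (upd \<omega> i y) = act p i \<omega>"
  by (simp add: act_def live_upd_future hist_upd_future)

text \<open>An inactive coordinate is either not selected or lies after the stopping time. In the
  second case the continued history may change, hence histories are claimed to agree only as long as
  the policy is live; the two claims need each other in the induction.\<close>

lemma live_upd_inactive:
  assumes "\<not> act p i \<omega>"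
  shows "live p (upd \<omega> i y) n = live p \<omega> n \<and> (live p \<omega> n \<longrightarrow> hist p (upd \<omega> i y) n = hist p \<omega> n)"
proof (induction n)
  case 0 then show ?case by (simp add: live_def)
next
  case (Suc n)
  have 1: "live p (upd \<omega> i y) (Suc n) = live p \<omega> (Suc n)"
    using Suc by (auto simp: live_Suc stopped_def)
  moreover have "hist p (upd \<omega> i y) (Suc n) = hist p \<omega> (Suc n)" if l: "live p \<omega> (Suc n)"
  proof -
    have h: "hist p (upd \<omega> i y) n = hist p \<omega> n" using Suc l by (auto simp: live_Suc)
    have "(n, k) \<noteq> i" if "k \<in> Sel p \<omega> n" for k using assms l that by (auto simp: act_def)
    then show ?thesis by (auto simp: h Let_def restrict_def fun_eq_iff)
  qed
  ultimately show ?case by blast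
qed

lemma act_upd_inactive: "\<not> act p i \<omega> \<Longrightarrow> act p j (upd \<omega> i y) = act p j \<omega>"
  using live_upd_inactive[of p i \<omega> y "Suc (fst j)"] live_upd_inactive[of p i \<omega> y "fst j"]
    live_mono[of p \<omega> "Suc (fst j)" "fst j"]
  by (auto simp: act_def)

lemma ends_upd_inactive: "\<not> act p i \<omega> \<Longrightarrow> ends p m n (upd \<omega> i y) = ends p m n \<omega>"
proof -
  assume a: "\<not> act p i \<omega>"
  have "(live p (upd \<omega> i y) k \<and> stopped p (upd \<omega> i y) k \<and> dec p (snd (upd \<omega> i y)) (hist p (upd \<omega> i y) k) = m)
      = (live p \<omega> k \<and> stopped p \<omega> k \<and> dec p (snd \<omega>) (hist p \<omega> k) = m)" for k
    using live_upd_inactive[OF a, of y k] by (auto simp: stopped_def)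
  then show ?thesis by (simp add: ends_def)
qed

lemma ends_mono:
  assumes "ends p m n \<omega>" "n \<le> n'"
  shows "ends p m n' \<omega>"
proof -
  from assms(1) obtain k where "k \<le> n" "live p \<omega> k \<and> stopped p \<omega> k \<and> dec p (snd \<omega>) (hist p \<omega> k) = m"
    unfolding ends_def by blast
  then show ?thesis unfolding ends_def using assms(2) by (intro exI[of _ k]) auto
qed

lemma ends_incseq: "incseq (\<lambda>n. {\<omega>\<in>A. ends p m n \<omega>})"
  unfolding incseq_def using ends_mono by blast

lemma live_rows:
  assumes "\<And>i. fst i < n \<Longrightarrow> fst \<omega> i = fst \<omega>' i" "snd \<omega> = snd \<omega>'"
  shows "k \<le> Suc n \<Longrightarrow> live p \<omega> k = live p \<omega>' k"
proof -
  assume k: "k \<le> Suc n"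
  have "hist p \<omega> i = hist p \<omega>' i" if "i < k" for i
    using assms that k by (intro hist_rows) auto
  then show ?thesis by (auto simp: live_def stopped_def assms(2))
qed

lemma ends_rows:
  assumes "\<And>i. fst i < n \<Longrightarrow> fst \<omega> i = fst \<omega>' i" "snd \<omega> = snd \<omega>'"
  shows "ends p m n \<omega> = ends p m n \<omega>'"
proof -
  have "hist p \<omega> i = hist p \<omega>' i" if "i \<le> n" for i
    using assms that by (intro hist_rows) auto
  then have "(live p \<omega> i \<and> stopped p \<omega> i \<and> dec p (snd \<omega>) (hist p \<omega> i) = m)
      = (live p \<omega>' i \<and> stopped p \<omega>' i \<and> dec p (snd \<omega>') (hist p \<omega>' i) = m)" if "i \<le> n" for i
    using live_rows[of n \<omega> \<omega>' i p] assms that by (auto simp: stopped_def)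
  then show ?thesis unfolding ends_def by blast
qed

lemma act_rows:
  assumes "\<And>i. fst i < n \<Longrightarrow> fst \<omega> i = fst \<omega>' i" "snd \<omega> = snd \<omega>'"
  shows "fst i < n \<Longrightarrow> act p i \<omega> = act p i \<omega>'"
proof -
  assume "fst i < n"
  then show ?thesis using live_rows[of n \<omega> \<omega>' "Suc (fst i)" p] hist_rows[of "fst i" \<omega> \<omega>' p] assms
    by (auto simp: act_def)
qed

text \<open>The tail sum also covers samples on which the policy never stops, where all terms are 1,
  so expected stopping times become sums of probabilities in every case.\<close>

lemma stop_time_eq: "stop_time p \<omega> = (\<Sum>n. if live p \<omega> (Suc n) then 1 else 0)"
proof (cases "\<exists>n. stopped p \<omega> n")
  case True
  define N where "N = (LEAST n. stopped p \<omega> n)"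
  have N: "stopped p \<omega> N" "\<And>i. i < N \<Longrightarrow> \<not> stopped p \<omega> i"
    unfolding N_def by (rule LeastI_ex[OF True], rule not_less_Least)
  have live: "live p \<omega> (Suc n) \<longleftrightarrow> n < N" for n
  proof
    assume "live p \<omega> (Suc n)"
    then show "n < N" using N(1) unfolding live_def by (meson leI less_Suc_eq_le)
  qed (use N(2) in \<open>simp add: live_def\<close>)
  have "(\<Sum>n. if live p \<omega> (Suc n) then 1 else 0) = (\<Sum>n<N. if live p \<omega> (Suc n) then 1 else (0::ennreal))"
    by (rule suminf_finite) (auto simp: live)
  also have "\<dots> = of_nat N" by (simp add: live)
  finally show ?thesis using True by (simp add: stop_time_def N_def)
next
  case False
  have "(\<Sum>n. (1::ennreal)) = \<infinity>"
  proof (cases "\<Sum>n. (1::ennreal)")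
    case (real r)
    obtain n where n: "r < real n" using reals_Archimedean2 by blast
    have "ennreal (real n) \<le> (\<Sum>n. (1::ennreal))"
      using sum_le_suminf[of "\<lambda>n. 1::ennreal" "{..<n}"] by (simp add: ennreal_of_nat_eq_real_of_nat)
    then show ?thesis using real n by (simp add: ennreal_le_iff)
  qed simp
  then show ?thesis using False by (simp add: stop_time_def live_def)
qed

text \<open>Never stopping counts as an error, so success is an increasing union of events, each
  settled by finitely many rows.\<close>

lemma decision_error_iff: "decision_error p m \<omega> \<longleftrightarrow> \<not> (\<exists>n. ends p m n \<omega>)"
proof (cases "\<exists>n. stopped p \<omega> n")
  case True
  define N where "N = (LEAST n. stopped p \<omega> n)"
  have N: "stopped p \<omega> N" "live p \<omega> N"
    unfolding N_def live_def by (rule LeastI_ex[OF True]) (auto dest: not_less_Least)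
  have "(\<exists>n. ends p m n \<omega>) \<longleftrightarrow> dec p (snd \<omega>) (hist p \<omega> N) = m"
  proof
    assume "\<exists>n. ends p m n \<omega>"
    then obtain k where k: "live p \<omega> k" "stopped p \<omega> k" "dec p (snd \<omega>) (hist p \<omega> k) = m"
      unfolding ends_def by blast
    with live_stopped_unique[OF k(1,2) N(2,1)] show "dec p (snd \<omega>) (hist p \<omega> N) = m" by simp
  qed (use N in \<open>auto simp: ends_def\<close>)
  then show ?thesis using True by (simp add: decision_error_def N_def)
qed (auto simp: decision_error_def ends_def)

section \<open>Stopped log-likelihood ratios between hypotheses\<close>

context two_densities
begin

definition meas_policy :: "'a policy \<Rightarrow> bool" where
  "meas_policy p = (\<forall>n. (\<lambda>\<omega>. Sel p \<omega> n) \<in> measurable Om (count_space UNIV) \<and>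
     (\<lambda>\<omega>. stopped p \<omega> n) \<in> measurable Om (count_space UNIV) \<and>
     (\<lambda>\<omega>. dec p (snd \<omega>) (hist p \<omega> n)) \<in> measurable Om (count_space UNIV))"

lemma meas_policyI: "0 < M \<Longrightarrow> admissible M K \<mu> f g p \<Longrightarrow> meas_policy p"
  unfolding admissible_def meas_policy_def sample_space_eq_Pr measurable_cong_sets[OF sets_Pr refl]
  by blast

abbreviation H :: "nat \<Rightarrow> 'a sample measure" where "H m \<equiv> Pr {i. snd i = m}"

definition alpha :: "'a policy \<Rightarrow> nat \<Rightarrow> real" where
  "alpha p m = measure (H m) {\<omega>\<in>space Om. decision_error p m \<omega>}"

definition Lam :: "'a policy \<Rightarrow> nat \<Rightarrow> nat \<Rightarrow> 'a sample \<Rightarrow> real" where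
  "Lam p n k \<omega> = (\<Sum>t<n. if act p (t, k) \<omega> then llr (fst \<omega> (t, k)) else 0)"

lemma Lam_upd_inactive: "\<not> act p i \<omega> \<Longrightarrow> Lam p n k (upd \<omega> i y) = Lam p n k \<omega>"
  unfolding Lam_def by (intro sum.cong) (auto simp: act_upd_inactive)

lemma Lam_rows:
  assumes "\<And>i. fst i < n \<Longrightarrow> fst \<omega> i = fst \<omega>' i" "snd \<omega> = snd \<omega>'"
  shows "Lam p n k \<omega> = Lam p n k \<omega>'"
  unfolding Lam_def using act_rows[OF assms, where p=p] assms by (intro sum.cong) auto

context
  fixes p :: "'a policy"
  assumes mp: "meas_policy p"
begin

lemma sel_meas [measurable]: "(\<lambda>\<omega>. Sel p \<omega> n) \<in> measurable Om (count_space UNIV)"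
  and stopped_meas [measurable]: "Measurable.pred Om (\<lambda>\<omega>. stopped p \<omega> n)"
  and dec_meas [measurable]: "(\<lambda>\<omega>. dec p (snd \<omega>) (hist p \<omega> n)) \<in> measurable Om (count_space UNIV)"
  using mp by (auto simp: meas_policy_def)

lemma mem_sel_meas [measurable]: "Measurable.pred Om (\<lambda>\<omega>. k \<in> Sel p \<omega> n)"
  by (rule measurable_compose[OF sel_meas]) simp

lemma live_meas [measurable]: "Measurable.pred Om (\<lambda>\<omega>. live p \<omega> n)"
  unfolding live_def by measurable

lemma act_meas [measurable]: "Measurable.pred Om (act p i)"
  unfolding act_def by measurable

lemma ends_meas [measurable]: "Measurable.pred Om (ends p m n)"
  unfolding ends_def by measurable

lemma decision_error_meas [measurable]: "Measurable.pred Om (decision_error p m)"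
  unfolding decision_error_iff by measurable

lemma Lam_meas [measurable]: "Lam p n k \<in> borel_measurable Om"
  unfolding Lam_def by measurable

text \<open>For an integrand of the first \<open>n\<close> rows only the coordinates
  \<open>(t, m)\<close> with \<open>t < n\<close> separate \<open>H m\<close> from the law with
  \<open>f\<close> everywhere, and only the active ones among them contribute to the weight.\<close>

lemma likelihood_ratio0:
  assumes phi: "\<phi> \<in> borel_measurable Om"
    and rows: "\<And>\<omega> \<omega>'. (\<And>i. fst i < n \<Longrightarrow> fst \<omega> i = fst \<omega>' i) \<Longrightarrow> snd \<omega> = snd \<omega>' \<Longrightarrow> \<phi> \<omega> = \<phi> \<omega>'"
    and phi_upd: "\<And>i \<omega> y. \<not> act p i \<omega> \<Longrightarrow> \<phi> (upd \<omega> i y) = \<phi> \<omega>"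
  shows "(\<integral>\<^sup>+\<omega>. \<phi> \<omega> \<partial>H m) = (\<integral>\<^sup>+\<omega>. \<phi> \<omega> * ennreal (exp (Lam p n m \<omega>)) \<partial>Pr {})"
proof -
  let ?I = "{..<n} \<times> {m}"
  have L: "(\<Sum>i\<in>?I. if act p i \<omega> then llr (fst \<omega> i) else 0) = Lam p n m \<omega>" for \<omega>
    unfolding Lam_def
    by (rule sum.reindex_bij_witness[of _ "\<lambda>t. (t, m)" fst]) auto
  have "(\<integral>\<^sup>+\<omega>. \<phi> \<omega> \<partial>H m) = (\<integral>\<^sup>+\<omega>. \<phi> \<omega> \<partial>Pr (?I \<union> {}))"
  proof (rule relevant_rows[OF phi, where n=n])
    fix x x' :: "nat \<times> nat \<Rightarrow> 'a" and \<xi> assume "\<And>i. fst i < n \<Longrightarrow> x i = x' i"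
    then show "\<phi> (x, \<xi>) = \<phi> (x', \<xi>)" by (intro rows) simp_all
  qed auto
  also have "\<dots> = (\<integral>\<^sup>+\<omega>. \<phi> \<omega> * ennreal (exp (\<Sum>i\<in>?I. if act p i \<omega> then llr (fst \<omega> i) else 0)) \<partial>Pr {})"
    by (rule change_law) (auto simp: act_upd_self act_upd_inactive phi phi_upd)
  also have "\<dots> = (\<integral>\<^sup>+\<omega>. \<phi> \<omega> * ennreal (exp (Lam p n m \<omega>)) \<partial>Pr {})"
    by (simp only: L)
  finally show ?thesis .
qed

text \<open>Both hypotheses are compared with \<open>Pr {}\<close>, where the weight of
  \<open>m\<close> cancels. The exponent is the log-likelihood ratio stopped at
  \<open>min \<tau> n\<close>, although no stopped process appears.\<close>

lemma likelihood_ratio: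
  assumes phi [measurable]: "\<phi> \<in> borel_measurable Om"
    and rows: "\<And>\<omega> \<omega>'. (\<And>i. fst i < n \<Longrightarrow> fst \<omega> i = fst \<omega>' i) \<Longrightarrow> snd \<omega> = snd \<omega>' \<Longrightarrow> \<phi> \<omega> = \<phi> \<omega>'"
    and phi_upd: "\<And>i \<omega> y. \<not> act p i \<omega> \<Longrightarrow> \<phi> (upd \<omega> i y) = \<phi> \<omega>"
  shows "(\<integral>\<^sup>+\<omega>. \<phi> \<omega> \<partial>H j) = (\<integral>\<^sup>+\<omega>. \<phi> \<omega> * ennreal (exp (Lam p n j \<omega> - Lam p n m \<omega>)) \<partial>H m)"
proof -
  let ?\<psi> = "\<lambda>\<omega>. \<phi> \<omega> * ennreal (exp (Lam p n j \<omega> - Lam p n m \<omega>))"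
  have "(\<integral>\<^sup>+\<omega>. ?\<psi> \<omega> \<partial>H m) = (\<integral>\<^sup>+\<omega>. ?\<psi> \<omega> * ennreal (exp (Lam p n m \<omega>)) \<partial>Pr {})"
  proof (rule likelihood_ratio0)
    fix \<omega> \<omega>' :: "'a sample" assume *: "\<And>i. fst i < n \<Longrightarrow> fst \<omega> i = fst \<omega>' i" "snd \<omega> = snd \<omega>'"
    show "?\<psi> \<omega> = ?\<psi> \<omega>'" using rows[OF *] Lam_rows[OF *] by simp
  qed (auto simp: phi_upd Lam_upd_inactive)
  also have "\<dots> = (\<integral>\<^sup>+\<omega>. \<phi> \<omega> * ennreal (exp (Lam p n j \<omega>)) \<partial>Pr {})"
    by (intro nn_integral_cong) (simp add: mult.assoc ennreal_mult'[symmetric] exp_add[symmetric])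
  also have "\<dots> = (\<integral>\<^sup>+\<omega>. \<phi> \<omega> \<partial>H j)"
    by (rule likelihood_ratio0[OF phi rows phi_upd, symmetric])
  finally show ?thesis by simp
qed

lemma ends_error: "m \<noteq> j \<Longrightarrow> measure (H j) {\<omega>\<in>space Om. ends p m n \<omega>} \<le> alpha p j"
proof -
  assume mj: "m \<noteq> j"
  interpret P: prob_space "H j" by (rule prob_Pr)
  have "decision_error p j \<omega>" if "ends p m n \<omega>" for \<omega>
    using that mj live_stopped_unique[of p \<omega>] unfolding decision_error_iff ends_def by blast
  then show ?thesis unfolding alpha_def by (intro P.finite_measure_mono) auto
qed

lemma ends_limit: "(\<lambda>n. measure (H m) {\<omega>\<in>space Om. ends p m n \<omega>}) \<longlonglongrightarrow> 1 - alpha p m"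
proof -
  interpret P: prob_space "H m" by (rule prob_Pr)
  have "(\<lambda>n. measure (H m) {\<omega>\<in>space Om. ends p m n \<omega>}) \<longlonglongrightarrow> measure (H m) (\<Union>n. {\<omega>\<in>space Om. ends p m n \<omega>})"
    by (rule P.finite_Lim_measure_incseq[OF _ ends_incseq]) auto
  also have "(\<Union>n. {\<omega>\<in>space Om. ends p m n \<omega>}) = space (H m) - {\<omega>\<in>space Om. decision_error p m \<omega>}"
    by (auto simp: decision_error_iff)
  also have "measure (H m) \<dots> = 1 - alpha p m"
    unfolding alpha_def by (rule P.prob_compl) simp
  finally show ?thesis .
qed

end

end

section \<open>Wald's identity and the information needed for a decision\<close>

locale divergences = two_densities +
  assumes Dgf_fin: "integrable \<mu> (\<lambda>x. g x * ln (g x / f x))"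
    and Dfg_fin: "integrable \<mu> (\<lambda>x. f x * ln (f x / g x))"
    and Dgf_pos: "0 < KL \<mu> g f" and Dfg_pos: "0 < KL \<mu> f g"
begin

lemma llr_neg: "x \<in> space \<mu> \<Longrightarrow> llr x = - ln (f x / g x)"
  unfolding llr_def by (subst ln_inverse[symmetric]) (auto simp: inverse_eq_divide)

lemma llr_Dg: "integrable Dg llr" "(\<integral>y. llr y \<partial>Dg) = KL \<mu> g f"
  using Dgf_fin g_nonneg unfolding Dg_def KL_def
  by (auto simp: integrable_real_density integral_real_density llr_def cong: Bochner_Integration.integral_cong)

lemma llr_Df: "integrable Df llr" "(\<integral>y. llr y \<partial>Df) = - KL \<mu> f g"
proof -
  have eq: "f x * llr x = - (f x * ln (f x / g x))" if "x \<in> space \<mu>" for x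
    using llr_neg[OF that] by simp
  have "integrable \<mu> (\<lambda>x. f x * llr x)"
    using Dfg_fin by (subst Bochner_Integration.integrable_cong[OF refl eq]) auto
  then show "integrable Df llr"
    using f_nonneg unfolding Df_def by (subst integrable_real_density) auto
  show "(\<integral>y. llr y \<partial>Df) = - KL \<mu> f g"
    using f_nonneg Bochner_Integration.integral_cong[OF refl eq] unfolding Df_def KL_def
    by (subst integral_real_density) (auto simp: Bochner_Integration.integral_minus)
qed

context
  fixes p :: "'a policy"
  assumes mp: "meas_policy p"
begin

lemmas [measurable] = act_meas[OF mp] Lam_meas[OF mp] ends_meas[OF mp] live_meas[OF mp]
  mem_sel_meas[OF mp] decision_error_meas[OF mp]

text \<open>Wald's identity truncated at \<open>n\<close>. The stopping rule sits inside
  \<open>act\<close>, so this is a finite sum of single fresh observations, each on an event settled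
  before it.\<close>

lemma Lam_integral:
  shows "integrable (H m) (Lam p n k)"
    and "(\<integral>\<omega>. Lam p n k \<omega> \<partial>H m) =
      (\<Sum>t<n. measure (H m) {\<omega>\<in>space Om. act p (t, k) \<omega>} * (if k = m then KL \<mu> g f else - KL \<mu> f g))"
proof -
  have law: "integrable (law {i. snd i = m} (t, k)) llr"
    "(\<integral>y. llr y \<partial>law {i. snd i = m} (t, k)) = (if k = m then KL \<mu> g f else - KL \<mu> f g)" for t
    using llr_Df llr_Dg by (auto simp: law_def)
  note fresh = integral_fresh[OF llr_meas law(1), of "act p (_, k)", OF act_meas[OF mp] act_upd_self]
  show "integrable (H m) (Lam p n k)"
    unfolding Lam_def by (intro Bochner_Integration.integrable_sum fresh)
  show "(\<integral>\<omega>. Lam p n k \<omega> \<partial>H m) =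
      (\<Sum>t<n. measure (H m) {\<omega>\<in>space Om. act p (t, k) \<omega>} * (if k = m then KL \<mu> g f else - KL \<mu> f g))"
    unfolding Lam_def by (subst Bochner_Integration.integral_sum) (auto simp: fresh law)
qed

text \<open>The pointwise bounds \<open>x \<ge> 1 + a - exp (a - x)\<close> on the event and \<open>x \<ge> 1 - exp (- x)\<close> off it
  replace the data processing inequality for the Kullback-Leibler divergence.\<close>

lemma information_bound:
  assumes mj: "m \<noteq> j"
  shows "a * measure (H m) {\<omega>\<in>space Om. ends p m n \<omega>} - exp a * alpha p j
    \<le> (\<integral>\<omega>. Lam p n m \<omega> - Lam p n j \<omega> \<partial>H m)"
proof -
  interpret P: prob_space "H m" by (rule prob_Pr)
  interpret Q: prob_space "H j" by (rule prob_Pr)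
  let ?B = "{\<omega>\<in>space Om. ends p m n \<omega>}"
  let ?D = "\<lambda>\<omega>. Lam p n m \<omega> - Lam p n j \<omega>"
  \<comment> \<open>Under \<open>H m\<close> the weight \<open>exp (- ?D \<omega>)\<close> turns
    mass into mass under \<open>H j\<close>. It is used on the event and on its complement
    separately, because the two pointwise bounds carry it with different factors.\<close>
  have LR: "integrable (H m) (\<lambda>\<omega>. if E \<omega> then exp (- ?D \<omega>) else 0) \<and>
      (\<integral>\<omega>. (if E \<omega> then exp (- ?D \<omega>) else 0) \<partial>H m) = measure (H j) {\<omega>\<in>space Om. E \<omega>}"
    if E: "E = ends p m n \<or> E = (\<lambda>\<omega>. \<not> ends p m n \<omega>)" for E
  proof -
    have [measurable]: "Measurable.pred Om E" using E by auto
    have "(\<integral>\<^sup>+\<omega>. ennreal (if E \<omega> then exp (- ?D \<omega>) else 0) \<partial>H m)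
        = (\<integral>\<^sup>+\<omega>. (if E \<omega> then 1 else 0) * ennreal (exp (Lam p n j \<omega> - Lam p n m \<omega>)) \<partial>H m)"
      by (intro nn_integral_cong) auto
    also have "\<dots> = (\<integral>\<^sup>+\<omega>. (if E \<omega> then 1 else 0) \<partial>H j)"
    proof (rule likelihood_ratio[OF mp, symmetric])
      fix \<omega> \<omega>' :: "'a sample" assume *: "\<And>i. fst i < n \<Longrightarrow> fst \<omega> i = fst \<omega>' i" "snd \<omega> = snd \<omega>'"
      show "(if E \<omega> then 1 else 0::ennreal) = (if E \<omega>' then 1 else 0)"
        using E ends_rows[of n \<omega> \<omega>' p m] * by auto
    qed (use E in \<open>auto simp: ends_upd_inactive\<close>)
    also have "\<dots> = (\<integral>\<^sup>+\<omega>. indicator {\<omega>\<in>space Om. E \<omega>} \<omega> \<partial>H j)"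
      by (intro nn_integral_cong) auto
    also have "\<dots> = ennreal (measure (H j) {\<omega>\<in>space Om. E \<omega>})" by (simp add: Q.emeasure_eq_measure)
    finally have nn: "(\<integral>\<^sup>+\<omega>. ennreal (if E \<omega> then exp (- ?D \<omega>) else 0) \<partial>H m)
        = ennreal (measure (H j) {\<omega>\<in>space Om. E \<omega>})" .
    have "integrable (H m) (\<lambda>\<omega>. if E \<omega> then exp (- ?D \<omega>) else 0)"
      by (rule integrableI_nn_integral_finite[OF _ _ nn]) auto
    moreover have "(\<integral>\<omega>. (if E \<omega> then exp (- ?D \<omega>) else 0) \<partial>H m) = measure (H j) {\<omega>\<in>space Om. E \<omega>}"
      using nn by (subst integral_eq_nn_integral) auto
    ultimately show ?thesis by blast
  qed
  define X where "X = (\<lambda>\<omega>. if ends p m n \<omega> then exp (- ?D \<omega>) else 0)"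
  define Y where "Y = (\<lambda>\<omega>. if \<not> ends p m n \<omega> then exp (- ?D \<omega>) else 0)"
  have X: "integrable (H m) X" "(\<integral>\<omega>. X \<omega> \<partial>H m) = measure (H j) ?B"
    and Y: "integrable (H m) Y" "(\<integral>\<omega>. Y \<omega> \<partial>H m) = measure (H j) {\<omega>\<in>space Om. \<not> ends p m n \<omega>}"
    using LR[of "ends p m n"] LR[of "\<lambda>\<omega>. \<not> ends p m n \<omega>"] unfolding X_def Y_def by blast+
  have I: "integrable (H m) (indicat_real ?B)" by (rule P.integrable_const_bound[where B=1]) auto
  have vI: "(\<integral>\<omega>. indicat_real ?B \<omega> \<partial>H m) = measure (H m) ?B"
    by (subst Bochner_Integration.integral_indicator) (auto intro!: arg_cong[where f="measure (H m)"])
  have int: "integrable (H m) (\<lambda>\<omega>. 1 + a * indicat_real ?B \<omega> - exp a * X \<omega> - Y \<omega>)"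
    using X(1) Y(1) I by simp
  have D: "integrable (H m) ?D" by (intro Bochner_Integration.integrable_diff Lam_integral(1))
  have "(\<integral>\<omega>. 1 + a * indicat_real ?B \<omega> - exp a * X \<omega> - Y \<omega> \<partial>H m) \<le> (\<integral>\<omega>. ?D \<omega> \<partial>H m)"
  proof (rule integral_mono[OF int D])
    fix \<omega> assume "\<omega> \<in> space (H m)"
    then have ind: "indicat_real ?B \<omega> = (if ends p m n \<omega> then 1 else 0)" by simp
    have *: "1 + (a - ?D \<omega>) \<le> exp a * exp (- ?D \<omega>)" "1 + (- ?D \<omega>) \<le> exp (- ?D \<omega>)"
      using exp_ge_add_one_self[of "a + - ?D \<omega>"] exp_ge_add_one_self[of "- ?D \<omega>"]
      unfolding exp_add[symmetric] by linarith+
    show "1 + a * indicat_real ?B \<omega> - exp a * X \<omega> - Y \<omega> \<le> ?D \<omega>"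
      unfolding ind X_def Y_def using *
      by (cases "ends p m n \<omega>"; simp only: if_True if_False simp_thms; linarith)
  qed
  also have "(\<integral>\<omega>. 1 + a * indicat_real ?B \<omega> - exp a * X \<omega> - Y \<omega> \<partial>H m)
    = 1 + a * measure (H m) ?B - exp a * measure (H j) ?B - measure (H j) {\<omega>\<in>space Om. \<not> ends p m n \<omega>}"
    using X Y I using P.prob_space by (simp add: vI)
  finally have "1 + a * measure (H m) ?B - exp a * measure (H j) ?B - measure (H j) {\<omega>\<in>space Om. \<not> ends p m n \<omega>}
      \<le> (\<integral>\<omega>. ?D \<omega> \<partial>H m)" .
  \<comment> \<open>The constant 1 of the pointwise bounds outweighs the \<open>H j\<close>-mass off
    the event, so both drop out.\<close>
  moreover have "measure (H j) {\<omega>\<in>space Om. \<not> ends p m n \<omega>} \<le> 1" by simp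
  moreover have "exp a * measure (H j) ?B \<le> exp a * alpha p j"
    using ends_error[OF mp mj] by simp
  ultimately show ?thesis by linarith
qed

end

end

section \<open>Lower bound on the Bayes risk\<close>

context divergences
begin

lemma Istar_pos:
  assumes "1 \<le> K" "K \<le> M" "2 \<le> M"
  shows "0 < Istar M K (KL \<mu> g f) (KL \<mu> f g)"
  using assms Dgf_pos Dfg_pos by (auto simp: Istar_def less_max_iff_disj add_pos_pos add_pos_nonneg)

text \<open>Summed over the alternatives, the drift depends on \<open>S\<close> only through whether
  \<open>m\<close> is in it: \<open>card (S - {m})\<close> is then \<open>K - 1\<close>, and
  otherwise \<open>K\<close>. For \<open>K < M\<close> the two totals are the two terms of the
  maximum in \<open>Istar\<close>, times \<open>M - 1\<close>.\<close>

lemma selection_rate: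
  assumes S: "S \<subseteq> {..<M}" "card S = K" and K: "1 \<le> K" and m: "m < M" and M: "2 \<le> M"
  shows "(\<Sum>j\<in>{..<M}-{m}. (if m \<in> S then KL \<mu> g f else 0) + (if j \<in> S then KL \<mu> f g else 0))
    \<le> (real M - 1) * Istar M K (KL \<mu> g f) (KL \<mu> f g)" (is "?L \<le> _ * ?I")
proof -
  have finS: "finite S" using S(1) finite_subset by blast
  have KM: "K \<le> M" using card_mono[OF _ S(1)] S(2) by simp
  have "?L = (real M - 1) * (if m \<in> S then KL \<mu> g f else 0) + real (card (S - {m})) * KL \<mu> f g"
  proof -
    have "(\<Sum>j\<in>{..<M}-{m}. if j \<in> S then KL \<mu> f g else 0) = (\<Sum>j\<in>S-{m}. KL \<mu> f g)"
      by (rule sum.mono_neutral_cong_right) (use S in auto)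
    then show ?thesis using m M by (simp add: sum.distrib of_nat_diff)
  qed
  also have "\<dots> \<le> (real M - 1) * ?I"
  proof (cases "K = M")
    case True
    then have "S = {..<M}" using S by (intro card_subset_eq) auto
    then show ?thesis using True m M by (simp add: Istar_def card_Diff_singleton of_nat_diff algebra_simps)
  next
    case False
    then have I: "?I = max (real K * KL \<mu> f g / (real M - 1)) (KL \<mu> g f + (real K - 1) * KL \<mu> f g / (real M - 1))"
      by (simp add: Istar_def)
    have M1: "0 < real M - 1" using M by simp
    show ?thesis
    proof (cases "m \<in> S")
      case True
      have "(real M - 1) * (KL \<mu> g f + (real K - 1) * KL \<mu> f g / (real M - 1)) \<le> (real M - 1) * ?I"
        unfolding I using M1 by (intro mult_left_mono) auto
      moreover have "(real M - 1) * (KL \<mu> g f + (real K - 1) * KL \<mu> f g / (real M - 1))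
          = (real M - 1) * KL \<mu> g f + (real K - 1) * KL \<mu> f g"
        using M1 by (simp add: distrib_left)
      ultimately show ?thesis using True S(2) K finS by (simp add: card_Diff_singleton of_nat_diff)
    next
      case False
      have "(real M - 1) * (real K * KL \<mu> f g / (real M - 1)) \<le> (real M - 1) * ?I"
        unfolding I using M1 by (intro mult_left_mono) auto
      then show ?thesis using False S(2) finS M1 by simp
    qed
  qed
  finally show ?thesis .
qed

lemma expected_stop_time:
  assumes mp: "meas_policy p"
  shows "(\<integral>\<^sup>+\<omega>. stop_time p \<omega> \<partial>Pr G) = (\<Sum>n. ennreal (measure (Pr G) {\<omega>\<in>space Om. live p \<omega> (Suc n)}))"
proof -
  interpret P: prob_space "Pr G" by (rule prob_Pr)
  note [measurable] = live_meas[OF mp]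
  have "(\<integral>\<^sup>+\<omega>. stop_time p \<omega> \<partial>Pr G) = (\<integral>\<^sup>+\<omega>. (\<Sum>n. indicator {\<omega>\<in>space Om. live p \<omega> (Suc n)} \<omega>) \<partial>Pr G)"
    by (intro nn_integral_cong) (auto simp: stop_time_eq intro!: suminf_cong)
  also have "\<dots> = (\<Sum>n. \<integral>\<^sup>+\<omega>. indicator {\<omega>\<in>space Om. live p \<omega> (Suc n)} \<omega> \<partial>Pr G)"
    by (rule nn_integral_suminf) measurable
  also have "\<dots> = (\<Sum>n. ennreal (measure (Pr G) {\<omega>\<in>space Om. live p \<omega> (Suc n)}))"
    by (simp add: P.emeasure_eq_measure)
  finally show ?thesis .
qed

context
  fixes p :: "'a policy" and M K :: nat
  assumes M: "2 \<le> M" and K: "1 \<le> K" "K \<le> M" and adm: "admissible M K \<mu> f g p"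
begin

lemma admissible_meas_policy: "meas_policy p"
  using adm M by (intro meas_policyI[of M]) auto

lemma expected_llr_bound:
  assumes m: "m < M"
  shows "(\<Sum>j\<in>{..<M}-{m}. \<integral>\<omega>. Lam p n m \<omega> - Lam p n j \<omega> \<partial>H m)
    \<le> (real M - 1) * Istar M K (KL \<mu> g f) (KL \<mu> f g) * (\<Sum>t<n. measure (H m) {\<omega>\<in>space Om. live p \<omega> (Suc t)})"
proof -
  interpret P: prob_space "H m" by (rule prob_Pr)
  note [measurable] = act_meas[OF admissible_meas_policy] live_meas[OF admissible_meas_policy]
  let ?J = "{..<M} - {m}" and ?I = "Istar M K (KL \<mu> g f) (KL \<mu> f g)"
  let ?A = "\<lambda>t k. {\<omega>\<in>space Om. act p (t, k) \<omega>}" and ?L = "\<lambda>t. {\<omega>\<in>space Om. live p \<omega> (Suc t)}"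
  have ind: "integrable (H m) (\<lambda>\<omega>. r * indicat_real {\<omega>\<in>space Om. Q \<omega>} \<omega>)"
    "(\<integral>\<omega>. r * indicat_real {\<omega>\<in>space Om. Q \<omega>} \<omega> \<partial>H m) = r * measure (H m) {\<omega>\<in>space Om. Q \<omega>}"
    if [measurable]: "Measurable.pred Om Q" for Q r
  proof -
    show "integrable (H m) (\<lambda>\<omega>. r * indicat_real {\<omega>\<in>space Om. Q \<omega>} \<omega>)"
      by (intro integrable_mult_right P.integrable_const_bound[where B=1]) auto
    have "(\<integral>\<omega>. indicat_real {\<omega>\<in>space Om. Q \<omega>} \<omega> \<partial>H m) = measure (H m) {\<omega>\<in>space Om. Q \<omega>}"
      by (subst Bochner_Integration.integral_indicator) (auto intro!: arg_cong[where f="measure (H m)"])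
    then show "(\<integral>\<omega>. r * indicat_real {\<omega>\<in>space Om. Q \<omega>} \<omega> \<partial>H m) = r * measure (H m) {\<omega>\<in>space Om. Q \<omega>}"
      by simp
  qed
  note indA = ind[OF act_meas[OF admissible_meas_policy]] and indL = ind[OF live_meas[OF admissible_meas_policy]]
  have step: "(\<Sum>j\<in>?J. KL \<mu> g f * measure (H m) (?A t m) + KL \<mu> f g * measure (H m) (?A t j))
      \<le> (real M - 1) * ?I * measure (H m) (?L t)" for t
  proof -
    have "(\<Sum>j\<in>?J. KL \<mu> g f * measure (H m) (?A t m) + KL \<mu> f g * measure (H m) (?A t j))
      = (\<integral>\<omega>. (\<Sum>j\<in>?J. KL \<mu> g f * indicat_real (?A t m) \<omega> + KL \<mu> f g * indicat_real (?A t j) \<omega>) \<partial>H m)"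
      
    proof (subst Bochner_Integration.integral_sum)
      fix j show "integrable (H m) (\<lambda>\<omega>. KL \<mu> g f * indicat_real (?A t m) \<omega> + KL \<mu> f g * indicat_real (?A t j) \<omega>)"
        by (intro Bochner_Integration.integrable_add indA)
    next
      have "(\<integral>\<omega>. KL \<mu> g f * indicat_real (?A t m) \<omega> + KL \<mu> f g * indicat_real (?A t j) \<omega> \<partial>H m)
        = KL \<mu> g f * measure (H m) (?A t m) + KL \<mu> f g * measure (H m) (?A t j)" for j
        by (subst Bochner_Integration.integral_add[OF indA(1) indA(1)]) (simp only: indA(2))
      then show "(\<Sum>j\<in>?J. KL \<mu> g f * measure (H m) (?A t m) + KL \<mu> f g * measure (H m) (?A t j))
        = (\<Sum>j\<in>?J. \<integral>\<omega>. KL \<mu> g f * indicat_real (?A t m) \<omega> + KL \<mu> f g * indicat_real (?A t j) \<omega> \<partial>H m)"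
        by (simp only:)
    qed
    also have "\<dots> \<le> (\<integral>\<omega>. (real M - 1) * ?I * indicat_real (?L t) \<omega> \<partial>H m)"
    proof (rule integral_mono)
      fix \<omega> assume "\<omega> \<in> space (H m)"
      then have \<omega>: "\<omega> \<in> space Om" by simp
      have S: "Sel p \<omega> t \<subseteq> {..<M}" "card (Sel p \<omega> t) = K" using adm by (auto simp: admissible_def)
      show "(\<Sum>j\<in>?J. KL \<mu> g f * indicat_real (?A t m) \<omega> + KL \<mu> f g * indicat_real (?A t j) \<omega>)
        \<le> (real M - 1) * ?I * indicat_real (?L t) \<omega>"
      proof (cases "live p \<omega> (Suc t)")
        case True
        then have "KL \<mu> g f * indicat_real (?A t m) \<omega> + KL \<mu> f g * indicat_real (?A t j) \<omega>
          = (if m \<in> Sel p \<omega> t then KL \<mu> g f else 0) + (if j \<in> Sel p \<omega> t then KL \<mu> f g else 0)" for j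
          using \<omega> by (simp add: act_def)
        then show ?thesis using selection_rate[OF S K(1) m M] \<omega> True by simp
      qed (simp add: act_def)
    qed (intro Bochner_Integration.integrable_sum Bochner_Integration.integrable_add indA indL)+
    also have "\<dots> = (real M - 1) * ?I * measure (H m) (?L t)" by (rule indL)
    finally show ?thesis .
  qed
  have "(\<Sum>j\<in>?J. \<integral>\<omega>. Lam p n m \<omega> - Lam p n j \<omega> \<partial>H m)
    = (\<Sum>j\<in>?J. \<Sum>t<n. KL \<mu> g f * measure (H m) (?A t m) + KL \<mu> f g * measure (H m) (?A t j))"
  proof (rule sum.cong)
    fix j assume "j \<in> ?J"
    then show "(\<integral>\<omega>. Lam p n m \<omega> - Lam p n j \<omega> \<partial>H m)
      = (\<Sum>t<n. KL \<mu> g f * measure (H m) (?A t m) + KL \<mu> f g * measure (H m) (?A t j))"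
      by (subst Bochner_Integration.integral_diff)
         (auto simp: Lam_integral[OF admissible_meas_policy] sum.distrib sum_negf algebra_simps)
  qed simp
  also have "\<dots> = (\<Sum>t<n. \<Sum>j\<in>?J. KL \<mu> g f * measure (H m) (?A t m) + KL \<mu> f g * measure (H m) (?A t j))"
    by (rule sum.swap)
  also have "\<dots> \<le> (\<Sum>t<n. (real M - 1) * ?I * measure (H m) (?L t))"
    by (intro sum_mono step)
  finally show ?thesis by (simp add: sum_distrib_left)
qed

text \<open>The information bound is averaged over \<open>j\<close> before \<open>n\<close> grows.
  The right side is then bounded through \<open>T\<close> for every \<open>n\<close>, so the only
  limit to take is that of the probability of a correct decision.\<close>

lemma expected_time_lower:
  assumes m: "m < M" and e: "\<And>j. j < M \<Longrightarrow> alpha p j \<le> e"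
    and T: "(\<integral>\<^sup>+\<omega>. stop_time p \<omega> \<partial>H m) = ennreal T" "0 \<le> T"
  shows "a * (1 - alpha p m) - exp a * e \<le> Istar M K (KL \<mu> g f) (KL \<mu> f g) * T"
proof (rule LIMSEQ_le_const2)
  let ?I = "Istar M K (KL \<mu> g f) (KL \<mu> f g)"
  let ?P = "\<lambda>n. measure (H m) {\<omega>\<in>space Om. ends p m n \<omega>}"
  show "(\<lambda>n. a * ?P n - exp a * e) \<longlonglongrightarrow> a * (1 - alpha p m) - exp a * e"
    by (rule tendsto_diff[OF tendsto_mult[OF tendsto_const ends_limit[OF admissible_meas_policy]] tendsto_const])
  have M1: "0 < real M - 1" using M by simp
  show "\<exists>N. \<forall>n\<ge>N. a * ?P n - exp a * e \<le> ?I * T"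
  proof (intro exI[of _ 0] allI impI)
    fix n
    let ?s = "\<Sum>t<n. measure (H m) {\<omega>\<in>space Om. live p \<omega> (Suc t)}"
    have "ennreal ?s = (\<Sum>t<n. ennreal (measure (H m) {\<omega>\<in>space Om. live p \<omega> (Suc t)}))"
      by (rule sum_ennreal[symmetric]) simp
    also have "\<dots> \<le> (\<Sum>t. ennreal (measure (H m) {\<omega>\<in>space Om. live p \<omega> (Suc t)}))"
      by (rule sum_le_suminf) auto
    also have "\<dots> = ennreal T" using T(1) expected_stop_time[OF admissible_meas_policy] by metis
    finally have "ennreal ?s \<le> ennreal T" .
    then have s: "?s \<le> T" using T(2) by simp
    have "(real M - 1) * (a * ?P n - exp a * e) = (\<Sum>j\<in>{..<M}-{m}. a * ?P n - exp a * e)"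
    proof -
      have "real (card ({..<M} - {m})) = real M - 1" using m M by (simp add: of_nat_diff)
      then show ?thesis by (simp only: sum_constant)
    qed
    also have "\<dots> \<le> (\<Sum>j\<in>{..<M}-{m}. \<integral>\<omega>. Lam p n m \<omega> - Lam p n j \<omega> \<partial>H m)"
    proof (rule sum_mono)
      fix j assume j: "j \<in> {..<M}-{m}"
      have "exp a * alpha p j \<le> exp a * e" using e[of j] j by simp
      then show "a * ?P n - exp a * e \<le> (\<integral>\<omega>. Lam p n m \<omega> - Lam p n j \<omega> \<partial>H m)"
        using information_bound[OF admissible_meas_policy, of m j a n] j by (simp only: Diff_iff singleton_iff) linarith
    qed
    also have "\<dots> \<le> (real M - 1) * ?I * ?s" by (rule expected_llr_bound[OF m])
    also have "\<dots> \<le> (real M - 1) * (?I * T)"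
      unfolding mult.assoc using s Istar_pos[OF K M] M1 by (intro mult_left_mono) auto
    finally show "a * ?P n - exp a * e \<le> ?I * T" using M1 by (rule mult_left_le_imp_le)
  qed
qed

lemma bayes_risk_eq:
  "bayes_risk M \<mu> f g \<pi> c p = (\<Sum>m<M. ennreal (\<pi> m) * ennreal (alpha p m))
     + ennreal c * (\<Sum>m<M. ennreal (\<pi> m) * (\<integral>\<^sup>+\<omega>. stop_time p \<omega> \<partial>H m))"
proof -
  have "emeasure (H m) {\<omega>\<in>space Om. decision_error p m \<omega>} = ennreal (alpha p m)" for m
    unfolding alpha_def by (simp add: finite_measure.emeasure_eq_measure prob_space.finite_measure[OF prob_Pr])
  then show ?thesis by (simp add: bayes_risk_def sample_space_eq_Pr)
qed

text \<open>Errors lower the information bound by at most \<open>(a + exp a / q) * Pe\<close>, since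
  each error probability is at most \<open>Pe / q\<close>. After multiplication by \<open>c\<close>
  this is at most \<open>I* * Pe\<close> by \<open>small\<close>, and the error term of the risk
  itself pays for it. Accurate and inaccurate policies are thus treated alike.\<close>

lemma bayes_risk_lower:
  assumes c: "0 < c" and a: "0 \<le> a" and prior: "\<forall>m<M. 0 < \<pi> m" "(\<Sum>m<M. \<pi> m) = 1"
    and q: "0 < q" "\<And>m. m < M \<Longrightarrow> q \<le> \<pi> m"
    and small: "c * (a + exp a / q) \<le> Istar M K (KL \<mu> g f) (KL \<mu> f g)"
  shows "ennreal (c * a / Istar M K (KL \<mu> g f) (KL \<mu> f g)) \<le> bayes_risk M \<mu> f g \<pi> c p"
proof (cases "\<exists>m<M. (\<integral>\<^sup>+\<omega>. stop_time p \<omega> \<partial>H m) = \<infinity>")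
  case True
  then obtain m where m: "m < M" "(\<integral>\<^sup>+\<omega>. stop_time p \<omega> \<partial>H m) = \<infinity>" by blast
  have "ennreal (\<pi> m) * (\<integral>\<^sup>+\<omega>. stop_time p \<omega> \<partial>H m) = \<infinity>"
    using m prior(1) by (auto simp: ennreal_mult_eq_top_iff ennreal_eq_0_iff not_le)
  moreover have "ennreal (\<pi> m) * (\<integral>\<^sup>+\<omega>. stop_time p \<omega> \<partial>H m) \<le> (\<Sum>m<M. ennreal (\<pi> m) * (\<integral>\<^sup>+\<omega>. stop_time p \<omega> \<partial>H m))"
    using m(1) by (intro member_le_sum) auto
  ultimately have "(\<Sum>m<M. ennreal (\<pi> m) * (\<integral>\<^sup>+\<omega>. stop_time p \<omega> \<partial>H m)) = \<infinity>"
    by (simp add: top_unique)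
  then have "bayes_risk M \<mu> f g \<pi> c p = \<infinity>"
    unfolding bayes_risk_eq using c by (simp only: infinity_ennreal_def ennreal_mult_eq_top_iff add_top) (simp add: ennreal_mult_top)
  then show ?thesis by simp
next
  case False
  let ?I = "Istar M K (KL \<mu> g f) (KL \<mu> f g)"
  define T where "T m = enn2real (\<integral>\<^sup>+\<omega>. stop_time p \<omega> \<partial>H m)" for m
  have T: "(\<integral>\<^sup>+\<omega>. stop_time p \<omega> \<partial>H m) = ennreal (T m)" "0 \<le> T m" if "m < M" for m
    using False that unfolding T_def by (auto simp: less_top)
  define Pe where "Pe = (\<Sum>m<M. \<pi> m * alpha p m)"
  have al: "0 \<le> alpha p m" for m by (simp add: alpha_def)
  have pi0: "0 \<le> \<pi> m" if "m < M" for m using prior(1) that by (auto intro: less_imp_le)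
  have Pe0: "0 \<le> Pe" unfolding Pe_def using pi0 al by (intro sum_nonneg mult_nonneg_nonneg) auto
  have e: "alpha p j \<le> Pe / q" if j: "j < M" for j
  proof -
    have "q * alpha p j \<le> \<pi> j * alpha p j" using q(2)[OF j] al by (intro mult_right_mono)
    also have "\<dots> \<le> Pe" unfolding Pe_def
      using pi0 al j by (intro member_le_sum) auto
    finally show ?thesis using q(1) by (simp add: field_simps)
  qed
  have I: "0 < ?I" by (rule Istar_pos[OF K M])
  have "bayes_risk M \<mu> f g \<pi> c p = ennreal (Pe + c * (\<Sum>m<M. \<pi> m * T m))"
  proof -
    have "(\<Sum>m<M. ennreal (\<pi> m) * ennreal (alpha p m)) = ennreal Pe"
      unfolding Pe_def using pi0 al by (subst sum_ennreal[symmetric]) (auto simp: ennreal_mult intro!: sum.cong)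
    moreover have "(\<Sum>m<M. ennreal (\<pi> m) * (\<integral>\<^sup>+\<omega>. stop_time p \<omega> \<partial>H m)) = ennreal (\<Sum>m<M. \<pi> m * T m)"
      using pi0 T by (subst sum_ennreal[symmetric]) (auto simp: ennreal_mult intro!: sum.cong)
    moreover have "0 \<le> (\<Sum>m<M. \<pi> m * T m)" using pi0 T by (intro sum_nonneg) auto
    ultimately show ?thesis using c Pe0 by (simp add: bayes_risk_eq ennreal_mult ennreal_plus)
  qed
  moreover have "c * a / ?I \<le> Pe + c * (\<Sum>m<M. \<pi> m * T m)"
  proof -
    have "(\<Sum>m<M. \<pi> m * (a * (1 - alpha p m) - exp a * (Pe / q))) \<le> (\<Sum>m<M. \<pi> m * (?I * T m))"
      using expected_time_lower[of _ "Pe / q" "T _" a] e T pi0 by (intro sum_mono mult_left_mono) auto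
    moreover have "(\<Sum>m<M. \<pi> m * (a * (1 - alpha p m) - exp a * (Pe / q)))
        = a * (\<Sum>m<M. \<pi> m) - a * Pe - exp a * (Pe / q) * (\<Sum>m<M. \<pi> m)"
      unfolding Pe_def sum_distrib_left sum_subtractf[symmetric]
      by (intro sum.cong) (auto simp: algebra_simps)
    moreover have "(\<Sum>m<M. \<pi> m * (?I * T m)) = ?I * (\<Sum>m<M. \<pi> m * T m)"
      unfolding sum_distrib_left by (intro sum.cong refl mult.left_commute)
    ultimately have "a - a * Pe - exp a * (Pe / q) \<le> ?I * (\<Sum>m<M. \<pi> m * T m)"
      by (simp add: prior(2))
    then have "c * (a - a * Pe - exp a * (Pe / q)) \<le> c * (?I * (\<Sum>m<M. \<pi> m * T m))"
      using c by (intro mult_left_mono) auto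
    moreover have "c * (a + exp a / q) * Pe \<le> ?I * Pe" using small Pe0 by (rule mult_right_mono)
    ultimately have "c * a \<le> ?I * (Pe + c * (\<Sum>m<M. \<pi> m * T m))"
      by (simp add: algebra_simps)
    then show ?thesis using I by (simp add: field_simps)
  qed
  ultimately show ?thesis by (simp add: ennreal_leI)
qed

end

end

section \<open>Random subsets\<close>

text \<open>The rank, the number of smaller elements, is injective on \<open>A\<close> with values
  below \<open>card A\<close>, hence a bijection onto these values; so exactly \<open>r\<close>
  elements have rank below \<open>r\<close>.\<close>

lemma card_smallest:
  assumes A: "finite A" "r \<le> card A"
    and irr: "\<And>x. \<not> lt x x" and tr: "\<And>x y z. lt x y \<Longrightarrow> lt y z \<Longrightarrow> lt x z"
    and tot: "\<And>x y. x \<in> A \<Longrightarrow> y \<in> A \<Longrightarrow> x \<noteq> y \<Longrightarrow> lt x y \<or> lt y x"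
  shows "card {k \<in> A. card {j \<in> A. lt j k} < r} = r"
proof -
  let ?rk = "\<lambda>k. card {j \<in> A. lt j k}"
  have less: "?rk x < ?rk y" if "x \<in> A" "lt x y" for x y
  proof -
    have "{j \<in> A. lt j x} \<subset> {j \<in> A. lt j y}"
      using that irr[of x] tr[of _ x y] by blast
    then show ?thesis using A by (intro psubset_card_mono) auto
  qed
  have inj: "inj_on ?rk A"
  proof (rule inj_onI)
    fix x y assume xy: "x \<in> A" "y \<in> A" "?rk x = ?rk y"
    then show "x = y" using less[of x y] less[of y x] tot[of x y] by fastforce
  qed
  have "?rk ` A \<subseteq> {..<card A}"
  proof (rule image_subsetI)
    fix k assume k: "k \<in> A"
    then show "?rk k \<in> {..<card A}" using A irr[of k] by (auto intro!: psubset_card_mono)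
  qed
  then have im: "?rk ` A = {..<card A}"
    by (rule card_subset_eq[OF finite_lessThan]) (simp add: card_image[OF inj])
  have "card {k \<in> A. ?rk k < r} = card (?rk ` {k \<in> A. ?rk k < r})"
    by (rule card_image[symmetric]) (rule inj_on_subset[OF inj], auto)
  also have "?rk ` {k \<in> A. ?rk k < r} = {..<r}"
  proof -
    have "?rk ` {k \<in> A. ?rk k < r} = ?rk ` A \<inter> {..<r}" by auto
    then show ?thesis using im A(2) by auto
  qed
  finally show ?thesis by simp
qed

lemma rand_subset_subset: "rand_subset \<xi> n A r \<subseteq> A"
  by (auto simp: rand_subset_def)

lemma card_rand_subset:
  assumes "finite A" "r \<le> card A"
  shows "card (rand_subset \<xi> n A r) = r"
  unfolding rand_subset_def using assms by (rule card_smallest) auto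

lemma rand_subset_row:
  assumes "\<And>k. \<xi> (n, k) = \<xi>' (n, k)"
  shows "rand_subset \<xi> n A r = rand_subset \<xi>' n A r"
  unfolding rand_subset_def assms ..

lemma measurable_card_less [measurable]:
  assumes A: "finite A" and P [measurable]: "\<And>j. j \<in> A \<Longrightarrow> Measurable.pred N (\<lambda>x. P x j)"
  shows "Measurable.pred N (\<lambda>x. card {j \<in> A. P x j} < r)"
proof -
  have "card {j \<in> A. P x j} = (\<Sum>j\<in>A. if P x j then 1 else 0)" for x
    using A by (simp add: sum.If_cases Int_def)
  then show ?thesis by simp
qed

lemma rand_subset_meas:
  assumes A: "finite A" and N: "\<And>i. (\<lambda>x. \<xi> x i) \<in> borel_measurable N"
  shows "Measurable.pred N (\<lambda>x. k \<in> rand_subset (\<xi> x) n A r)"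
proof -
  note [measurable] = N
  have "Measurable.pred N (\<lambda>x. card {j \<in> A. \<xi> x (n, j) < \<xi> x (n, k) \<or> (\<xi> x (n, j) = \<xi> x (n, k) \<and> j < k)} < r)"
    by (rule measurable_card_less[OF A]) measurable
  then show ?thesis unfolding rand_subset_def mem_Collect_eq by measurable
qed

lemma seed_component [measurable]: "(\<lambda>\<xi>. \<xi> i) \<in> borel_measurable seed_space"
proof -
  have "(\<lambda>\<xi>. \<xi> i) \<in> borel_measurable (PiM UNIV (\<lambda>_. unif))"
    using measurable_component_singleton[of i UNIV "\<lambda>_. unif"]
    by (simp cong: measurable_cong_sets)
  then show ?thesis unfolding seed_space_def .
qed

lemma space_seed_space [simp]: "space seed_space = UNIV"
  unfolding seed_space_def by (simp add: space_PiM)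

text \<open>Redrawing the seed at \<open>a\<close> makes it hit the fixed value at \<open>b\<close>
  with probability 0, as the uniform law has no atoms.\<close>

lemma seeds_distinct:
  assumes "a \<noteq> b"
  shows "AE \<xi> in seed_space. \<xi> a \<noteq> \<xi> b"
proof -
  let ?N = "\<lambda>_::nat \<times> nat. unif"
  let ?\<phi> = "\<lambda>\<xi>::seeds. indicator {\<xi>. \<xi> a = \<xi> b} \<xi> :: ennreal"
  have "{\<xi>\<in>space seed_space. \<xi> a = \<xi> b} \<in> sets seed_space"
    by (rule borel_measurable_eq[OF seed_component seed_component])
  then have phi: "?\<phi> \<in> borel_measurable seed_space" by (intro borel_measurable_indicator) simp
  have null: "emeasure unif {x} = 0" for x :: real
    by (subst emeasure_uniform_measure) (auto simp: emeasure_lborel_countable)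
  have u: "?N(a := unif) = ?N" by auto
  have "(\<integral>\<^sup>+\<xi>. ?\<phi> \<xi> \<partial>PiM UNIV (?N(a := unif))) = (\<integral>\<^sup>+\<xi>. \<integral>\<^sup>+y. ?\<phi> (\<xi>(a := y)) \<partial>unif \<partial>PiM UNIV ?N)"
    by (rule nn_integral_PiM_resample) (use phi in \<open>auto simp: prob_space_unif seed_space_def\<close>)
  also have "\<dots> = (\<integral>\<^sup>+\<xi>. \<integral>\<^sup>+y. indicator {\<xi> b} y \<partial>unif \<partial>PiM UNIV ?N)"
    using assms by (intro nn_integral_cong) (auto simp: indicator_def)
  also have "\<dots> = 0" by (simp add: null)
  finally have "(\<integral>\<^sup>+\<xi>. ?\<phi> \<xi> \<partial>seed_space) = 0" 
    unfolding seed_space_def by (simp only: u)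
  then have "AE \<xi> in seed_space. ?\<phi> \<xi> = 0" using phi by (simp add: nn_integral_0_iff_AE)
  then show ?thesis by eventually_elim (auto simp: indicator_def split: if_splits)
qed

text \<open>Away from ties, exchanging the seeds of two cells exchanges their roles in the random subset,
  so all cells of \<open>A\<close> are equally likely to be drawn.\<close>

lemma prob_rand_subset:
  assumes A: "finite A" and r: "r \<le> card A" and k: "k \<in> A"
  shows "measure seed_space {\<xi>. k \<in> rand_subset \<xi> n A r} = real r / real (card A)"
proof -
  interpret S: prob_space seed_space by (rule prob_space_seed_space)
  let ?Q = "\<lambda>k \<xi>. card {j\<in>A. \<xi> (n, j) < \<xi> (n, k)} < r"
  let ?R = "\<lambda>k \<xi>. k \<in> rand_subset \<xi> n A r"
  have Rm [measurable]: "Measurable.pred seed_space (?R k)" for k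
    by (rule rand_subset_meas[OF A]) measurable
  have Qm [measurable]: "Measurable.pred seed_space (?Q k)" for k
    by (rule measurable_card_less[OF A]) measurable
  \<comment> \<open>The tie rule prefers smaller indices and is not symmetric in the cells; almost
    surely no tie occurs.\<close>
  have QR: "measure seed_space {\<xi>. ?R k \<xi>} = measure seed_space {\<xi>. ?Q k \<xi>}" if k: "k \<in> A" for k
  proof (rule S.finite_measure_eq_AE)
    have "AE \<xi> in seed_space. \<forall>j\<in>A - {k}. \<xi> (n, j) \<noteq> \<xi> (n, k)"
      using A by (intro AE_finite_allI seeds_distinct) auto
    then show "AE \<xi> in seed_space. (\<xi> \<in> {\<xi>. ?R k \<xi>}) = (\<xi> \<in> {\<xi>. ?Q k \<xi>})"
    proof eventually_elim
      case (elim \<xi>)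
      have "{j\<in>A. \<xi> (n, j) < \<xi> (n, k) \<or> (\<xi> (n, j) = \<xi> (n, k) \<and> j < k)} = {j\<in>A. \<xi> (n, j) < \<xi> (n, k)}"
        using elim by auto
      then show ?case using k by (simp add: rand_subset_def)
    qed
  qed (use Rm[of k] Qm[of k] in \<open>auto simp: pred_def\<close>)
  have swap: "measure seed_space {\<xi>. ?Q k \<xi>} = measure seed_space {\<xi>. ?Q l \<xi>}" if kl: "k \<in> A" "l \<in> A" for k l
  proof -
    let ?t = "\<lambda>i. if i = (n, k) then (n, l) else if i = (n, l) then (n, k) else i"
    let ?T = "\<lambda>\<xi>::seeds. \<lambda>i\<in>UNIV. \<xi> (?t i)"
    have D: "distr seed_space seed_space ?T = seed_space"
      unfolding seed_space_def
      by (rule distr_PiM_reindex[of UNIV "\<lambda>_. unif" ?t UNIV]) (auto simp: prob_space_unif inj_on_def split: if_splits)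
    have Tm: "?T \<in> measurable seed_space seed_space"
      unfolding seed_space_def
      by (rule measurable_restrict, rule measurable_component_singleton) simp
    have QT: "?Q k (?T \<xi>) = ?Q l \<xi>" for \<xi>
    proof -
      let ?s = "\<lambda>j. if j = k then l else if j = l then k else j"
      have "bij_betw ?s {j\<in>A. \<xi> (n, ?s j) < \<xi> (n, l)} {j\<in>A. \<xi> (n, j) < \<xi> (n, l)}"
        by (rule bij_betwI[where g="?s"]) (use kl in \<open>auto split: if_splits\<close>)
      then have "card {j\<in>A. \<xi> (n, ?s j) < \<xi> (n, l)} = card {j\<in>A. \<xi> (n, j) < \<xi> (n, l)}"
        by (rule bij_betw_same_card)
      moreover have "{j\<in>A. ?T \<xi> (n, j) < ?T \<xi> (n, k)} = {j\<in>A. \<xi> (n, ?s j) < \<xi> (n, l)}"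
        by (auto split: if_splits)
      ultimately show ?thesis by simp
    qed
    have "measure (distr seed_space seed_space ?T) {\<xi>. ?Q k \<xi>} = measure seed_space (?T -` {\<xi>. ?Q k \<xi>} \<inter> space seed_space)"
      by (rule measure_distr[OF Tm]) (use Qm[of k] in \<open>auto simp: pred_def\<close>)
    also have "?T -` {\<xi>. ?Q k \<xi>} \<inter> space seed_space = {\<xi>. ?Q l \<xi>}"
      using QT by auto
    finally show ?thesis unfolding D .
  qed
  \<comment> \<open>Exactly \<open>r\<close> cells are drawn, so the equal probabilities add up to
    \<open>r\<close>.\<close>
  have "real r = (\<integral>\<xi>. (\<Sum>j\<in>A. indicat_real {\<xi>. ?R j \<xi>} \<xi>) \<partial>seed_space)"
  proof -
    have "(\<Sum>j\<in>A. indicat_real {\<xi>. ?R j \<xi>} \<xi>) = real r" for \<xi>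
    proof -
      have "(\<Sum>j\<in>A. indicat_real {\<xi>. ?R j \<xi>} \<xi>) = real (card (A \<inter> rand_subset \<xi> n A r))"
        using A by (simp add: indicator_def sum.If_cases Int_def)
      also have "A \<inter> rand_subset \<xi> n A r = rand_subset \<xi> n A r" using rand_subset_subset by blast
      finally show ?thesis by (simp add: card_rand_subset[OF A r])
    qed
    then show ?thesis using S.prob_space by simp
  qed
  also have "\<dots> = (\<Sum>j\<in>A. measure seed_space {\<xi>. ?R j \<xi>})"
  proof -
    have s: "{\<xi>. ?R j \<xi>} \<in> sets seed_space" for j using Rm[of j] by (simp add: pred_def)
    show ?thesis
      using s by (subst Bochner_Integration.integral_sum)
        (auto intro!: integrable_real_indicator simp: S.emeasure_eq_measure)
  qed
  also have "\<dots> = (\<Sum>j\<in>A. measure seed_space {\<xi>. ?R k \<xi>})"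
  proof (rule sum.cong[OF refl])
    fix j assume j: "j \<in> A"
    show "measure seed_space {\<xi>. ?R j \<xi>} = measure seed_space {\<xi>. ?R k \<xi>}"
      unfolding QR[OF j] QR[OF k] by (rule swap[OF j k])
  qed
  also have "\<dots> = real (card A) * measure seed_space {\<xi>. ?R k \<xi>}" by simp
  finally show ?thesis using k A by (auto simp: field_simps card_gt_0_iff)
qed

section \<open>The Chernoff test\<close>

text \<open>The derivative of the moment generating function at 0, taken along the exponents
  \<open>1 / Suc n\<close> so that dominated convergence for sequences applies. Chord and tangent of
  the exponential bound the difference quotient \<open>h n x\<close> by
  \<open>abs (X x) + exp (- X x)\<close>.\<close>

lemma exp_moment_derivative:
  fixes X :: "'b \<Rightarrow> real"
  assumes P: "prob_space D" and X: "integrable D X" and E: "integrable D (\<lambda>x. exp (- X x))" and e: "0 < \<eta>"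
  shows "\<forall>\<^sub>F n in sequentially. (\<integral>x. exp (- X x / real (Suc n)) \<partial>D) \<le> 1 - ((\<integral>x. X x \<partial>D) - \<eta>) / real (Suc n)"
    and "integrable D (\<lambda>x. exp (- X x / real (Suc n)))"
proof -
  interpret prob_space D by fact
  have [measurable]: "X \<in> borel_measurable D" using X by auto
  have upper: "exp (- x / real (Suc n)) \<le> 1 + (exp (- x) - 1) / real (Suc n)" for x n
  proof -
    have "exp ((1 - 1 / real (Suc n)) *\<^sub>R 0 + (1 / real (Suc n)) *\<^sub>R (- x))
      \<le> (1 - 1 / real (Suc n)) * exp 0 + (1 / real (Suc n)) * exp (- x)"
      by (rule convex_onD[OF exp_convex]) auto
    then show ?thesis by (simp add: diff_divide_distrib algebra_simps del: of_nat_Suc)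
  qed
  have lower: "1 - x / real (Suc n) \<le> exp (- x / real (Suc n))" for x n
    using exp_ge_add_one_self[of "- x / real (Suc n)"] by simp
  show int: "integrable D (\<lambda>x. exp (- X x / real (Suc n)))" for n
  proof (rule Bochner_Integration.integrable_bound)
    show "integrable D (\<lambda>x. 1 + exp (- X x))" using E by simp
    show "AE x in D. norm (exp (- X x / real (Suc n))) \<le> norm (1 + exp (- X x))"
    proof (rule AE_I2)
      fix x
      have "(exp (- X x) - 1) / real (Suc n) \<le> exp (- X x) / real (Suc n)" by (intro divide_right_mono) auto
      also have "\<dots> \<le> exp (- X x)" by (simp add: field_simps)
      finally show "norm (exp (- X x / real (Suc n))) \<le> norm (1 + exp (- X x))" using upper[of "X x" n] by simp
    qed
  qed measurable
  define h where "h n x = (exp (- X x / real (Suc n)) - 1) * real (Suc n)" for n x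
  have "(\<lambda>n. \<integral>x. h n x \<partial>D) \<longlonglongrightarrow> (\<integral>x. - X x \<partial>D)"
  proof (rule integral_dominated_convergence[where w="\<lambda>x. \<bar>X x\<bar> + exp (- X x)"])
    show "AE x in D. (\<lambda>n. h n x) \<longlonglongrightarrow> - X x"
    proof (rule AE_I2)
      fix x
      have "((\<lambda>u. (exp (u * (- X x)) - 1) / u) \<longlongrightarrow> - X x) (at 0)"
      proof -
        have "((\<lambda>u. exp (u * (- X x))) has_field_derivative (- X x)) (at 0)"
          by (auto intro!: derivative_eq_intros)
        then show ?thesis by (simp add: has_field_derivative_iff)
      qed
      then have "(\<lambda>n. (exp (inverse (real (Suc n)) * (- X x)) - 1) / inverse (real (Suc n))) \<longlonglongrightarrow> - X x"
        by (rule filterlim_compose) (auto simp: filterlim_at LIMSEQ_inverse_real_of_nat simp del: of_nat_Suc)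
      then show "(\<lambda>n. h n x) \<longlonglongrightarrow> - X x" by (simp add: h_def field_simps del: of_nat_Suc)
    qed
    show "AE x in D. norm (h n x) \<le> \<bar>X x\<bar> + exp (- X x)" for n
    proof (rule AE_I2)
      fix x
      have "exp (- X x / real (Suc n)) - 1 \<le> (exp (- X x) - 1) / real (Suc n)" using upper[of "X x" n] by linarith
      from mult_right_mono[OF this, of "real (Suc n)"] have "h n x \<le> exp (- X x) - 1"
        by (simp add: h_def del: of_nat_Suc)
      moreover have "- X x / real (Suc n) \<le> exp (- X x / real (Suc n)) - 1" using lower[of "X x" n] by simp
      from mult_right_mono[OF this, of "real (Suc n)"] have "- X x \<le> h n x"
        by (simp add: h_def del: of_nat_Suc)
      ultimately show "norm (h n x) \<le> \<bar>X x\<bar> + exp (- X x)" using exp_gt_zero[of "- X x"] by (simp only: real_norm_def)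
    qed
  qed (use X E in \<open>auto simp: h_def\<close>)
  then have "\<forall>\<^sub>F n in sequentially. (\<integral>x. h n x \<partial>D) < - (\<integral>x. X x \<partial>D) + \<eta>"
    using e by (intro order_tendstoD(2)) auto
  then show "\<forall>\<^sub>F n in sequentially. (\<integral>x. exp (- X x / real (Suc n)) \<partial>D) \<le> 1 - ((\<integral>x. X x \<partial>D) - \<eta>) / real (Suc n)"
  proof eventually_elim
    case (elim n)
    have "(\<integral>x. h n x \<partial>D) = ((\<integral>x. exp (- X x / real (Suc n)) \<partial>D) - 1) * real (Suc n)"
      unfolding h_def using int[of n] prob_space by simp
    with elim have "((\<integral>x. exp (- X x / real (Suc n)) \<partial>D) - 1) * real (Suc n) \<le> - (\<integral>x. X x \<partial>D) + \<eta>" by simp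
    then show ?case by (simp add: field_simps del: of_nat_Suc)
  qed
qed

lemma ex_arg_max:
  fixes F :: "'b \<Rightarrow> 'c::linorder"
  assumes "finite {x. P x}" "\<exists>x. P x"
  shows "P (arg_max F P)" "P y \<Longrightarrow> F y \<le> F (arg_max F P)"
proof -
  obtain x where "P x" "\<And>y. P y \<Longrightarrow> F y \<le> F x"
    using obtains_MAX[of "{x. P x}" F] assms by (metis (mono_tags) Max_ge empty_Collect_eq finite_imageI imageI mem_Collect_eq)
  then have "\<exists>x. is_arg_max F P x" by (auto simp: is_arg_max_linorder)
  then have "is_arg_max F P (arg_max F P)" unfolding arg_max_def by (rule someI_ex)
  then show "P (arg_max F P)" "P y \<Longrightarrow> F y \<le> F (arg_max F P)" by (auto simp: is_arg_max_linorder)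
qed

lemma leader_less:
  assumes "2 \<le> M"
  shows "leader M f g h < M"
  unfolding leader_def by (rule ex_arg_max(1)[where P="\<lambda>k. k < M"]) (use assms in \<open>auto intro!: exI[of _ "0::nat"]\<close>)

lemma leader_max:
  assumes "k < M"
  shows "Ssum f g h k \<le> Ssum f g h (leader M f g h)"
  unfolding leader_def
proof (rule ex_arg_max(2)[where P="\<lambda>k. k < M"])
  show "\<exists>x. x < M" using assms by blast
qed (use assms in simp_all)

text \<open>Comparing the leader with every other cell removes the runner-up and its arbitrary
  choice among ties.\<close>

lemma gap_ge_iff:
  assumes M: "2 \<le> M"
  shows "a \<le> gap M f g h \<longleftrightarrow> (\<forall>k<M. k \<noteq> leader M f g h \<longrightarrow> a \<le> Ssum f g h (leader M f g h) - Ssum f g h k)"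
proof -
  let ?l = "leader M f g h" and ?r = "runner_up M f g h"
  have ex: "\<exists>k. k < M \<and> k \<noteq> ?l" using M by (intro exI[of _ "if ?l = 0 then 1 else 0"]) auto
  have fin: "finite {k. k < M \<and> k \<noteq> ?l}" by simp
  note r = ex_arg_max[OF fin ex, where F="Ssum f g h", folded runner_up_def]
  show ?thesis
  proof
    assume "a \<le> gap M f g h"
    then have "a \<le> Ssum f g h ?l - Ssum f g h ?r" by (simp add: gap_def)
    moreover have "Ssum f g h k \<le> Ssum f g h ?r" if "k < M" "k \<noteq> ?l" for k using r(2)[of k] that by simp
    ultimately show "\<forall>k<M. k \<noteq> ?l \<longrightarrow> a \<le> Ssum f g h ?l - Ssum f g h k" by force
  qed (use r(1) in \<open>auto simp: gap_def\<close>)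
qed

lemma measurable_finite_subset:
  assumes "\<And>\<omega>. S \<omega> \<subseteq> {..<M::nat}" and [measurable]: "\<And>k. Measurable.pred N (\<lambda>\<omega>. k \<in> S \<omega>)"
  shows "S \<in> measurable N (count_space UNIV)"
proof (rule measurableI)
  fix X :: "nat set set"
  have eq: "{\<omega>\<in>space N. S \<omega> = B} = {\<omega>\<in>space N. \<forall>k<M. k \<in> S \<omega> \<longleftrightarrow> k \<in> B}" if "B \<subseteq> {..<M}" for B
    using assms(1) that by blast
  have "S -` X \<inter> space N = (\<Union>B\<in>X \<inter> Pow {..<M}. {\<omega>\<in>space N. S \<omega> = B})"
    using assms(1) by auto
  also have "\<dots> = (\<Union>B\<in>X \<inter> Pow {..<M}. {\<omega>\<in>space N. \<forall>k<M. k \<in> S \<omega> \<longleftrightarrow> k \<in> B})"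
    by (rule SUP_cong[OF refl]) (use eq in blast)
  also have "\<dots> \<in> sets N" by (intro sets.finite_UN) measurable
  finally show "S -` X \<inter> space N \<in> sets N" .
qed simp

text \<open>The arbitrary choice among ties is harmless: it is a function of the set of maximizers,
  and that set takes only finitely many values.\<close>

lemma measurable_arg_max:
  fixes F :: "'b \<Rightarrow> nat \<Rightarrow> real"
  assumes [measurable]: "\<And>k. (\<lambda>\<omega>. F \<omega> k) \<in> borel_measurable N"
  shows "(\<lambda>\<omega>. arg_max (F \<omega>) (\<lambda>k. k < M)) \<in> measurable N (count_space UNIV)"
proof -
  let ?A = "\<lambda>\<omega>. {x. is_arg_max (F \<omega>) (\<lambda>k. k < M) x}"
  have "?A \<in> measurable N (count_space UNIV)"
    by (rule measurable_finite_subset[where M=M]) (auto simp: is_arg_max_linorder)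
  then have "(\<lambda>\<omega>. SOME x. x \<in> ?A \<omega>) \<in> measurable N (count_space UNIV)"
    by (rule measurable_compose) simp
  then show ?thesis by (simp add: arg_max_def)
qed

lemma length_hist [simp]: "length (hist p \<omega> n) = n"
  by (induction n) (auto simp: Let_def)

context divergences
begin

text \<open>At exponent 1 the moments are exactly 1, since \<open>exp llr\<close> is the density
  ratio. \<open>C\<close> allows \<open>s\<close> to be taken as small as desired, and one
  \<open>s\<close> serves both laws because both estimates hold eventually along the same
  sequence.\<close>

lemma exp_moments:
  assumes e: "0 < \<eta>"
  obtains s where "0 < s" "s * C \<le> 1"
    "(\<integral>\<^sup>+y. ennreal (exp (- s * llr y)) \<partial>Dg) \<le> ennreal (1 - s * (KL \<mu> g f - \<eta>))"
    "(\<integral>\<^sup>+y. ennreal (exp (s * llr y)) \<partial>Df) \<le> ennreal (1 - s * (KL \<mu> f g - \<eta>))"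
proof -
  interpret Df: prob_space Df by (rule prob_D)
  interpret Dg: prob_space Dg by (rule prob_D)
  have "(\<integral>\<^sup>+y. ennreal (exp (- llr y)) \<partial>Dg) = 1"
    by (simp add: nn_integral_Dg ennreal_mult'[symmetric] exp_minus_inverse exp_add[symmetric] Df.emeasure_space_1)
  then have g: "integrable Dg (\<lambda>y. exp (- llr y))"
    by (intro integrableI_nn_integral_finite[where x=1]) auto
  have "(\<integral>\<^sup>+y. ennreal (exp (- (- llr y))) \<partial>Df) = 1"
    using nn_integral_Dg[of "\<lambda>_. 1"] by (simp add: Dg.emeasure_space_1)
  then have f: "integrable Df (\<lambda>y. exp (- (- llr y)))"
    by (intro integrableI_nn_integral_finite[where x=1]) auto
  note G = exp_moment_derivative[OF prob_D(2) llr_Dg(1) g e]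
  have mf: "integrable Df (\<lambda>y. - llr y)" using llr_Df(1) by simp
  note F = exp_moment_derivative[OF prob_D(1) mf f e]
  have "\<forall>\<^sub>F n in sequentially. C \<le> real (Suc n)"
    using eventually_ge_at_top[of "nat \<lceil>C\<rceil>"] by eventually_elim linarith
  then obtain n where n: "C \<le> real (Suc n)" "(\<integral>x. exp (- llr x / real (Suc n)) \<partial>Dg) \<le> 1 - ((\<integral>x. llr x \<partial>Dg) - \<eta>) / real (Suc n)"
    "(\<integral>x. exp (- (- llr x) / real (Suc n)) \<partial>Df) \<le> 1 - ((\<integral>x. - llr x \<partial>Df) - \<eta>) / real (Suc n)"
    using eventually_happens[OF eventually_conj[OF _ eventually_conj[OF G(1) F(1)]]] by auto
  show ?thesis
  proof (rule that[of "1 / real (Suc n)"])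
    show "1 / real (Suc n) * C \<le> 1" using n(1) by (simp add: field_simps)
    show "(\<integral>\<^sup>+y. ennreal (exp (- (1 / real (Suc n)) * llr y)) \<partial>Dg) \<le> ennreal (1 - 1 / real (Suc n) * (KL \<mu> g f - \<eta>))"
      using n(2) nn_integral_eq_integral[OF G(2)[of n]] by (simp add: llr_Dg ennreal_leI)
    show "(\<integral>\<^sup>+y. ennreal (exp (1 / real (Suc n) * llr y)) \<partial>Df) \<le> ennreal (1 - 1 / real (Suc n) * (KL \<mu> f g - \<eta>))"
      using n(3) nn_integral_eq_integral[OF F(2)[of n]] by (simp add: llr_Df ennreal_leI)
  qed auto
qed

text \<open>The leader \<open>l\<close> is an argument of its own, so that for each fixed
  \<open>l\<close> the selection is a function of row \<open>n\<close> of the seeds alone,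
  independent of the history that decides which \<open>l\<close> occurs.\<close>

definition csel :: "nat \<Rightarrow> nat \<Rightarrow> nat \<Rightarrow> seeds \<Rightarrow> nat \<Rightarrow> nat set" where
  "csel M K l \<xi> n = (if K = M then {..<M}
     else if KL \<mu> f g / (real M - 1) \<le> KL \<mu> g f then insert l (rand_subset \<xi> n ({..<M} - {l}) (K - 1))
     else rand_subset \<xi> n ({..<M} - {l}) K)"

abbreviation CT :: "nat \<Rightarrow> nat \<Rightarrow> real \<Rightarrow> 'a policy" where "CT M K c \<equiv> chernoff_test M K \<mu> f g c"

lemma sel_CT: "sel (CT M K c) \<xi> h = csel M K (leader M f g h) \<xi> (length h)"
  by (simp add: chernoff_test_def csel_def Let_def)

lemma dec_CT: "dec (CT M K c) \<xi> h = leader M f g h"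
  by (simp add: chernoff_test_def)

lemma stopped_CT: "stopped (CT M K c) \<omega> n \<longleftrightarrow> - ln c \<le> gap M f g (hist (CT M K c) \<omega> n)"
  by (simp add: stopped_def chernoff_test_def)

lemma csel_subset: "l < M \<Longrightarrow> csel M K l \<xi> n \<subseteq> {..<M}"
  using rand_subset_subset[of \<xi> n "{..<M} - {l}" "K - 1"] rand_subset_subset[of \<xi> n "{..<M} - {l}" K]
  by (auto simp: csel_def)

lemma card_csel:
  assumes "l < M" "1 \<le> K" "K \<le> M"
  shows "card (csel M K l \<xi> n) = K"
proof -
  have c: "card ({..<M} - {l}) = M - 1" using assms by simp
  have "card (rand_subset \<xi> n ({..<M} - {l}) (K - 1)) = K - 1"
    by (rule card_rand_subset) (use assms c in auto)
  moreover have "card (rand_subset \<xi> n ({..<M} - {l}) K) = K" if "K \<noteq> M"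
    by (rule card_rand_subset) (use assms c that in auto)
  moreover have "l \<notin> rand_subset \<xi> n ({..<M} - {l}) (K - 1)"
    using rand_subset_subset[of \<xi> n "{..<M} - {l}" "K - 1"] by blast
  moreover have "finite (rand_subset \<xi> n ({..<M} - {l}) (K - 1))"
    using finite_subset[OF rand_subset_subset] by blast
  ultimately show ?thesis using assms by (simp add: csel_def)
qed

lemma csel_row: "(\<And>k. \<xi> (n, k) = \<xi>' (n, k)) \<Longrightarrow> csel M K l \<xi> n = csel M K l \<xi>' n"
  unfolding csel_def using rand_subset_row[of \<xi> n \<xi>'] by simp

lemma csel_meas:
  assumes "\<And>i. (\<lambda>x. \<xi> x i) \<in> borel_measurable N"
  shows "Measurable.pred N (\<lambda>x. k \<in> csel M K l (\<xi> x) n)"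
proof -
  have R: "Measurable.pred N (\<lambda>x. j \<in> rand_subset (\<xi> x) n ({..<M} - {l}) r)" for r j
    by (rule rand_subset_meas[OF _ assms]) simp
  show ?thesis unfolding csel_def
    by (cases "K = M"; cases "KL \<mu> f g / (real M - 1) \<le> KL \<mu> g f"; cases "k = l") (simp_all add: R)
qed

lemma hist_CT: "hist (CT M K c) \<omega> n = hist (CT M K 1) \<omega> n"
  by (induction n) (auto simp: Let_def sel_CT)

end

text \<open>The selection rule does not depend on the cost \<open>c\<close>, so one observation process serves all costs.\<close>

locale chernoff_process = divergences +
  fixes M K :: nat
  assumes M: "2 \<le> M" and K: "1 \<le> K" "K \<le> M"
begin

abbreviation "p \<equiv> CT M K 1"

definition S :: "nat \<Rightarrow> nat \<Rightarrow> 'a sample \<Rightarrow> real" where "S n k \<omega> = Ssum f g (hist p \<omega> n) k"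
definition ld :: "nat \<Rightarrow> 'a sample \<Rightarrow> nat" where "ld n \<omega> = leader M f g (hist p \<omega> n)"

lemma Sel_eq: "Sel p \<omega> n = csel M K (ld n \<omega>) (snd \<omega>) n"
  by (simp add: sel_CT ld_def)

lemma Sel_CT: "Sel (CT M K c) \<omega> n = csel M K (ld n \<omega>) (snd \<omega>) n"
  by (simp add: sel_CT ld_def hist_CT[of _ _ c])

lemma Sel_CT_eq: "Sel (CT M K c) \<omega> n = Sel p \<omega> n"
  unfolding Sel_CT ..

lemma S_0 [simp]: "S 0 k \<omega> = 0"
  by (simp add: S_def Ssum_def)

lemma S_Suc: "S (Suc n) k \<omega> = S n k \<omega> + (if k \<in> Sel p \<omega> n then llr (fst \<omega> (n, k)) else 0)"
  by (simp add: S_def Ssum_def Let_def llr_def)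

lemma ld_less: "ld n \<omega> < M"
  using leader_less[OF M] by (simp add: ld_def)

lemma ld_max: "k < M \<Longrightarrow> S n k \<omega> \<le> S n (ld n \<omega>) \<omega>"
  using leader_max by (simp add: ld_def S_def)

text \<open>One induction for all three: the sums determine the leader, leader and seeds determine
  the selection, and the selection determines the next sums.\<close>

lemma S_ld_meas: "(\<forall>k. S n k \<in> borel_measurable Om) \<and> ld n \<in> measurable Om (count_space UNIV)
   \<and> (\<forall>k. Measurable.pred Om (\<lambda>\<omega>. k \<in> Sel p \<omega> n))"
proof (induction n)
  have ld: "ld n \<in> measurable Om (count_space UNIV)" if "\<forall>k. S n k \<in> borel_measurable Om" for n
    using measurable_arg_max[of "\<lambda>\<omega> k. S n k \<omega>" Om M] that
    unfolding ld_def[abs_def] leader_def S_def by simp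
  have Sel: "Measurable.pred Om (\<lambda>\<omega>. k \<in> Sel p \<omega> n)" if [measurable]: "ld n \<in> measurable Om (count_space UNIV)" for n k
  proof -
    have [measurable]: "Measurable.pred Om (\<lambda>\<omega>. k \<in> csel M K l (snd \<omega>) n)" for l
      by (rule csel_meas) measurable
    have "(\<lambda>\<omega>. k \<in> Sel p \<omega> n) = (\<lambda>\<omega>. \<exists>l<M. ld n \<omega> = l \<and> k \<in> csel M K l (snd \<omega>) n)"
      using ld_less by (auto simp: Sel_eq fun_eq_iff)
    then show ?thesis by simp
  qed
  {
    case 0
    have "S 0 k = (\<lambda>_. 0)" for k by (simp add: fun_eq_iff)
    then have "\<forall>k. S 0 k \<in> borel_measurable Om" by simp
    then show ?case using ld[of 0] Sel[of 0] by blast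
  next
    case (Suc n)
    note [measurable] = Suc[THEN conjunct1, rule_format] Suc[THEN conjunct2, THEN conjunct2, rule_format]
    have "(\<lambda>\<omega>. S n k \<omega> + (if k \<in> Sel p \<omega> n then llr (fst \<omega> (n, k)) else 0)) \<in> borel_measurable Om" for k
      by measurable
    then have "\<forall>k. S (Suc n) k \<in> borel_measurable Om" by (simp add: S_Suc[abs_def])
    then show ?case using ld[of "Suc n"] Sel[of "Suc n"] by blast
  }
qed

lemma S_meas [measurable]: "S n k \<in> borel_measurable Om"
  and ld_meas [measurable]: "ld n \<in> measurable Om (count_space UNIV)"
  and Sel_meas [measurable]: "Measurable.pred Om (\<lambda>\<omega>. k \<in> Sel p \<omega> n)"
  using S_ld_meas by auto

lemma stopped_iff:
  "stopped (CT M K c) \<omega> n \<longleftrightarrow> (\<forall>k<M. k \<noteq> ld n \<omega> \<longrightarrow> - ln c \<le> S n (ld n \<omega>) \<omega> - S n k \<omega>)"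
  unfolding stopped_CT gap_ge_iff[OF M] hist_CT[of _ _ c] by (simp add: S_def ld_def)

lemma stopped_CT_meas [measurable]: "Measurable.pred Om (\<lambda>\<omega>. stopped (CT M K c) \<omega> n)"
proof -
  have "(\<lambda>\<omega>. stopped (CT M K c) \<omega> n) = (\<lambda>\<omega>. \<exists>l\<in>{..<M}. ld n \<omega> = l \<and> (\<forall>k\<in>{..<M} - {l}. - ln c \<le> S n l \<omega> - S n k \<omega>))"
    (is "_ = ?R")
  proof (rule ext)
    fix \<omega> show "stopped (CT M K c) \<omega> n = ?R \<omega>"
      unfolding stopped_iff using ld_less[of n \<omega>] by auto
  qed
  moreover have "Measurable.pred Om ?R"
  proof (intro pred_intros_countable_bounded pred_intros_logic(3))
    show "Measurable.pred Om (\<lambda>\<omega>. ld n \<omega> = l)" for l by measurable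
    show "Measurable.pred Om (\<lambda>\<omega>. - ln c \<le> S n l \<omega> - S n k \<omega>)" for l k by measurable
  qed
  ultimately show ?thesis by (simp only:)
qed

lemma Sel_meas': "Measurable.pred Om (\<lambda>\<omega>. k \<in> Sel (CT M K c) \<omega> n)"
  using Sel_meas unfolding Sel_CT .

lemma admissible_CT: "admissible M K \<mu> f g (CT M K c)"
proof -
  have "sel (CT M K c) \<xi> h \<subseteq> {..<M} \<and> card (sel (CT M K c) \<xi> h) = K \<and> dec (CT M K c) \<xi> h < M" for \<xi> h
    unfolding sel_CT dec_CT using csel_subset card_csel[OF _ K] leader_less[OF M, of f g h] by blast
  moreover have "(\<lambda>\<omega>. Sel (CT M K c) \<omega> n) \<in> measurable Om (count_space UNIV)" for n
    by (rule measurable_finite_subset[where M=M, OF _ Sel_meas'])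
       (unfold Sel_CT, rule csel_subset[OF ld_less])
  moreover have "(\<lambda>\<omega>. dec (CT M K c) (snd \<omega>) (hist (CT M K c) \<omega> n)) \<in> measurable Om (count_space UNIV)" for n
    using ld_meas[of n] unfolding dec_CT hist_CT[of _ _ c] ld_def[abs_def] .
  ultimately show ?thesis
    unfolding admissible_def sample_space_eq_Pr measurable_cong_sets[OF sets_Pr refl]
    by (intro conjI allI impI stopped_CT_meas) simp_all
qed

end

section \<open>The exponential supermartingale for a pair of cells\<close>

context two_densities
begin

lemma nn_integral_fresh_if:
  assumes h [measurable]: "h \<in> borel_measurable \<mu>" and F [measurable]: "F \<in> borel_measurable Om"
    and B [measurable]: "Measurable.pred Om B"
    and F_upd: "\<And>\<omega> y. F (upd \<omega> i y) = F \<omega>" and B_upd: "\<And>\<omega> y. B (upd \<omega> i y) = B \<omega>"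
  shows "(\<integral>\<^sup>+\<omega>. F \<omega> * (if B \<omega> then h (fst \<omega> i) else 1) \<partial>Pr G)
       = (\<integral>\<^sup>+\<omega>. F \<omega> * (if B \<omega> then (\<integral>\<^sup>+y. h y \<partial>law G i) else 1) \<partial>Pr G)"
proof -
  interpret L: prob_space "law G i" by (rule prob_law)
  have sp: "space (law G i) = space \<mu>" by (rule sets_eq_imp_space_eq) simp
  have "(\<integral>\<^sup>+\<omega>. F \<omega> * (if B \<omega> then h (fst \<omega> i) else 1) \<partial>Pr G)
      = (\<integral>\<^sup>+\<omega>. \<integral>\<^sup>+y. F (upd \<omega> i y) * (if B (upd \<omega> i y) then h (fst (upd \<omega> i y) i) else 1) \<partial>law G i \<partial>Pr G)"
    by (rule resample) simp_all
  also have "\<dots> = (\<integral>\<^sup>+\<omega>. F \<omega> * (if B \<omega> then (\<integral>\<^sup>+y. h y \<partial>law G i) else 1) \<partial>Pr G)"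
  proof (rule nn_integral_cong)
    fix \<omega>
    show "(\<integral>\<^sup>+y. F (upd \<omega> i y) * (if B (upd \<omega> i y) then h (fst (upd \<omega> i y) i) else 1) \<partial>law G i)
      = F \<omega> * (if B \<omega> then (\<integral>\<^sup>+y. h y \<partial>law G i) else 1)"
      using L.emeasure_space_1 by (cases "B \<omega>") (simp_all add: F_upd B_upd nn_integral_cmult)
  qed
  finally show ?thesis .
qed

end

text \<open>By symmetry \<open>k\<close> is drawn with probability \<open>r / card A\<close>, so the
  factor averages to at most \<open>1 - x * r / card A\<close>, which the exponential
  dominates.\<close>

lemma nn_integral_rand_subset:
  assumes A: "finite A" "k \<in> A" and r: "r \<le> card A" and x: "0 \<le> x" "x \<le> 1" and b: "b \<le> ennreal (1 - x)"
  shows "(\<integral>\<^sup>+\<xi>. (if k \<in> rand_subset \<xi> n A r then b else 1) \<partial>seed_space) \<le> ennreal (exp (- (real r / real (card A) * x)))"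
proof -
  interpret S: prob_space seed_space by (rule prob_space_seed_space)
  let ?E = "{\<xi>. k \<in> rand_subset \<xi> n A r}" and ?\<rho> = "real r / real (card A)"
  have "Measurable.pred seed_space (\<lambda>\<xi>. k \<in> rand_subset \<xi> n A r)"
    by (rule rand_subset_meas[OF A(1)]) (rule seed_component)
  then have E: "?E \<in> sets seed_space" by (simp add: pred_def)
  have I: "integrable seed_space (\<lambda>\<xi>. x * indicat_real ?E \<xi>)"
    using E by (intro integrable_mult_right integrable_real_indicator) (simp_all add: S.emeasure_eq_measure)
  have prob: "measure seed_space ?E = ?\<rho>" by (rule prob_rand_subset[OF A(1) r A(2)])
  have "(\<integral>\<^sup>+\<xi>. (if k \<in> rand_subset \<xi> n A r then b else 1) \<partial>seed_space)
      \<le> (\<integral>\<^sup>+\<xi>. ennreal (1 - x * indicat_real ?E \<xi>) \<partial>seed_space)"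
    using b by (intro nn_integral_mono) (auto simp: indicator_def)
  also have "\<dots> = ennreal (\<integral>\<xi>. 1 - x * indicat_real ?E \<xi> \<partial>seed_space)"
  proof (rule nn_integral_eq_integral)
    show "AE \<xi> in seed_space. 0 \<le> 1 - x * indicat_real ?E \<xi>" using x by (intro AE_I2) (auto simp: indicator_def)
  qed (use I in simp)
  also have "(\<integral>\<xi>. 1 - x * indicat_real ?E \<xi> \<partial>seed_space) = 1 - x * ?\<rho>"
    using I E S.prob_space by (simp add: prob)
  also have "1 - x * ?\<rho> \<le> exp (- (?\<rho> * x))"
    using exp_ge_add_one_self[of "- (?\<rho> * x)"] by (simp add: mult.commute)
  finally show ?thesis by (simp add: ennreal_leI)
qed

context chernoff_process
begin

definition N :: "nat \<Rightarrow> nat \<Rightarrow> 'a sample \<Rightarrow> real" where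
  "N q n \<omega> = (\<Sum>t<n. if ld t \<omega> = q then 1 else 0)"

text \<open>With \<open>q = m\<close> this process controls the growth of \<open>S\<^sub>m - S\<^sub>j\<close> while the true cell \<open>m\<close> leads; with
  \<open>q = j\<close> it controls the time for which the wrong cell \<open>j\<close> leads.\<close>

definition Z :: "real \<Rightarrow> real \<Rightarrow> nat \<Rightarrow> nat \<Rightarrow> nat \<Rightarrow> nat \<Rightarrow> 'a sample \<Rightarrow> real" where
  "Z s r q m j n \<omega> = exp (s * (S n j \<omega> - S n m \<omega>) + s * r * N q n \<omega>)"

lemma ld_pred [measurable]: "Measurable.pred Om (\<lambda>\<omega>. ld n \<omega> = q)"
  by measurable

lemma N_meas [measurable]: "N q n \<in> borel_measurable Om"
  unfolding N_def by measurable

lemma Z_meas [measurable]: "Z s r q m j n \<in> borel_measurable Om"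
  unfolding Z_def by measurable

lemma process_upd:
  assumes "t \<le> n"
  shows "S t k (upd \<omega> (n, i) y) = S t k \<omega>" "ld t (upd \<omega> (n, i) y) = ld t \<omega>"
  using hist_upd_future[of t "(n, i)" p \<omega> y] assms by (simp_all add: S_def ld_def)

lemma Sel_upd: "Sel p (upd \<omega> (n, i) y) n = Sel p \<omega> n"
  unfolding Sel_CT by (simp add: process_upd)

lemma Z_upd: "Z s r q m j n (upd \<omega> (n, i) y) = Z s r q m j n \<omega>"
proof -
  have "N q n (upd \<omega> (n, i) y) = N q n \<omega>"
    unfolding N_def by (intro sum.cong refl) (simp add: process_upd)
  then show ?thesis by (simp add: Z_def process_upd)
qed

lemma hist_seeds:
  assumes "t \<le> n"
  shows "hist p (x, mix {i. fst i \<noteq> n} \<xi> \<xi>') t = hist p (x, \<xi>) t"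
  using assms
proof (induction t)
  case (Suc t)
  then have h: "hist p (x, mix {i. fst i \<noteq> n} \<xi> \<xi>') t = hist p (x, \<xi>) t" by simp
  have "sel p (mix {i. fst i \<noteq> n} \<xi> \<xi>') (hist p (x, \<xi>) t) = sel p \<xi> (hist p (x, \<xi>) t)"
    unfolding sel_CT length_hist by (rule csel_row) (use Suc.prems in \<open>simp add: mix_def\<close>)
  then show ?case by (simp add: h)
qed simp

lemma process_seeds:
  assumes "t \<le> n"
  shows "S t k (x, mix {i. fst i \<noteq> n} \<xi> \<xi>') = S t k (x, \<xi>)"
    "ld t (x, mix {i. fst i \<noteq> n} \<xi> \<xi>') = ld t (x, \<xi>)"
  using hist_seeds[OF assms] by (simp_all add: S_def ld_def)

lemma Z_seeds: "Z s r q m j n (x, mix {i. fst i \<noteq> n} \<xi> \<xi>') = Z s r q m j n (x, \<xi>)"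
proof -
  have "N q n (x, mix {i. fst i \<noteq> n} \<xi> \<xi>') = N q n (x, \<xi>)"
    unfolding N_def by (intro sum.cong refl) (simp add: process_seeds)
  then show ?thesis by (simp add: Z_def process_seeds)
qed

context
  fixes s r :: real and q m j :: nat and a b :: ennreal and u :: "nat \<Rightarrow> nat \<Rightarrow> seeds \<Rightarrow> ennreal"
  assumes mj: "m < M" "j < M" "j \<noteq> m"
  defines "a \<equiv> \<integral>\<^sup>+y. ennreal (exp (- s * llr y)) \<partial>Dg" and "b \<equiv> \<integral>\<^sup>+y. ennreal (exp (s * llr y)) \<partial>Df"
    and "u \<equiv> \<lambda>l n \<xi>. (if m \<in> csel M K l \<xi> n then a else 1) * (if j \<in> csel M K l \<xi> n then b else 1)"
  assumes ab: "a \<le> 1" "b \<le> 1"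
    and q: "\<And>n. ennreal (exp (s * r)) * (\<integral>\<^sup>+\<xi>. u q n \<xi> \<partial>seed_space) \<le> 1"
begin

lemma u_meas [measurable]: "u l n \<in> borel_measurable seed_space"
proof -
  have [measurable]: "Measurable.pred seed_space (\<lambda>\<xi>. k \<in> csel M K l \<xi> n)" for k
    by (rule csel_meas) (rule seed_component)
  show ?thesis unfolding u_def by measurable
qed

lemma u_le: "(\<integral>\<^sup>+\<xi>. u l n \<xi> \<partial>seed_space) \<le> 1"
proof -
  interpret S: prob_space seed_space by (rule prob_space_seed_space)
  have "u l n \<xi> \<le> 1" for \<xi>
    unfolding u_def using ab mult_mono[of a 1 b 1] by auto
  then have "(\<integral>\<^sup>+\<xi>. u l n \<xi> \<partial>seed_space) \<le> (\<integral>\<^sup>+\<xi>. 1 \<partial>seed_space)" by (intro nn_integral_mono)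
  then show ?thesis using S.emeasure_space_1 by simp
qed

text \<open>Given the selection, the observations of cells \<open>m\<close> and \<open>j\<close> at
  time \<open>n\<close> are fresh and are averaged out one after the other; what remains random in
  this row are the seeds.\<close>

lemma Z_integrate_row:
  "(\<integral>\<^sup>+\<omega>. ennreal (Z s r q m j (Suc n) \<omega>) \<partial>H m)
   = (\<integral>\<^sup>+\<omega>. ennreal (Z s r q m j n \<omega>) * ennreal (exp (if ld n \<omega> = q then s * r else 0)) * u (ld n \<omega>) n (snd \<omega>) \<partial>H m)"
proof -
  let ?F = "\<lambda>\<omega>. ennreal (Z s r q m j n \<omega>) * ennreal (exp (if ld n \<omega> = q then s * r else 0))"
  let ?Wm = "\<lambda>\<omega>. if m \<in> Sel p \<omega> n then ennreal (exp (- s * llr (fst \<omega> (n, m)))) else 1"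
  let ?Wj = "\<lambda>\<omega>. if j \<in> Sel p \<omega> n then ennreal (exp (s * llr (fst \<omega> (n, j)))) else 1"
  have law: "law {i. snd i = m} (n, m) = Dg" "law {i. snd i = m} (n, j) = Df"
    using mj by (auto simp: law_def)
  have F_upd: "?F (upd \<omega> (n, k) y) = ?F \<omega>" for \<omega> k y
    by (simp add: Z_upd process_upd)
  have [measurable]: "?F \<in> borel_measurable Om" by measurable
  have split: "ennreal (Z s r q m j (Suc n) \<omega>) = ?F \<omega> * ?Wm \<omega> * ?Wj \<omega>" for \<omega>
  proof -
    have "Z s r q m j (Suc n) \<omega> = Z s r q m j n \<omega> * exp (if ld n \<omega> = q then s * r else 0)
      * exp (if m \<in> Sel p \<omega> n then - s * llr (fst \<omega> (n, m)) else 0)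
      * exp (if j \<in> Sel p \<omega> n then s * llr (fst \<omega> (n, j)) else 0)"
      unfolding Z_def N_def S_Suc exp_add[symmetric] by (simp add: algebra_simps)
    moreover have "?Wm \<omega> = ennreal (exp (if m \<in> Sel p \<omega> n then - s * llr (fst \<omega> (n, m)) else 0))"
      "?Wj \<omega> = ennreal (exp (if j \<in> Sel p \<omega> n then s * llr (fst \<omega> (n, j)) else 0))" by auto
    ultimately show ?thesis by (simp only: ennreal_mult' Z_def exp_ge_zero mult_nonneg_nonneg)
  qed
  have "(\<integral>\<^sup>+\<omega>. ennreal (Z s r q m j (Suc n) \<omega>) \<partial>H m) = (\<integral>\<^sup>+\<omega>. ?F \<omega> * ?Wm \<omega> * ?Wj \<omega> \<partial>H m)"
    by (simp only: split)
  also have "\<dots> = (\<integral>\<^sup>+\<omega>. ?F \<omega> * ?Wm \<omega> * (if j \<in> Sel p \<omega> n then b else 1) \<partial>H m)"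
    unfolding b_def law(2)[symmetric]
  proof (rule nn_integral_fresh_if)
    fix \<omega> y show "?F (upd \<omega> (n, j) y) * ?Wm (upd \<omega> (n, j) y) = ?F \<omega> * ?Wm \<omega>"
      unfolding F_upd Sel_upd using mj(3) by simp
  qed (simp_all only: Sel_upd, measurable)
  also have "\<dots> = (\<integral>\<^sup>+\<omega>. ?F \<omega> * (if j \<in> Sel p \<omega> n then b else 1) * ?Wm \<omega> \<partial>H m)"
    by (simp only: ac_simps)
  also have "\<dots> = (\<integral>\<^sup>+\<omega>. ?F \<omega> * (if j \<in> Sel p \<omega> n then b else 1) * (if m \<in> Sel p \<omega> n then a else 1) \<partial>H m)"
    unfolding a_def law(1)[symmetric]
  proof (rule nn_integral_fresh_if)
    fix \<omega> y
    show "?F (upd \<omega> (n, m) y) * (if j \<in> Sel p (upd \<omega> (n, m) y) n then b else 1) = ?F \<omega> * (if j \<in> Sel p \<omega> n then b else 1)"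
      unfolding F_upd Sel_upd ..
  qed (simp_all only: Sel_upd, measurable)
  also have "\<dots> = (\<integral>\<^sup>+\<omega>. ?F \<omega> * u (ld n \<omega>) n (snd \<omega>) \<partial>H m)"
    unfolding u_def Sel_CT by (simp only: ac_simps)
  finally show ?thesis .
qed

text \<open>\<open>u l n\<close> is the mean one-step factor while \<open>l\<close> leads, given the
  seeds. Only steps with leader \<open>q\<close> carry the compensator \<open>exp (s * r)\<close>,
  which the assumption on \<open>q\<close> covers; with any other leader the factor is at most 1
  because \<open>a\<close> and \<open>b\<close> are. Splitting by the finitely many leaders leaves
  factors in the seeds of row \<open>n\<close>, independent of the past.\<close>

lemma Z_supermartingale: "(\<integral>\<^sup>+\<omega>. ennreal (Z s r q m j n \<omega>) \<partial>H m) \<le> 1"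
proof (induction n)
  case 0
  then show ?case using emeasure_Pr_UNIV[of "{i. snd i = m}"] by (simp add: Z_def N_def)
next
  case (Suc n)
  let ?e = "\<lambda>l. ennreal (exp (if l = q then s * r else 0))"
  let ?G = "\<lambda>l \<omega>. ennreal (Z s r q m j n \<omega>) * (if ld n \<omega> = l then 1 else 0)"
  have [measurable]: "(\<lambda>\<omega>. u l n (snd \<omega>)) \<in> borel_measurable Om" for l
  proof -
    have "u l n \<in> borel_measurable (PiM UNIV (\<lambda>_. borel))"
      using u_meas[of l n] by (simp add: measurable_cong_sets[OF sets_seed refl])
    then show ?thesis unfolding Om_def by (rule measurable_compose[OF measurable_snd])
  qed
  have split: "X \<omega> * ?e (ld n \<omega>) * u (ld n \<omega>) n (snd \<omega>)
      = (\<Sum>l<M. ?e l * (X \<omega> * (if ld n \<omega> = l then 1 else 0) * u l n (snd \<omega>)))" for X :: "'a sample \<Rightarrow> ennreal" and \<omega>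
  proof -
    have "(\<Sum>l<M. ?e l * (X \<omega> * (if ld n \<omega> = l then 1 else 0) * u l n (snd \<omega>)))
      = (\<Sum>l<M. if ld n \<omega> = l then X \<omega> * ?e (ld n \<omega>) * u (ld n \<omega>) n (snd \<omega>) else 0)"
      by (intro sum.cong refl) (auto simp: ac_simps)
    then show ?thesis using ld_less[of n \<omega>] by simp
  qed
  have "(\<integral>\<^sup>+\<omega>. ennreal (Z s r q m j (Suc n) \<omega>) \<partial>H m) = (\<integral>\<^sup>+\<omega>. (\<Sum>l<M. ?e l * (?G l \<omega> * u l n (snd \<omega>))) \<partial>H m)"
    unfolding Z_integrate_row by (rule nn_integral_cong) (rule split)
  also have "\<dots> = (\<Sum>l<M. ?e l * (\<integral>\<^sup>+\<omega>. ?G l \<omega> * u l n (snd \<omega>) \<partial>H m))"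
    by (simp add: nn_integral_sum nn_integral_cmult)
  also have "\<dots> = (\<Sum>l<M. ?e l * ((\<integral>\<^sup>+\<omega>. ?G l \<omega> \<partial>H m) * (\<integral>\<^sup>+\<xi>. u l n \<xi> \<partial>seed_space)))"
  proof -
    have "(\<integral>\<^sup>+\<omega>. ?G l \<omega> * u l n (snd \<omega>) \<partial>H m) = (\<integral>\<^sup>+\<omega>. ?G l \<omega> \<partial>H m) * (\<integral>\<^sup>+\<xi>. u l n \<xi> \<partial>seed_space)" for l
    proof (rule seed_indep[where J="{i. fst i \<noteq> n}"])
      fix x and \<xi> \<xi>' :: seeds
      show "?G l (x, mix {i. fst i \<noteq> n} \<xi> \<xi>') = ?G l (x, \<xi>)"
        by (simp only: Z_seeds process_seeds order_refl)
      show "u l n (mix {i. fst i \<noteq> n} \<xi> \<xi>') = u l n \<xi>'"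
        unfolding u_def using csel_row[of "mix {i. fst i \<noteq> n} \<xi> \<xi>'" n \<xi>' M K l] by (simp add: mix_def)
    qed measurable
    then show ?thesis by (simp only:)
  qed
  also have "\<dots> = (\<Sum>l<M. (\<integral>\<^sup>+\<omega>. ?G l \<omega> \<partial>H m) * (?e l * (\<integral>\<^sup>+\<xi>. u l n \<xi> \<partial>seed_space)))"
    by (simp only: ac_simps)
  also have "\<dots> \<le> (\<Sum>l<M. (\<integral>\<^sup>+\<omega>. ?G l \<omega> \<partial>H m) * 1)"
  proof (intro sum_mono mult_left_mono)
    fix l show "?e l * (\<integral>\<^sup>+\<xi>. u l n \<xi> \<partial>seed_space) \<le> 1"
      using q[of n] u_le[of l n] by (cases "l = q") auto
  qed simp
  also have "\<dots> = (\<integral>\<^sup>+\<omega>. (\<Sum>l<M. ?G l \<omega>) \<partial>H m)" by (simp add: nn_integral_sum)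
  also have "\<dots> = (\<integral>\<^sup>+\<omega>. ennreal (Z s r q m j n \<omega>) \<partial>H m)"
  proof (rule nn_integral_cong)
    fix \<omega> show "(\<Sum>l<M. ?G l \<omega>) = ennreal (Z s r q m j n \<omega>)"
      unfolding sum_distrib_left[symmetric] using ld_less[of n \<omega>] by simp
  qed
  also have "\<dots> \<le> 1" by (rule Suc.IH)
  finally show ?case .
qed

end

end

section \<open>Expected stopping time of the Chernoff test\<close>

lemma summable_linear_geometric:
  fixes x :: real
  assumes "0 \<le> x" "x < 1"
  shows "summable (\<lambda>n. real n * x ^ n)"
proof (rule summable_comparison_test)
  show "summable (\<lambda>n. of_nat (Suc n) * x ^ n)"
    using geometric_deriv_sums[of x] assms by (auto simp: sums_iff)
  show "\<exists>N. \<forall>n\<ge>N. norm (real n * x ^ n) \<le> of_nat (Suc n) * x ^ n"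
    using assms by (intro exI[of _ 0]) (auto simp: mult_right_mono)
qed

context chernoff_process
begin

text \<open>The three cases are the three selection rules: all cells, the leader with a random
  subset, a random subset without the leader. The roles are left open: \<open>l\<close> is the true
  cell while it leads, or the wrong cell while that one leads, with the two factors exchanged
  accordingly.\<close>

lemma csel_integral:
  assumes l: "l < M" and k: "k < M" "k \<noteq> l"
    and x: "0 \<le> x" "x \<le> 1" and y: "0 \<le> y" "y \<le> 1"
    and a: "a \<le> ennreal (1 - x)" and b: "b \<le> ennreal (1 - y)"
    and w: "K = M \<Longrightarrow> w \<le> x + y"
      "K \<noteq> M \<Longrightarrow> KL \<mu> f g / (real M - 1) \<le> KL \<mu> g f \<Longrightarrow> w \<le> x + (real K - 1) / (real M - 1) * y"
      "K \<noteq> M \<Longrightarrow> \<not> KL \<mu> f g / (real M - 1) \<le> KL \<mu> g f \<Longrightarrow> w \<le> real K / (real M - 1) * y"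
  shows "ennreal (exp w) * (\<integral>\<^sup>+\<xi>. (if l \<in> csel M K l \<xi> n then a else 1) * (if k \<in> csel M K l \<xi> n then b else 1) \<partial>seed_space) \<le> 1"
proof -
  interpret S: prob_space seed_space by (rule prob_space_seed_space)
  let ?A = "{..<M} - {l}"
  let ?I = "\<integral>\<^sup>+\<xi>. (if l \<in> csel M K l \<xi> n then a else 1) * (if k \<in> csel M K l \<xi> n then b else 1) \<partial>seed_space"
  have card: "card ?A = M - 1" using l by simp
  have rM: "real (M - 1) = real M - 1" using M by simp
  have a': "a \<le> ennreal (exp (- x))"
    using a by (rule order_trans) (use exp_ge_add_one_self[of "- x"] in \<open>simp add: ennreal_leI\<close>)
  have b': "b \<le> ennreal (exp (- y))"
    using b by (rule order_trans) (use exp_ge_add_one_self[of "- y"] in \<open>simp add: ennreal_leI\<close>)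
  have l_notin: "l \<notin> rand_subset \<xi> n ?A r" for \<xi> r using rand_subset_subset[of \<xi> n ?A r] by blast
  have "?I \<le> ennreal (exp (- w))"
  proof (cases "K = M")
    case True
    then have "?I = a * b" using l k S.emeasure_space_1 by (simp add: csel_def)
    also have "\<dots> \<le> ennreal (exp (- x)) * ennreal (exp (- y))" using a' b' by (intro mult_mono) auto
    also have "\<dots> = ennreal (exp (- x + - y))" by (simp only: ennreal_mult'[symmetric] exp_ge_zero exp_add)
    also have "\<dots> \<le> ennreal (exp (- w))" using w(1)[OF True] by (intro ennreal_leI) simp
    finally show ?thesis .
  next
    case False
    show ?thesis
    proof (cases "KL \<mu> f g / (real M - 1) \<le> KL \<mu> g f")
      case True
      have "?I = (\<integral>\<^sup>+\<xi>. a * (if k \<in> rand_subset \<xi> n ?A (K - 1) then b else 1) \<partial>seed_space)"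
        using False True k by (intro nn_integral_cong) (simp add: csel_def)
      also have "\<dots> = a * (\<integral>\<^sup>+\<xi>. (if k \<in> rand_subset \<xi> n ?A (K - 1) then b else 1) \<partial>seed_space)"
      proof (rule nn_integral_cmult)
        have [measurable]: "Measurable.pred seed_space (\<lambda>\<xi>. k \<in> rand_subset \<xi> n ?A (K - 1))"
          by (rule rand_subset_meas[OF _ seed_component]) simp
        show "(\<lambda>\<xi>. if k \<in> rand_subset \<xi> n ?A (K - 1) then b else 1) \<in> borel_measurable seed_space" by measurable
      qed
      also have "\<dots> \<le> ennreal (exp (- x)) * ennreal (exp (- (real (K - 1) / real (card ?A) * y)))"
        by (intro mult_mono a' nn_integral_rand_subset y b) (use k K card in auto)
      also have "\<dots> = ennreal (exp (- x + - (real (K - 1) / real (card ?A) * y)))"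
        by (simp only: ennreal_mult'[symmetric] exp_ge_zero exp_add)
      also have "\<dots> \<le> ennreal (exp (- w))"
        using w(2)[OF False True] K(1) unfolding card rM by (intro ennreal_leI) (simp add: of_nat_diff)
      finally show ?thesis .
    next
      case B: False
      have "?I = (\<integral>\<^sup>+\<xi>. (if k \<in> rand_subset \<xi> n ?A K then b else 1) \<partial>seed_space)"
        using False B l_notin by (intro nn_integral_cong) (simp add: csel_def)
      also have "\<dots> \<le> ennreal (exp (- (real K / real (card ?A) * y)))"
        by (intro nn_integral_rand_subset y b) (use k K card False in auto)
      also have "\<dots> \<le> ennreal (exp (- w))"
        using w(3)[OF False B] unfolding card rM by (intro ennreal_leI) simp
      finally show ?thesis .
    qed
  qed
  then have "ennreal (exp w) * ?I \<le> ennreal (exp w) * ennreal (exp (- w))" by (intro mult_left_mono) auto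
  also have "\<dots> = 1" by (simp only: ennreal_mult'[symmetric] exp_ge_zero exp_add[symmetric]) simp
  finally show ?thesis .
qed

abbreviation "I \<equiv> Istar M K (KL \<mu> g f) (KL \<mu> f g)"

lemma I_pos: "0 < I"
  by (rule Istar_pos[OF K M])

text \<open>Each divergence loses \<open>\<eta>\<close> when the exponential moment is replaced by
  its linear bound, and enters the rate with weight at most 1, whence \<open>I - 2 * \<eta>\<close>.
  While a wrong cell leads, some positive rate \<open>r\<close> is enough.\<close>

lemma exponents:
  assumes e: "0 < \<eta>" "\<eta> < KL \<mu> g f" "\<eta> < KL \<mu> f g"
  obtains s r where "0 < s" "0 < r"
    "\<And>m j n. m < M \<Longrightarrow> j < M \<Longrightarrow> j \<noteq> m \<Longrightarrow> (\<integral>\<^sup>+\<omega>. ennreal (Z s (I - 2 * \<eta>) m m j n \<omega>) \<partial>H m) \<le> 1"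
    "\<And>m j n. m < M \<Longrightarrow> j < M \<Longrightarrow> j \<noteq> m \<Longrightarrow> (\<integral>\<^sup>+\<omega>. ennreal (Z s r j m j n \<omega>) \<partial>H m) \<le> 1"
proof -
  define D1 where "D1 = KL \<mu> g f - \<eta>"
  define D2 where "D2 = KL \<mu> f g - \<eta>"
  have D: "0 < D1" "0 < D2" using e by (simp_all add: D1_def D2_def)
  have M1: "1 \<le> real M - 1" using M by simp
  obtain s where s: "0 < s" "s * (D1 + D2) \<le> 1"
    and ag: "(\<integral>\<^sup>+y. ennreal (exp (- s * llr y)) \<partial>Dg) \<le> ennreal (1 - s * D1)"
    and bf: "(\<integral>\<^sup>+y. ennreal (exp (s * llr y)) \<partial>Df) \<le> ennreal (1 - s * D2)"
    using exp_moments[OF e(1), of "D1 + D2"] unfolding D1_def D2_def by blast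
  have "0 < s * D1" "0 < s * D2" using s D by simp_all
  then have x: "0 \<le> s * D1" "s * D1 \<le> 1" "0 \<le> s * D2" "s * D2 \<le> 1"
    using s(2) by (simp_all add: distrib_left)
  have ab1: "(\<integral>\<^sup>+y. ennreal (exp (- s * llr y)) \<partial>Dg) \<le> 1" "(\<integral>\<^sup>+y. ennreal (exp (s * llr y)) \<partial>Df) \<le> 1"
    using order_trans[OF ag ennreal_leI[of "1 - s * D1" 1]] order_trans[OF bf ennreal_leI[of "1 - s * D2" 1]] x
    by (simp_all add: ennreal_1)
  \<comment> \<open>A wrong leader is itself observed and falls at rate \<open>D2\<close>, or, where
    the rule leaves the leader out, the true cell is observed with probability
    \<open>K / (M - 1)\<close> and rises at a mean rate of at least
    \<open>D1 / (M - 1)\<close>.\<close>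
  define r where "r = min D2 (min D1 (D1 / (real M - 1)))"
  have r: "0 < r" "r \<le> D2" "r \<le> D1" "r \<le> D1 / (real M - 1)" using D M1 by (simp_all add: r_def)
  have K1: "1 \<le> real K" using K(1) by simp
  show ?thesis
  proof (rule that[OF s(1) r(1)])
    fix m j n assume mj: "m < M" "j < M" "j \<noteq> m"
    show "(\<integral>\<^sup>+\<omega>. ennreal (Z s (I - 2 * \<eta>) m m j n \<omega>) \<partial>H m) \<le> 1"
    proof (rule Z_supermartingale[OF mj ab1], rule csel_integral[OF mj(1,2,3) x(1,2,3,4) ag bf])
      assume "K = M"
      then have "s * (I - 2 * \<eta>) = s * (D1 + D2)" by (simp add: Istar_def D1_def D2_def)
      then show "s * (I - 2 * \<eta>) \<le> s * D1 + s * D2" by (simp add: distrib_left)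
    next
      assume KM: "K \<noteq> M" and A: "KL \<mu> f g / (real M - 1) \<le> KL \<mu> g f"
      let ?\<rho> = "(real K - 1) / (real M - 1)"
      have \<rho>: "0 \<le> ?\<rho>" "?\<rho> \<le> 1" using K1 K(2) M1 by simp_all
      \<comment> \<open>The two terms of the maximum compare as
        \<open>KL \<mu> f g / (real M - 1)\<close> and \<open>KL \<mu> g f\<close> do, so the
        switching condition of the test selects the larger one.\<close>
      have "real K * KL \<mu> f g / (real M - 1) = KL \<mu> f g / (real M - 1) + ?\<rho> * KL \<mu> f g"
        by (simp add: diff_divide_distrib left_diff_distrib)
      then have "I = KL \<mu> g f + ?\<rho> * KL \<mu> f g" using KM A by (simp add: Istar_def)
      moreover have "?\<rho> * \<eta> \<le> \<eta>" using mult_right_mono[OF \<rho>(2), of \<eta>] e(1) by (simp only: mult_1_left)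
      ultimately have "I - 2 * \<eta> \<le> D1 + ?\<rho> * D2" by (simp add: D1_def D2_def right_diff_distrib)
      then have "s * (I - 2 * \<eta>) \<le> s * (D1 + ?\<rho> * D2)" using s(1) by (intro mult_left_mono) auto
      also have "\<dots> = s * D1 + ?\<rho> * (s * D2)" by (simp add: distrib_left)
      finally show "s * (I - 2 * \<eta>) \<le> s * D1 + ?\<rho> * (s * D2)" .
    next
      assume KM: "K \<noteq> M" and A: "\<not> KL \<mu> f g / (real M - 1) \<le> KL \<mu> g f"
      let ?\<rho> = "real K / (real M - 1)"
      have "K \<le> M - 1" using K KM by simp
      then have "real K \<le> real M - 1" using M by linarith
      then have \<rho>: "0 \<le> ?\<rho>" "?\<rho> \<le> 1" using K1 M1 by simp_all
      have "real K * KL \<mu> f g / (real M - 1) = KL \<mu> f g / (real M - 1) + (real K - 1) / (real M - 1) * KL \<mu> f g"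
        by (simp add: diff_divide_distrib left_diff_distrib)
      then have "I = ?\<rho> * KL \<mu> f g" using KM A by (simp add: Istar_def)
      moreover have "?\<rho> * \<eta> \<le> \<eta>" using mult_right_mono[OF \<rho>(2), of \<eta>] e(1) by (simp only: mult_1_left)
      ultimately have "I - 2 * \<eta> \<le> ?\<rho> * D2" using e(1) by (simp add: D2_def right_diff_distrib)
      then have "s * (I - 2 * \<eta>) \<le> s * (?\<rho> * D2)" using s(1) by (intro mult_left_mono) auto
      then show "s * (I - 2 * \<eta>) \<le> ?\<rho> * (s * D2)" by (simp only: mult.left_commute)
    qed
    show "(\<integral>\<^sup>+\<omega>. ennreal (Z s r j m j n \<omega>) \<partial>H m) \<le> 1"
    proof (rule Z_supermartingale[OF mj ab1], subst mult.commute[of "if m \<in> _ then _ else _"],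
        rule csel_integral[OF mj(2,1) mj(3)[symmetric] x(3,4,1,2) bf ag])
      have sr: "s * r \<le> s * D2" using r s(1) by simp
      show "s * r \<le> s * D2 + s * D1" using sr x(1) by linarith
      have "0 \<le> (real K - 1) / (real M - 1) * (s * D1)" using K1 M1 x(1) by simp
      then show "s * r \<le> s * D2 + (real K - 1) / (real M - 1) * (s * D1)" using sr by linarith
      have "r \<le> 1 * (D1 / (real M - 1))" using r by simp
      also have "\<dots> \<le> real K * (D1 / (real M - 1))" using K1 D M1 by (intro mult_right_mono) auto
      finally have "s * r \<le> s * (real K * (D1 / (real M - 1)))" using s(1) by (intro mult_left_mono) auto
      then show "s * r \<le> real K / (real M - 1) * (s * D1)" by (simp add: ac_simps)
    qed
  qed
qed

section \<open>Tail bounds for the time until the true cell is far ahead\<close>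

lemma prob_Z_bound:
  assumes E: "(\<integral>\<^sup>+\<omega>. ennreal (Z s r q m j n \<omega>) \<partial>H m) \<le> 1"
    and B: "B \<in> sets Om" "\<And>\<omega>. \<omega> \<in> B \<Longrightarrow> v \<le> s * (S n j \<omega> - S n m \<omega>) + s * r * N q n \<omega>"
  shows "measure (H m) B \<le> exp (- v)"
proof -
  interpret P: prob_space "H m" by (rule prob_Pr)
  have "ennreal (exp v) * emeasure (H m) B = (\<integral>\<^sup>+\<omega>. ennreal (exp v) * indicator B \<omega> \<partial>H m)"
    using B(1) by (subst nn_integral_cmult_indicator) auto
  also have "\<dots> \<le> (\<integral>\<^sup>+\<omega>. ennreal (Z s r q m j n \<omega>) \<partial>H m)"
    using B(2) by (intro nn_integral_mono) (auto simp: indicator_def Z_def intro!: ennreal_leI)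
  also note E
  finally have "ennreal (exp v * measure (H m) B) \<le> ennreal 1"
    by (simp add: P.emeasure_eq_measure ennreal_mult')
  then have "exp v * measure (H m) B \<le> 1" by (simp only: ennreal_le_iff zero_le_one)
  then show ?thesis by (simp add: exp_minus field_simps)
qed

lemma N_sum: "(\<Sum>l<M. N l n \<omega>) = real n"
proof -
  have "(\<Sum>l<M. N l n \<omega>) = (\<Sum>t<n. \<Sum>l<M. if ld t \<omega> = l then 1 else 0)"
    unfolding N_def by (rule sum.swap)
  then show ?thesis using ld_less by simp
qed

text \<open>At the last visit \<open>t\<close> the cell is actually leading, so its sum there is at
  least that of the true cell, and the count is smaller only by the visit at \<open>t\<close>
  itself.\<close>

lemma N_last_visit:
  assumes "0 < N l n \<omega>"
  shows "\<exists>t<n. ld t \<omega> = l \<and> N l t \<omega> = N l n \<omega> - 1"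
  using assms
proof (induction n)
  case 0 then show ?case by (simp add: N_def)
next
  case (Suc n)
  show ?case
  proof (cases "ld n \<omega> = l")
    case True
    then show ?thesis by (intro exI[of _ n]) (simp add: N_def)
  next
    case False
    then have "N l (Suc n) \<omega> = N l n \<omega>" by (simp add: N_def)
    with Suc obtain t where "t < n" "ld t \<omega> = l" "N l t \<omega> = N l (Suc n) \<omega> - 1" by auto
    then show ?thesis by (intro exI[of _ t]) simp
  qed
qed

text \<open>Free of \<open>c\<close>: it contains the event that the test is still running after
  \<open>n\<close> steps, for every \<open>c\<close> in \<open>(0, 1)\<close> with
  \<open>- ln c \<le> v\<close>. This makes the bound on the stopping time uniform in the
  cost.\<close>

definition late :: "real \<Rightarrow> nat \<Rightarrow> nat \<Rightarrow> 'a sample set" where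
  "late v m n = (\<Union>j\<in>{..<M} - {m}. {\<omega>\<in>space Om. S n m \<omega> - S n j \<omega> < v})"

lemma late_sets [measurable]: "late v m n \<in> sets Om"
  unfolding late_def by (intro sets.finite_UN) auto

text \<open>Either the true cell led for almost all of the time and its margin still lags behind, or
  some wrong cell led for more than \<open>\<kappa> * n / M\<close> steps. The first is
  exponentially unlikely; in the second the last visit of that cell is at an unknown time
  \<open>t < n\<close>, which costs a factor \<open>n\<close> and keeps summability.\<close>

lemma late_summable:
  assumes d: "0 < \<delta>" "\<delta> \<le> I" and m: "m < M"
  shows "summable (\<lambda>n. measure (H m) (late (real n * (I - \<delta>)) m n))"
proof -
  interpret P: prob_space "H m" by (rule prob_Pr)
  \<comment> \<open>The budget is \<open>\<delta>\<close>: the slack \<open>2 * \<eta>\<close> takes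
    at most a quarter, and steps with a wrong leader at most another through
    \<open>\<kappa> * I = \<delta> / 4\<close>; the remaining half is the exponential rate in
    \<open>E1\<close>. The second minimum keeps \<open>\<eta>\<close> below both
    divergences.\<close>
  define \<eta> where "\<eta> = min (\<delta> / 8) (min (KL \<mu> g f) (KL \<mu> f g) / 2)"
  have e: "0 < \<eta>" "\<eta> < KL \<mu> g f" "\<eta> < KL \<mu> f g" and e8: "\<eta> \<le> \<delta> / 8"
    using d Dgf_pos Dfg_pos by (auto simp: \<eta>_def min_def)
  obtain s r where s: "0 < s" and r: "0 < r"
    and Z1: "\<And>m j n. m < M \<Longrightarrow> j < M \<Longrightarrow> j \<noteq> m \<Longrightarrow> (\<integral>\<^sup>+\<omega>. ennreal (Z s (I - 2 * \<eta>) m m j n \<omega>) \<partial>H m) \<le> 1"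
    and Z2: "\<And>m j n. m < M \<Longrightarrow> j < M \<Longrightarrow> j \<noteq> m \<Longrightarrow> (\<integral>\<^sup>+\<omega>. ennreal (Z s r j m j n \<omega>) \<partial>H m) \<le> 1"
    using exponents[OF e] by blast
  define \<kappa> where "\<kappa> = \<delta> / (4 * I)"
  have k: "0 < \<kappa>" using d I_pos by (simp add: \<kappa>_def)
  have kI: "\<kappa> * I = \<delta> / 4" using I_pos by (simp add: \<kappa>_def)
  have R0: "0 \<le> I - 2 * \<eta>" using e8 d by simp
  let ?J = "{..<M} - {m}"
  define E1 where "E1 n j = {\<omega>\<in>space Om. S n m \<omega> - S n j \<omega> < real n * (I - \<delta>) \<and> (1 - \<kappa>) * real n \<le> N m n \<omega>}" for n j
  \<comment> \<open>The \<open>- 1\<close> is the visit at time \<open>t\<close> itself, which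
    \<open>N l t\<close> does not count.\<close>
  define E2 where "E2 n l t = {\<omega>\<in>space Om. ld t \<omega> = l \<and> \<kappa> * real n / real M - 1 \<le> N l t \<omega>}" for n l t
  have sets: "E1 n j \<in> sets Om" "E2 n l t \<in> sets Om" for n j l t unfolding E1_def E2_def by measurable
  have p1: "measure (H m) (E1 n j) \<le> exp (- (s * \<delta> / 2)) ^ n" if j: "j \<in> ?J" for n j
  proof -
    have "measure (H m) (E1 n j) \<le> exp (- (real n * (s * \<delta> / 2)))"
    proof (rule prob_Z_bound[OF Z1[of m j n]])
      fix \<omega> assume "\<omega> \<in> E1 n j"
      then have a: "S n m \<omega> - S n j \<omega> \<le> real n * (I - \<delta>)" and b: "(1 - \<kappa>) * real n \<le> N m n \<omega>"
        by (auto simp: E1_def)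
      have "(I - 2 * \<eta>) * ((1 - \<kappa>) * real n) \<le> (I - 2 * \<eta>) * N m n \<omega>" using b R0 by (rule mult_left_mono)
      moreover have "real n * (\<delta> / 2) \<le> (I - 2 * \<eta>) * ((1 - \<kappa>) * real n) - real n * (I - \<delta>)"
      proof -
        have "\<kappa> * (I - 2 * \<eta>) \<le> \<kappa> * I" using k e by (intro mult_left_mono) auto
        then have "\<delta> / 2 \<le> (I - 2 * \<eta>) * (1 - \<kappa>) - (I - \<delta>)" using kI e8 by (simp add: algebra_simps)
        from mult_left_mono[OF this, of "real n"] show ?thesis by (simp add: algebra_simps)
      qed
      ultimately have "real n * (\<delta> / 2) \<le> (S n j \<omega> - S n m \<omega>) + (I - 2 * \<eta>) * N m n \<omega>" using a by linarith
      then have "s * (real n * (\<delta> / 2)) \<le> s * ((S n j \<omega> - S n m \<omega>) + (I - 2 * \<eta>) * N m n \<omega>)"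
        using s by (intro mult_left_mono) auto
      then show "real n * (s * \<delta> / 2) \<le> s * (S n j \<omega> - S n m \<omega>) + s * (I - 2 * \<eta>) * N m n \<omega>"
        by (simp add: algebra_simps)
    qed (use m j sets in auto)
    also have "\<dots> = exp (- (s * \<delta> / 2)) ^ n" by (simp add: exp_of_nat_mult[symmetric])
    finally show ?thesis .
  qed
  have p2: "measure (H m) (E2 n l t) \<le> exp (s * r) * exp (- (s * r * \<kappa> / real M)) ^ n" if l: "l \<in> ?J" for n l t
  proof -
    have "measure (H m) (E2 n l t) \<le> exp (- (s * r * (\<kappa> * real n / real M - 1)))"
    proof (rule prob_Z_bound[OF Z2[of m l t]])
      fix \<omega> assume "\<omega> \<in> E2 n l t"
      then have "ld t \<omega> = l" and b: "\<kappa> * real n / real M - 1 \<le> N l t \<omega>" by (auto simp: E2_def)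
      \<comment> \<open>A leader is not behind the true cell, so the part of the exponent with the
        sums is nonnegative and the count alone makes it large.\<close>
      then have "0 \<le> S t l \<omega> - S t m \<omega>" using ld_max[OF m, of t \<omega>] by simp
      then have "0 \<le> s * (S t l \<omega> - S t m \<omega>)" using s by simp
      moreover have "s * r * (\<kappa> * real n / real M - 1) \<le> s * r * N l t \<omega>" using b s r by (intro mult_left_mono) auto
      ultimately show "s * r * (\<kappa> * real n / real M - 1) \<le> s * (S t l \<omega> - S t m \<omega>) + s * r * N l t \<omega>" by linarith
    qed (use m l sets in auto)
    also have "- (s * r * (\<kappa> * real n / real M - 1)) = s * r + real n * (- (s * r * \<kappa> / real M))" by (simp add: algebra_simps)
    finally show ?thesis by (simp only: exp_add exp_of_nat_mult)
  qed
  have sub: "late (real n * (I - \<delta>)) m n \<subseteq> (\<Union>j\<in>?J. E1 n j) \<union> (\<Union>l\<in>?J. \<Union>t\<in>{..<n}. E2 n l t)" for n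
  proof
    fix \<omega> assume "\<omega> \<in> late (real n * (I - \<delta>)) m n"
    then obtain j where j: "j \<in> ?J" "\<omega> \<in> space Om" "S n m \<omega> - S n j \<omega> < real n * (I - \<delta>)"
      by (auto simp: late_def)
    show "\<omega> \<in> (\<Union>j\<in>?J. E1 n j) \<union> (\<Union>l\<in>?J. \<Union>t\<in>{..<n}. E2 n l t)"
    proof (cases "(1 - \<kappa>) * real n \<le> N m n \<omega>")
      case True
      then have "\<omega> \<in> E1 n j" using j by (simp add: E1_def)
      then show ?thesis using j(1) by blast
    next
      case False
      have "(\<Sum>l<M. N l n \<omega>) = N m n \<omega> + (\<Sum>l\<in>?J. N l n \<omega>)"
        using m by (intro sum.remove) auto
      then have big: "\<kappa> * real n < (\<Sum>l\<in>?J. N l n \<omega>)" using False N_sum[of n \<omega>] by (simp add: algebra_simps)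
      have "\<exists>l\<in>?J. \<kappa> * real n / real M < N l n \<omega>"
      proof (rule ccontr)
        assume "\<not> ?thesis"
        then have "(\<Sum>l\<in>?J. N l n \<omega>) \<le> (\<Sum>l\<in>?J. \<kappa> * real n / real M)" by (intro sum_mono) (auto simp: not_less)
        also have "\<dots> \<le> real M * (\<kappa> * real n / real M)"
          using k m by (simp only: sum_constant) (intro mult_right_mono, auto)
        also have "\<dots> = \<kappa> * real n" using M by simp
        finally show False using big by simp
      qed
      then obtain l where l: "l \<in> ?J" "\<kappa> * real n / real M < N l n \<omega>" by blast
      moreover have "0 \<le> \<kappa> * real n / real M" using k by simp
      ultimately have "0 < N l n \<omega>" by linarith
      then obtain t where t: "t < n" "ld t \<omega> = l" "N l t \<omega> = N l n \<omega> - 1" using N_last_visit by blast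
      then have "\<omega> \<in> E2 n l t" using l j(2) by (simp add: E2_def)
      then show ?thesis using l t by blast
    qed
  qed
  let ?x = "exp (- (s * \<delta> / 2))" and ?y = "exp (- (s * r * \<kappa> / real M))"
  have bound: "measure (H m) (late (real n * (I - \<delta>)) m n) \<le> real (card ?J) * ?x ^ n + real (card ?J) * exp (s * r) * (real n * ?y ^ n)" for n
  proof -
    have U1: "(\<Union>j\<in>?J. E1 n j) \<in> sets (H m)" and U2: "(\<Union>t\<in>{..<n}. E2 n l t) \<in> sets (H m)"
      and U3: "(\<Union>l\<in>?J. \<Union>t\<in>{..<n}. E2 n l t) \<in> sets (H m)" for l
      using sets by (auto intro!: sets.finite_UN)
    have "measure (H m) (late (real n * (I - \<delta>)) m n) \<le> measure (H m) ((\<Union>j\<in>?J. E1 n j) \<union> (\<Union>l\<in>?J. \<Union>t\<in>{..<n}. E2 n l t))"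
      using sub U1 U3 by (intro P.finite_measure_mono) auto
    also have "\<dots> \<le> measure (H m) (\<Union>j\<in>?J. E1 n j) + measure (H m) (\<Union>l\<in>?J. \<Union>t\<in>{..<n}. E2 n l t)"
      using U1 U3 by (rule measure_Un_le)
    also have "\<dots> \<le> (\<Sum>j\<in>?J. measure (H m) (E1 n j)) + (\<Sum>l\<in>?J. measure (H m) (\<Union>t\<in>{..<n}. E2 n l t))"
      using sets U2 by (intro add_mono measure_UNION_le) auto
    also have "\<dots> \<le> (\<Sum>j\<in>?J. ?x ^ n) + (\<Sum>l\<in>?J. \<Sum>t<n. exp (s * r) * ?y ^ n)"
    proof (intro add_mono sum_mono)
      fix l assume l: "l \<in> ?J"
      have "measure (H m) (\<Union>t\<in>{..<n}. E2 n l t) \<le> (\<Sum>t<n. measure (H m) (E2 n l t))"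
        using sets by (intro measure_UNION_le) auto
      also have "\<dots> \<le> (\<Sum>t<n. exp (s * r) * ?y ^ n)" by (intro sum_mono p2 l)
      finally show "measure (H m) (\<Union>t\<in>{..<n}. E2 n l t) \<le> (\<Sum>t<n. exp (s * r) * ?y ^ n)" .
    qed (rule p1)
    also have "\<dots> = real (card ?J) * ?x ^ n + real (card ?J) * exp (s * r) * (real n * ?y ^ n)"
      by (simp only: sum_constant card_lessThan ac_simps)
    finally show ?thesis .
  qed
  show ?thesis
  proof (rule summable_comparison_test)
    have "0 < s * r * \<kappa> / real M" "0 < s * \<delta> / 2" using s r k M d by simp_all
    then have "?x < 1" "?y < 1" by (simp_all only: exp_less_one_iff neg_less_0_iff_less)
    then show "summable (\<lambda>n. real (card ?J) * ?x ^ n + real (card ?J) * exp (s * r) * (real n * ?y ^ n))"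
      by (intro summable_add summable_mult summable_geometric summable_linear_geometric) simp_all
    show "\<exists>N. \<forall>n\<ge>N. norm (measure (H m) (late (real n * (I - \<delta>)) m n))
      \<le> real (card ?J) * ?x ^ n + real (card ?J) * exp (s * r) * (real n * ?y ^ n)"
      using bound by (intro exI[of _ 0]) (unfold real_norm_def abs_of_nonneg[OF measure_nonneg], blast)
  qed
qed

text \<open>A positive margin over all others forces the true cell to be the leader whatever the tie
  rule, and a margin of \<open>- ln c\<close> stops the test.\<close>

lemma live_late:
  assumes c: "0 < c" "c < 1" and v: "- ln c \<le> v" and m: "m < M" and live: "live (CT M K c) \<omega> (Suc n)"
    and \<omega>: "\<omega> \<in> space Om"
  shows "\<omega> \<in> late v m n"
proof (rule ccontr)
  assume "\<omega> \<notin> late v m n"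
  then have ge: "v \<le> S n m \<omega> - S n j \<omega>" if "j < M" "j \<noteq> m" for j
    using that \<omega> by (auto simp: late_def not_less)
  have "0 < v" using v ln_less_zero[OF c] by linarith
  have "ld n \<omega> = m"
  proof (rule ccontr)
    assume "ld n \<omega> \<noteq> m"
    then show False using ge[of "ld n \<omega>"] ld_less[of n \<omega>] ld_max[OF m, of n \<omega>] \<open>0 < v\<close> by simp
  qed
  then have "stopped (CT M K c) \<omega> n" unfolding stopped_iff using ge v by force
  then show False using live by (simp add: live_Suc)
qed

text \<open>From \<open>n \<ge> - ln c / (I - \<delta>)\<close> on, the threshold lies below
  \<open>n * (I - \<delta>)\<close>, so the tail probabilities are dominated by one summable series
  that does not involve \<open>c\<close>. The earlier terms are at most 1 each, and rounding up
  their number adds another 1.\<close>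

lemma expected_stop_time_CT:
  assumes d: "0 < \<delta>" "\<delta> < I" and m: "m < M"
  shows "\<exists>C\<ge>0. \<forall>c. 0 < c \<longrightarrow> c < 1 \<longrightarrow>
    (\<integral>\<^sup>+\<omega>. stop_time (CT M K c) \<omega> \<partial>H m) \<le> ennreal (- ln c / (I - \<delta>) + C)"
proof -
  interpret P: prob_space "H m" by (rule prob_Pr)
  let ?b = "\<lambda>n. measure (H m) (late (real n * (I - \<delta>)) m n)"
  have sum: "summable ?b" using d m by (intro late_summable) auto
  have b0: "0 \<le> suminf ?b" using sum by (intro suminf_nonneg) auto
  have Id: "0 < I - \<delta>" using d by simp
  show ?thesis
  proof (intro exI[of _ "1 + suminf ?b"] conjI allI impI)
    fix c :: real assume c: "0 < c" "c < 1"
    have mp: "meas_policy (CT M K c)"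
      by (rule meas_policyI[OF _ admissible_CT]) (use M in simp)
    note [measurable] = live_meas[OF mp]
    have lnc: "0 < - ln c" using ln_less_zero[OF c] by simp
    define N0 where "N0 = nat \<lceil>- ln c / (I - \<delta>)\<rceil>"
    define x where "x = - ln c / (I - \<delta>)"
    have "0 \<le> x" using lnc Id unfolding x_def by (intro divide_nonneg_pos) simp_all
    then have "x \<le> real (nat \<lceil>x\<rceil>)" "real (nat \<lceil>x\<rceil>) \<le> x + 1" by linarith+
    then have N0: "- ln c / (I - \<delta>) \<le> real N0" "real N0 \<le> - ln c / (I - \<delta>) + 1"
      unfolding N0_def x_def by blast+
    have le: "ennreal (measure (H m) {\<omega>\<in>space Om. live (CT M K c) \<omega> (Suc n)}) \<le> ennreal (if n \<in> {..<N0} then 1 else 0) + ennreal (?b n)" for n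
    proof (cases "n < N0")
      case True
      have "ennreal (measure (H m) {\<omega>\<in>space Om. live (CT M K c) \<omega> (Suc n)}) \<le> ennreal 1"
        by (rule ennreal_leI) simp
      then show ?thesis using True by (simp add: add_increasing2)
    next
      case False
      then have "- ln c / (I - \<delta>) \<le> real n" using N0(1) by linarith
      then have v: "- ln c \<le> real n * (I - \<delta>)" using Id by (simp only: pos_divide_le_eq)
      have "{\<omega>\<in>space Om. live (CT M K c) \<omega> (Suc n)} \<subseteq> late (real n * (I - \<delta>)) m n"
        using live_late[OF c v m] by blast
      then show ?thesis using False by (auto intro!: ennreal_leI P.finite_measure_mono)
    qed
    have "(\<integral>\<^sup>+\<omega>. stop_time (CT M K c) \<omega> \<partial>H m) \<le> (\<Sum>n. ennreal (if n \<in> {..<N0} then 1 else 0) + ennreal (?b n))"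
      unfolding expected_stop_time[OF mp] by (intro suminf_le le) auto
    also have "\<dots> = (\<Sum>n. ennreal (if n \<in> {..<N0} then 1 else 0)) + (\<Sum>n. ennreal (?b n))"
      by (rule suminf_add[symmetric]) auto
    also have "(\<Sum>n. ennreal (if n \<in> {..<N0} then 1 else 0)) = ennreal (real N0)"
      by (subst suminf_finite[of "{..<N0}"]) (auto simp: ennreal_of_nat_eq_real_of_nat)
    also have "(\<Sum>n. ennreal (?b n)) = ennreal (suminf ?b)"
      using sum by (intro suminf_ennreal2) auto
    also have "ennreal (real N0) + ennreal (suminf ?b) = ennreal (real N0 + suminf ?b)"
      using b0 by simp
    also have "\<dots> \<le> ennreal (- ln c / (I - \<delta>) + (1 + suminf ?b))"
      using N0(2) by (intro ennreal_leI) simp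
    finally show "(\<integral>\<^sup>+\<omega>. stop_time (CT M K c) \<omega> \<partial>H m) \<le> ennreal (- ln c / (I - \<delta>) + (1 + suminf ?b))" .
  qed (use b0 in simp)
qed

end

section \<open>Asymptotic optimality\<close>

context chernoff_process
begin

lemma S_eq_sum: "S n i \<omega> = (\<Sum>t<n. if i \<in> Sel p \<omega> t then llr (fst \<omega> (t, i)) else 0)"
  by (induction n) (simp_all add: S_Suc del: hist.simps)

text \<open>The sums frozen in \<open>Lam\<close> are the statistics on which the test bases its
  decision.\<close>

lemma Lam_stopped:
  assumes k: "k \<le> n" "live (CT M K c) \<omega> k" "stopped (CT M K c) \<omega> k"
  shows "Lam (CT M K c) n i \<omega> = S k i \<omega>"
proof -
  have live: "live (CT M K c) \<omega> (Suc t) \<longleftrightarrow> t < k" for t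
  proof
    assume "live (CT M K c) \<omega> (Suc t)"
    then show "t < k" using k(3) unfolding live_def by (meson leI less_Suc_eq_le)
  qed (use k(2) in \<open>simp add: live_def\<close>)
  have "Lam (CT M K c) n i \<omega> = (\<Sum>t<n. if t < k \<and> i \<in> Sel p \<omega> t then llr (fst \<omega> (t, i)) else 0)"
    unfolding Lam_def act_def fst_conv snd_conv live Sel_CT_eq[of c] ..
  also have "\<dots> = (\<Sum>t<k. if i \<in> Sel p \<omega> t then llr (fst \<omega> (t, i)) else 0)"
    using k(1) by (intro sum.mono_neutral_cong_right) auto
  finally show ?thesis by (simp only: S_eq_sum)
qed

text \<open>Passing to \<open>H j\<close>, the hypothesis declared, weights the event by the
  likelihood ratio of \<open>m\<close> to \<open>j\<close>, and the stopping rule keeps this ratio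
  at most \<open>c\<close>.\<close>

lemma wrong_decision_CT:
  assumes c: "0 < c" "c < 1" and m: "m < M" "j < M" "j \<noteq> m"
  shows "measure (H m) {\<omega>\<in>space Om. ends (CT M K c) j n \<omega>} \<le> c"
proof -
  interpret P: prob_space "H m" by (rule prob_Pr)
  let ?p = "CT M K c"
  have mp: "meas_policy ?p" by (rule meas_policyI[OF _ admissible_CT]) (use M in simp)
  note [measurable] = ends_meas[OF mp]
  have "ennreal (measure (H m) {\<omega>\<in>space Om. ends ?p j n \<omega>}) = (\<integral>\<^sup>+\<omega>. indicator {\<omega>\<in>space Om. ends ?p j n \<omega>} \<omega> \<partial>H m)"
    by (simp add: P.emeasure_eq_measure)
  also have "\<dots> = (\<integral>\<^sup>+\<omega>. (if ends ?p j n \<omega> then 1 else 0) \<partial>H m)"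
    by (intro nn_integral_cong) auto
  also have "\<dots> = (\<integral>\<^sup>+\<omega>. (if ends ?p j n \<omega> then 1 else 0) * ennreal (exp (Lam ?p n m \<omega> - Lam ?p n j \<omega>)) \<partial>H j)"
  proof (rule likelihood_ratio[OF mp])
    fix \<omega> \<omega>' :: "'a sample" assume *: "\<And>i. fst i < n \<Longrightarrow> fst \<omega> i = fst \<omega>' i" "snd \<omega> = snd \<omega>'"
    show "(if ends ?p j n \<omega> then 1 else 0::ennreal) = (if ends ?p j n \<omega>' then 1 else 0)"
      using ends_rows[of n \<omega> \<omega>' ?p j] * by simp
  qed (simp_all add: ends_upd_inactive)
  also have "\<dots> \<le> (\<integral>\<^sup>+\<omega>. ennreal c \<partial>H j)"
  proof (rule nn_integral_mono)
    fix \<omega>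
    show "(if ends ?p j n \<omega> then 1 else 0) * ennreal (exp (Lam ?p n m \<omega> - Lam ?p n j \<omega>)) \<le> ennreal c"
    proof (cases "ends ?p j n \<omega>")
      case True
      then obtain k where k: "k \<le> n" "live ?p \<omega> k" "stopped ?p \<omega> k" "dec ?p (snd \<omega>) (hist ?p \<omega> k) = j"
        by (auto simp: ends_def)
      then have "ld k \<omega> = j" unfolding dec_CT hist_CT[of _ _ c] ld_def by simp
      then have "- ln c \<le> S k j \<omega> - S k m \<omega>" using k(3) m unfolding stopped_iff by auto
      then have "exp (S k m \<omega> - S k j \<omega>) \<le> exp (ln c)" by simp
      then show ?thesis using True c by (simp add: Lam_stopped[OF k(1-3)] ennreal_leI)
    qed simp
  qed
  also have "\<dots> = ennreal c" by simp
  finally show ?thesis using c by (simp add: ennreal_le_iff)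
qed

text \<open>There are fewer than \<open>M\<close> wrong decisions, each of probability at most
  \<open>c\<close>. Never stopping is also an error, but a null event because the expected stopping
  time is finite.\<close>

lemma alpha_CT:
  assumes c: "0 < c" "c < 1" and m: "m < M"
  shows "alpha (CT M K c) m \<le> real M * c"
proof -
  interpret P: prob_space "H m" by (rule prob_Pr)
  let ?p = "CT M K c" and ?J = "{..<M} - {m}"
  have mp: "meas_policy ?p" by (rule meas_policyI[OF _ admissible_CT]) (use M in simp)
  note [measurable] = ends_meas[OF mp] live_meas[OF mp] decision_error_meas[OF mp]
  let ?E = "\<lambda>j. \<Union>n. {\<omega>\<in>space Om. ends ?p j n \<omega>}"
  have E: "?E j \<in> sets (H m)" for j by measurable
  have le_c: "measure (H m) (?E j) \<le> c" if j: "j \<in> ?J" for j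
  proof (rule LIMSEQ_le_const2)
    show "(\<lambda>n. measure (H m) {\<omega>\<in>space Om. ends ?p j n \<omega>}) \<longlonglongrightarrow> measure (H m) (?E j)"
      by (rule P.finite_Lim_measure_incseq[OF _ ends_incseq]) auto
    show "\<exists>N. \<forall>n\<ge>N. measure (H m) {\<omega>\<in>space Om. ends ?p j n \<omega>} \<le> c"
      using wrong_decision_CT[OF c m] j by blast
  qed
  \<comment> \<open>Any \<open>\<delta>\<close> in \<open>(0, I)\<close> would do; only finiteness
    is extracted.\<close>
  obtain C where C: "(\<integral>\<^sup>+\<omega>. stop_time ?p \<omega> \<partial>H m) \<le> ennreal (- ln c / (I - I / 2) + C)"
    using expected_stop_time_CT[of "I / 2" m] I_pos m c by force
  have [measurable]: "stop_time ?p \<in> borel_measurable Om"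
    unfolding stop_time_eq[abs_def] by measurable
  have "(\<integral>\<^sup>+\<omega>. stop_time ?p \<omega> \<partial>H m) \<noteq> \<infinity>" using C by (metis ennreal_less_top infinity_ennreal_def leD)
  then have fin: "AE \<omega> in H m. stop_time ?p \<omega> \<noteq> \<infinity>"
    by (intro nn_integral_noteq_infinite) measurable
  have "measure (H m) {\<omega>\<in>space Om. decision_error ?p m \<omega>} \<le> measure (H m) (\<Union>j\<in>?J. ?E j)"
  proof (rule P.finite_measure_mono_AE)
    show "AE \<omega> in H m. \<omega> \<in> {\<omega>\<in>space Om. decision_error ?p m \<omega>} \<longrightarrow> \<omega> \<in> (\<Union>j\<in>?J. ?E j)"
      using fin
    proof eventually_elim
      case (elim \<omega>)
      show ?case
      proof
        assume err: "\<omega> \<in> {\<omega>\<in>space Om. decision_error ?p m \<omega>}"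
        have ex: "\<exists>n. stopped ?p \<omega> n" using elim by (auto simp: stop_time_def split: if_splits)
        define k where "k = (LEAST n. stopped ?p \<omega> n)"
        have k: "stopped ?p \<omega> k" "live ?p \<omega> k"
          unfolding k_def live_def by (rule LeastI_ex[OF ex]) (auto dest: not_less_Least)
        let ?j = "dec ?p (snd \<omega>) (hist ?p \<omega> k)"
        have "ends ?p ?j k \<omega>" unfolding ends_def using k by blast
        moreover have "?j < M" unfolding dec_CT by (rule leader_less[OF M])
        moreover have "?j \<noteq> m" using err ex unfolding decision_error_def k_def by blast
        ultimately show "\<omega> \<in> (\<Union>j\<in>?J. ?E j)" using err by blast
      qed
    qed
    show "(\<Union>j\<in>?J. ?E j) \<in> sets (H m)" by (rule sets.finite_UN) (simp, rule E)
  qed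
  also have "\<dots> \<le> (\<Sum>j\<in>?J. measure (H m) (?E j))" by (rule measure_UNION_le) (simp, rule E)
  also have "\<dots> \<le> (\<Sum>j\<in>?J. c)" by (intro sum_mono le_c)
  also have "\<dots> \<le> real M * c" using c m by (simp only: sum_constant) (intro mult_right_mono, auto)
  finally show ?thesis by (simp add: alpha_def)
qed

lemma bayes_risk_CT_upper:
  assumes d: "0 < \<delta>" "\<delta> < I" and prior: "\<forall>m<M. 0 < \<pi> m" "(\<Sum>m<M. \<pi> m) = 1"
  shows "\<exists>C. \<forall>c. 0 < c \<longrightarrow> c < 1 \<longrightarrow>
    bayes_risk M \<mu> f g \<pi> c (CT M K c) \<le> ennreal (c * (- ln c / (I - \<delta>) + C))"
proof -
  have "\<forall>m\<in>{..<M}. \<exists>C\<ge>0. \<forall>c. 0 < c \<longrightarrow> c < 1 \<longrightarrow>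
    (\<integral>\<^sup>+\<omega>. stop_time (CT M K c) \<omega> \<partial>H m) \<le> ennreal (- ln c / (I - \<delta>) + C)"
    using expected_stop_time_CT[OF d] by blast
  from bchoice[OF this] obtain B where B: "\<And>m. m < M \<Longrightarrow> 0 \<le> B m"
    "\<And>m c. m < M \<Longrightarrow> 0 < c \<Longrightarrow> c < 1 \<Longrightarrow> (\<integral>\<^sup>+\<omega>. stop_time (CT M K c) \<omega> \<partial>H m) \<le> ennreal (- ln c / (I - \<delta>) + B m)"
    by auto
  define C where "C = (\<Sum>m<M. B m)"
  have BC: "B m \<le> C" if "m < M" for m
    unfolding C_def using B(1) that by (intro member_le_sum) auto
  have C0: "0 \<le> C" unfolding C_def using B(1) by (intro sum_nonneg) auto
  show ?thesis
  \<comment> \<open>\<open>real M\<close> pays for the error probabilities, which are at most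
    \<open>M * c\<close>.\<close>
  proof (intro exI[of _ "real M + C"] allI impI)
    fix c :: real assume c: "0 < c" "c < 1"
    have pi0: "0 \<le> \<pi> m" if "m < M" for m using prior(1) that by (auto intro: less_imp_le)
    have T0: "0 \<le> - ln c / (I - \<delta>)" using ln_less_zero[OF c] d by (intro divide_nonneg_pos) auto
    have w: "(\<Sum>m<M. ennreal (\<pi> m) * ennreal x) = ennreal x" if "0 \<le> x" for x
    proof -
      have "(\<Sum>m<M. ennreal (\<pi> m) * ennreal x) = (\<Sum>m<M. ennreal (\<pi> m * x))"
        using pi0 that by (intro sum.cong refl) (simp add: ennreal_mult)
      also have "\<dots> = ennreal (\<Sum>m<M. \<pi> m * x)" using pi0 that by (intro sum_ennreal) auto
      finally show ?thesis by (simp add: sum_distrib_right[symmetric] prior(2))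
    qed
    have "bayes_risk M \<mu> f g \<pi> c (CT M K c) = (\<Sum>m<M. ennreal (\<pi> m) * ennreal (alpha (CT M K c) m))
      + ennreal c * (\<Sum>m<M. ennreal (\<pi> m) * (\<integral>\<^sup>+\<omega>. stop_time (CT M K c) \<omega> \<partial>H m))"
      by (rule bayes_risk_eq[OF M K admissible_CT])
    also have "\<dots> \<le> (\<Sum>m<M. ennreal (\<pi> m) * ennreal (real M * c))
      + ennreal c * (\<Sum>m<M. ennreal (\<pi> m) * ennreal (- ln c / (I - \<delta>) + C))"
    proof (intro add_mono mult_left_mono sum_mono)
      fix m assume "m \<in> {..<M}"
      then have m: "m < M" by simp
      show "ennreal (alpha (CT M K c) m) \<le> ennreal (real M * c)" by (rule ennreal_leI[OF alpha_CT[OF c m]])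
      show "(\<integral>\<^sup>+\<omega>. stop_time (CT M K c) \<omega> \<partial>H m) \<le> ennreal (- ln c / (I - \<delta>) + C)"
        by (rule order_trans[OF B(2)[OF m c]]) (use BC[OF m] in \<open>simp add: ennreal_leI\<close>)
    qed simp_all
    also have "\<dots> = ennreal (real M * c) + ennreal c * ennreal (- ln c / (I - \<delta>) + C)"
      using c T0 C0 by (simp only: w mult_nonneg_nonneg of_nat_0_le_iff less_imp_le add_nonneg_nonneg)
    also have "\<dots> = ennreal (real M * c + c * (- ln c / (I - \<delta>) + C))"
    proof -
      have "ennreal c * ennreal (- ln c / (I - \<delta>) + C) = ennreal (c * (- ln c / (I - \<delta>) + C))"
        by (rule ennreal_mult[symmetric]) (use c T0 C0 in auto)
      moreover have "0 \<le> c * (- ln c / (I - \<delta>) + C)" using c T0 C0 by simp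
      ultimately show ?thesis using c by (simp add: ennreal_plus)
    qed
    also have "real M * c + c * (- ln c / (I - \<delta>) + C) = c * (- ln c / (I - \<delta>) + (real M + C))"
      by (simp add: algebra_simps)
    finally show "bayes_risk M \<mu> f g \<pi> c (CT M K c) \<le> ennreal (c * (- ln c / (I - \<delta>) + (real M + C)))" .
  qed
qed

text \<open>With \<open>a = - ln c - b\<close> the smallness condition and the bound involve only
  \<open>c\<close>, the prior and \<open>I\<close>, not the policy, so the bound passes to the
  infimum.\<close>

lemma optimal_risk_lower:
  assumes prior: "\<forall>m<M. 0 < \<pi> m" "(\<Sum>m<M. \<pi> m) = 1"
  shows "\<exists>b. \<forall>\<^sub>F c in at_right 0.
    ennreal (c * (- ln c - b) / I) \<le> (INF p\<in>{p. admissible M K \<mu> f g p}. bayes_risk M \<mu> f g \<pi> c p)"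
proof -
  define q where "q = Min (\<pi> ` {..<M})"
  have "\<pi> 0 \<in> \<pi> ` {..<M}" using M by simp
  then have ne: "\<pi> ` {..<M} \<noteq> {}" by blast
  have q: "0 < q" "\<And>m. m < M \<Longrightarrow> q \<le> \<pi> m"
    using prior(1) ne unfolding q_def by (auto simp: Min_gr_iff)
  \<comment> \<open>chosen so that \<open>c * exp (- ln c - b) / q = I / 2\<close>\<close>
  define b where "b = - ln (I * q / 2)"
  have "((\<lambda>c. c * (- ln c - b)) \<longlongrightarrow> 0) (at_right 0)" by real_asymp
  then have "\<forall>\<^sub>F c in at_right 0. c * (- ln c - b) < I / 2"
    by (rule order_tendstoD(2)) (use I_pos in simp)
  moreover have "\<forall>\<^sub>F c::real in at_right 0. 0 \<le> - ln c - b" by real_asymp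
  moreover have "\<forall>\<^sub>F c::real in at_right 0. 0 < c" by (rule eventually_at_right_less)
  ultimately have "\<forall>\<^sub>F c in at_right 0.
    ennreal (c * (- ln c - b) / I) \<le> (INF p\<in>{p. admissible M K \<mu> f g p}. bayes_risk M \<mu> f g \<pi> c p)"
  proof eventually_elim
    case (elim c)
    have "0 < I * q / 2" using I_pos q by simp
    then have "exp (- ln c - b) = (I * q / 2) / c"
      using elim(3) by (simp add: b_def exp_diff exp_minus field_simps)
    then have "c * ((- ln c - b) + exp (- ln c - b) / q) = c * (- ln c - b) + I / 2"
      using elim(3) q(1) by (simp add: distrib_left)
    then have small: "c * ((- ln c - b) + exp (- ln c - b) / q) \<le> I" using elim(1) by simp
    show ?case
      by (rule INF_greatest)
         (use bayes_risk_lower[OF M K _ elim(3,2) prior q small] in blast)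
  qed
  then show ?thesis by blast
qed

end

text \<open>Additive errors of order \<open>c\<close> disappear relative to
  \<open>- c * ln c\<close>. The remaining factor \<open>J / (J - \<delta>)\<close> is close to 1
  for small \<open>\<delta>\<close>, and \<open>C\<close> may depend on \<open>\<delta>\<close>
  because \<open>\<delta>\<close> is fixed before \<open>c\<close> tends to 0. The statement serves
  the risk of the test and the optimal risk alike.\<close>

lemma risk_ratio_limit:
  fixes R :: "real \<Rightarrow> ennreal"
  assumes J: "0 < J"
    and lower: "\<forall>\<^sub>F c in at_right 0. ennreal (c * (- ln c - b) / J) \<le> R c"
    and upper: "\<And>\<delta>. 0 < \<delta> \<Longrightarrow> \<delta> < J \<Longrightarrow> \<exists>C. \<forall>\<^sub>F c in at_right 0. R c \<le> ennreal (c * (- ln c / (J - \<delta>) + C))"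
  shows "((\<lambda>c. enn2real (R c) / (- c * ln c / J)) \<longlongrightarrow> 1) (at_right 0)"
proof (rule order_tendstoI)
  have small: "\<forall>\<^sub>F c::real in at_right 0. 0 < c \<and> 0 < - ln c"
    by (intro eventually_conj eventually_at_right_less) real_asymp
  \<comment> \<open>\<open>enn2real\<close> sends infinity to 0, so a lower bound in
    \<open>ennreal\<close> passes to the reals only where the risk is finite.\<close>
  have finite: "\<forall>\<^sub>F c in at_right 0. R c < \<infinity>"
  proof -
    obtain C where "\<forall>\<^sub>F c in at_right 0. R c \<le> ennreal (c * (- ln c / (J - J / 2) + C))"
      using upper[of "J / 2"] J by auto
    then show ?thesis by eventually_elim (auto intro: le_less_trans)
  qed
  fix x :: real
  {
    assume x: "x < 1"
    have "((\<lambda>c. 1 + b / ln c) \<longlongrightarrow> 1) (at_right 0)" by real_asymp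
    then have "\<forall>\<^sub>F c in at_right 0. x < 1 + b / ln c" using x by (rule order_tendstoD(1))
    then show "\<forall>\<^sub>F c in at_right 0. x < enn2real (R c) / (- c * ln c / J)"
      using lower small finite
    proof eventually_elim
      case (elim c)
      have "0 < c * (- ln c)" using elim(3) by (intro mult_pos_pos) simp_all
      from divide_pos_pos[OF this J] have pos: "0 < - c * ln c / J" by simp
      have "c * (- ln c - b) / J \<le> enn2real (R c)"
        using elim(2,4) by (cases "R c") (auto simp: ennreal_le_iff2)
      moreover have "c * (- ln c - b) / J = (1 + b / ln c) * (- c * ln c / J)"
        using elim(3) J by (auto simp: field_simps)
      ultimately have "(1 + b / ln c) \<le> enn2real (R c) / (- c * ln c / J)"
        using pos by (simp only: pos_le_divide_eq)
      then show ?case using elim(1) by linarith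
    qed
  next
    assume x: "1 < x"
    \<comment> \<open>\<open>J / (J - y) = x\<close> exactly; halving \<open>y\<close> makes the
      inequality strict.\<close>
    define y where "y = J * (1 - 1 / x)"
    define \<delta> where "\<delta> = y / 2"
    have u: "0 < 1 - 1 / x" "1 - 1 / x < 1" using x by auto
    have "y < J" unfolding y_def using mult_strict_left_mono[OF u(2) J] by simp
    moreover have "0 < y" unfolding y_def using J u(1) by (rule mult_pos_pos)
    ultimately have d: "0 < \<delta>" "\<delta> < J" by (simp_all add: \<delta>_def)
    have "J / (J - \<delta>) < x"
    proof -
      have "J < x * (J - \<delta>)"
      proof -
        have "x * (J - \<delta>) = J * (x + 1) / 2" using x by (simp add: \<delta>_def y_def field_simps)
        also have "\<dots> > J" using x J by (simp add: field_simps)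
        finally show ?thesis .
      qed
      then show ?thesis using d by (simp add: pos_divide_less_eq)
    qed
    moreover obtain C where C: "\<forall>\<^sub>F c in at_right 0. R c \<le> ennreal (c * (- ln c / (J - \<delta>) + C))"
      using upper[OF d] by blast
    have "((\<lambda>c. J / (J - \<delta>) - C * J / ln c) \<longlongrightarrow> J / (J - \<delta>)) (at_right 0)" by real_asymp
    ultimately have "\<forall>\<^sub>F c in at_right 0. J / (J - \<delta>) - C * J / ln c < x"
      by (intro order_tendstoD(2))
    then show "\<forall>\<^sub>F c in at_right 0. enn2real (R c) / (- c * ln c / J) < x"
      using C small
    proof eventually_elim
      case (elim c)
      have "0 < c * (- ln c)" using elim(3) by (intro mult_pos_pos) simp_all
      from divide_pos_pos[OF this J] have pos: "0 < - c * ln c / J" by simp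
      have eq: "c * (- ln c / (J - \<delta>) + C) = (J / (J - \<delta>) - C * J / ln c) * (- c * ln c / J)"
      proof -
        have nz: "ln c \<noteq> 0" "J \<noteq> 0" using elim(3) J by auto
        have "J / (J - \<delta>) * (- c * ln c / J) = c * (- ln c / (J - \<delta>))" using nz(2) by simp
        moreover have "C * J / ln c * (- c * ln c / J) = - (c * C)" using nz by simp
        ultimately show ?thesis by (simp only: left_diff_distrib distrib_left)
      qed
      have "enn2real (R c) < x * (- c * ln c / J)"
      proof (cases "0 \<le> c * (- ln c / (J - \<delta>) + C)")
        case True
        then have "enn2real (R c) \<le> c * (- ln c / (J - \<delta>) + C)" using elim(2) by (rule enn2real_leI)
        also have "\<dots> < x * (- c * ln c / J)" unfolding eq using elim(1) pos by (rule mult_strict_right_mono)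
        finally show ?thesis .
      next
        \<comment> \<open>The real bound is negative here, and \<open>ennreal\<close> truncates it
          to 0.\<close>
        case False
        then have "R c = 0" using elim(2) by (simp add: ennreal_neg)
        then have "enn2real (R c) = 0" by simp
        moreover have "0 < x * (- c * ln c / J)" by (rule mult_pos_pos[OF _ pos]) (use x in simp)
        ultimately show ?thesis by (simp only:)
      qed
      then show ?case using pos by (simp only: pos_divide_less_eq)
    qed
  }
qed

theorem theorem2:
  fixes \<mu> :: "'a measure" and f g :: "'a \<Rightarrow> real" and \<pi> :: "nat \<Rightarrow> real" and M K :: nat
  assumes M: "2 \<le> M" and K: "1 \<le> K" "K \<le> M"
    and prior: "\<forall>m<M. 0 < \<pi> m \<and> \<pi> m < 1" "(\<Sum>m<M. \<pi> m) = 1"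
    and f_meas: "f \<in> borel_measurable \<mu>" and g_meas: "g \<in> borel_measurable \<mu>"
    and f_nonneg: "\<forall>x\<in>space \<mu>. 0 \<le> f x" and g_nonneg: "\<forall>x\<in>space \<mu>. 0 \<le> g x"
    and f_prob: "(\<integral>\<^sup>+x. ennreal (f x) \<partial>\<mu>) = 1" and g_prob: "(\<integral>\<^sup>+x. ennreal (g x) \<partial>\<mu>) = 1"
    and mutual_ac: "AE x in \<mu>. (f x = 0 \<longleftrightarrow> g x = 0)"
    and Dgf_fin: "integrable \<mu> (\<lambda>x. g x * ln (g x / f x))"
    and Dfg_fin: "integrable \<mu> (\<lambda>x. f x * ln (f x / g x))"
    and Dgf_pos: "0 < KL \<mu> g f" and Dfg_pos: "0 < KL \<mu> f g"
    and mgf_f: "\<exists>\<epsilon>>0. \<forall>t. \<bar>t\<bar> < \<epsilon> \<longrightarrow>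
                  integrable (density \<mu> (\<lambda>x. ennreal (f x))) (\<lambda>y. exp (t * ln (g y / f y)))"
    and mgf_g: "\<exists>\<epsilon>>0. \<forall>t. \<bar>t\<bar> < \<epsilon> \<longrightarrow>
                  integrable (density \<mu> (\<lambda>x. ennreal (g x))) (\<lambda>y. exp (t * ln (g y / f y)))"
  shows "((\<lambda>c. enn2real (bayes_risk M \<mu> f g \<pi> c (chernoff_test M K \<mu> f g c))
                / (- c * ln c / Istar M K (KL \<mu> g f) (KL \<mu> f g))) \<longlongrightarrow> 1) (at_right 0) \<and>
         ((\<lambda>c. enn2real (INF p\<in>{p. admissible M K \<mu> f g p}. bayes_risk M \<mu> f g \<pi> c p)
                / (- c * ln c / Istar M K (KL \<mu> g f) (KL \<mu> f g))) \<longlongrightarrow> 1) (at_right 0)"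
proof -
  interpret chernoff_process \<mu> f g M K
    by unfold_locales (use assms in auto)
  have pi: "\<forall>m<M. 0 < \<pi> m" using prior(1) by blast
  let ?R = "\<lambda>c. bayes_risk M \<mu> f g \<pi> c (chernoff_test M K \<mu> f g c)"
  let ?O = "\<lambda>c. INF p\<in>{p. admissible M K \<mu> f g p}. bayes_risk M \<mu> f g \<pi> c p"
  \<comment> \<open>The infimum lies between the universal lower bound and the risk of the test, so
    each of the two quantities inherits both bounds.\<close>
  have le: "?O c \<le> ?R c" for c
    by (rule INF_lower) (use admissible_CT in blast)
  obtain b where b: "\<forall>\<^sub>F c in at_right 0. ennreal (c * (- ln c - b) / I) \<le> ?O c"
    using optimal_risk_lower[OF pi prior(2)] by blast
  have R_lower: "\<forall>\<^sub>F c in at_right 0. ennreal (c * (- ln c - b) / I) \<le> ?R c"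
    using b by eventually_elim (rule order_trans[OF _ le])
  have R_upper: "\<exists>C. \<forall>\<^sub>F c in at_right 0. ?R c \<le> ennreal (c * (- ln c / (I - \<delta>) + C))" if \<delta>: "0 < \<delta>" "\<delta> < I" for \<delta>
  proof -
    obtain C where "\<forall>c. 0 < c \<longrightarrow> c < 1 \<longrightarrow> ?R c \<le> ennreal (c * (- ln c / (I - \<delta>) + C))"
      using bayes_risk_CT_upper[OF \<delta> pi prior(2)] by blast
    moreover have "\<forall>\<^sub>F c::real in at_right 0. 0 < c \<and> c < 1"
      unfolding eventually_at_right_field by (intro exI[of _ 1]) simp
    ultimately have "\<forall>\<^sub>F c in at_right 0. ?R c \<le> ennreal (c * (- ln c / (I - \<delta>) + C))"
      by (auto elim: eventually_mono)
    then show ?thesis by blast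
  qed
  have O_upper: "\<exists>C. \<forall>\<^sub>F c in at_right 0. ?O c \<le> ennreal (c * (- ln c / (I - \<delta>) + C))" if \<delta>: "0 < \<delta>" "\<delta> < I" for \<delta>
  proof -
    obtain C where "\<forall>\<^sub>F c in at_right 0. ?R c \<le> ennreal (c * (- ln c / (I - \<delta>) + C))"
      using R_upper[OF \<delta>] by blast
    then have "\<forall>\<^sub>F c in at_right 0. ?O c \<le> ennreal (c * (- ln c / (I - \<delta>) + C))"
      by eventually_elim (rule order_trans[OF le])
    then show ?thesis by blast
  qed
  show ?thesis
    using risk_ratio_limit[OF I_pos R_lower R_upper] risk_ratio_limit[OF I_pos b O_upper] by blast
qed

end
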